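(* Let $\theta(x_1,x_2,t)$ be a smooth solution of the 2D quasi-geostrophic equation defined for $0\le t<T_*$, $(x_1,x_2)\in\mathbb{R}^2$, where $T_*<\infty$. Assume for $0\le t<T_*$ that $\theta$ is constant along the curves $\rho=\text{const}$ of a simple hyperbolic saddle in a neighborhood $U$ of the origin. Assume also, for each fixed $t$, that $\theta$ is not constant on any disc in $U$. Let $\gamma(t)$ denote the angle of opening of the saddle. Then $\lim_{t\to T_*}\gamma(t)$ exists and is not $0$.
   Context: Quasi-geostrophic equation: $(\partial_t+u\cdot\nabla)\theta=0$ on $\mathbb{R}^2$, where $u=\nabla^\perp\psi=(-\partial_{x_2}\psi,\partial_{x_1}\psi)$ and $\theta=-(-\Delta)^{1/2}\psi$, with initial condition $\theta(x,0)=\theta_0(x)$. The function $\theta$ is bounded for all time and $\theta(\cdot,t)\in L^2(\mathbb{R}^2)$ with $L^2$ norm independent of $t$. Simple hyperbolic saddle in a neighborhood $U$ of the origin: the set of curves $\rho=\text{const}$, where $\rho=(y_1\beta(t)+y_2)(y_1\delta(t)-y_2)$ and there is a nonlinear time-dependent coordinate change $y_1=F_1(x_1,x_2,t)$, $y_2=F_2(x_1,x_2,t)$, with $\beta,\delta\in C^1([0,T_* ))$, $F_i\in C^2(\overline U\times[0,T_*])$, $|\beta|,|\delta|\le C$, $\beta(t)+\delta(t)\ge0$, and $\left|\det\frac{\partial F_i}{\partial x_j}\right|\ge c>0$ whenever $x\in U$, $t\in[0,T_*]$. The center of the saddle can move in $U$ with time. The angle of opening of the saddle is $\gamma\simeq\beta+\delta$,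 with $\frac{d\gamma}{dt}=\frac{d\delta}{dt}+\frac{d\beta}{dt}$.
   Formalization: It is additionally assumed that the opening angle γ=β+δ is not identically 0 on [0,T_* ): β+δ≥0 alone allows γ≡0 (e.g. a steady radial θ), where the claim fails. The center of the saddle is read as lying in U for all t in [0,T_*]. *)

theory Defs
  imports "HOL-Analysis.Analysis"
begin

section \<open>Differentiability classes\<close>

primrec iter_partial :: "'a::euclidean_space list \<Rightarrow> ('a \<Rightarrow> real) \<Rightarrow> 'a \<Rightarrow> real" where
  "iter_partial [] f = f"
| "iter_partial (b # bs) f = (\<lambda>x. frechet_derivative (iter_partial bs f) (at x) b)"

text \<open>
  The class of functions that are \<open>k\<close> times continuously differentiable on the open set \<open>D\<close> and
  whose partial derivatives of order at most \<open>k\<close> (order \<open>0\<close> included) extend continuously to \<open>E\<close>,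
  where \<open>D \<subseteq> E \<subseteq> closure D\<close>. It is the usual meaning of, for instance, \<open>C\<^sup>2(closure U \<times> [0, T])\<close>,
  with \<open>D = U \<times> (0, T)\<close>.
\<close>

definition C_upto :: "nat \<Rightarrow> 'a::euclidean_space set \<Rightarrow> 'a set \<Rightarrow> ('a \<Rightarrow> real) \<Rightarrow> bool" where
  "C_upto k D E f \<longleftrightarrow>
     continuous_on E f \<and>
     (\<forall>bs. set bs \<subseteq> Basis \<and> length bs < k \<longrightarrow>
        (\<forall>x\<in>D. iter_partial bs f differentiable (at x))) \<and>
     (\<forall>bs. set bs \<subseteq> Basis \<and> length bs \<le> k \<longrightarrow>
        (\<exists>g. continuous_on E g \<and> (\<forall>x\<in>D. g x = iter_partial bs f x)))"

definition smooth_upto :: "'a::euclidean_space set \<Rightarrow> 'a set \<Rightarrow> ('a \<Rightarrow> real) \<Rightarrow> bool" where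
  "smooth_upto D E f \<longleftrightarrow> (\<forall>k. C_upto k D E f)"

definition schwartz :: "('a::euclidean_space \<Rightarrow> real) \<Rightarrow> bool" where
  "schwartz \<phi> \<longleftrightarrow>
     (\<forall>bs. set bs \<subseteq> Basis \<longrightarrow>
        (\<forall>x. iter_partial bs \<phi> differentiable (at x)) \<and>
        (\<forall>n::nat. bounded (range (\<lambda>x. norm x ^ n * iter_partial bs \<phi> x))))"

definition grad :: "(real^2 \<Rightarrow> real) \<Rightarrow> real^2 \<Rightarrow> real^2" where
  "grad f x = (\<chi> i. frechet_derivative f (at x) (axis i 1))"

definition perp_grad :: "(real^2 \<Rightarrow> real) \<Rightarrow> real^2 \<Rightarrow> real^2" where
  "perp_grad f x = vector [- (grad f x $ 2), grad f x $ 1]"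

section \<open>The operator \<open>(-\<Delta>)\<^bsup>1/2\<^esup>\<close> in the plane\<close>

definition fourier :: "(real^2 \<Rightarrow> real) \<Rightarrow> real^2 \<Rightarrow> complex" where
  "fourier \<phi> \<xi> = (LINT x|lborel. complex_of_real (\<phi> x) * cis (- (x \<bullet> \<xi>)))"

text \<open>
  On Schwartz functions \<open>(-\<Delta>)\<^bsup>1/2\<^esup>\<close> is the Fourier multiplier \<open>\<bar>\<xi>\<bar>\<close>. For real \<open>\<phi>\<close> the inversion
  integral is real, so taking the real part only adjusts the type.
\<close>

definition half_laplacian :: "(real^2 \<Rightarrow> real) \<Rightarrow> real^2 \<Rightarrow> real" where
  "half_laplacian \<phi> x =
     Re ((LINT \<xi>|lborel. complex_of_real (norm \<xi>) * fourier \<phi> \<xi> * cis (x \<bullet> \<xi>)) / (2 * pi)\<^sup>2)"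

text \<open>
  \<open>has_half_laplacian f g\<close> states \<open>(-\<Delta>)\<^bsup>1/2\<^esup> f = g\<close>. The stream function need not be square
  integrable, so the multiplier is extended by duality. As \<open>half_laplacian \<phi>\<close> decays only like
  \<open>\<bar>x\<bar>\<^bsup>-3\<^esup>\<close>, the pairing requires the weighted integrability of \<open>f\<close>, the standard condition for
  this extension; it leaves \<open>f\<close> determined by \<open>g\<close> up to an additive constant.
\<close>

definition has_half_laplacian :: "(real^2 \<Rightarrow> real) \<Rightarrow> (real^2 \<Rightarrow> real) \<Rightarrow> bool" where
  "has_half_laplacian f g \<longleftrightarrow>
     integrable lborel (\<lambda>x. f x / (1 + norm x) ^ 3) \<and>
     (\<forall>\<phi>. schwartz \<phi> \<longrightarrow>
        (LINT x|lborel. f x * half_laplacian \<phi> x) = (LINT x|lborel. g x * \<phi> x))"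

section \<open>Smooth solutions of the quasi-geostrophic equation\<close>

text \<open>
  The stream function only enters through its spatial gradient at fixed times, hence no
  regularity of \<open>\<psi>\<close> in time is required. The time derivative is one-sided at \<open>t = 0\<close>.
\<close>

definition smooth_qg_solution ::
  "real \<Rightarrow> (real^2 \<Rightarrow> real) \<Rightarrow> (real^2 \<Rightarrow> real \<Rightarrow> real) \<Rightarrow> (real^2 \<Rightarrow> real \<Rightarrow> real) \<Rightarrow> bool" where
  "smooth_qg_solution T \<theta>0 \<theta> \<psi> \<longleftrightarrow>
     smooth_upto (UNIV \<times> {0<..<T}) (UNIV \<times> {0..<T}) (\<lambda>(x, t). \<theta> x t) \<and>
     (\<forall>t\<in>{0..<T}. smooth_upto UNIV UNIV (\<lambda>x. \<psi> x t)) \<and>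
     (\<forall>t\<in>{0..<T}. has_half_laplacian (\<lambda>x. \<psi> x t) (\<lambda>x. - \<theta> x t)) \<and>
     (\<forall>x. \<forall>t\<in>{0..<T}.
        ((\<lambda>s. \<theta> x s) has_real_derivative
           - (perp_grad (\<lambda>z. \<psi> z t) x \<bullet> grad (\<lambda>z. \<theta> z t) x)) (at t within {0..<T})) \<and>
     (\<forall>x. \<theta> x 0 = \<theta>0 x) \<and>
     (\<exists>M. \<forall>x. \<forall>t\<in>{0..<T}. \<bar>\<theta> x t\<bar> \<le> M) \<and>
     (\<forall>t\<in>{0..<T}. integrable lborel (\<lambda>x. (\<theta> x t)\<^sup>2) \<and>
        (LINT x|lborel. (\<theta> x t)\<^sup>2) = (LINT x|lborel. (\<theta>0 x)\<^sup>2))"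

section \<open>Simple hyperbolic saddles\<close>

definition saddle_rho ::
  "(real \<Rightarrow> real) \<Rightarrow> (real \<Rightarrow> real) \<Rightarrow> (real^2 \<Rightarrow> real \<Rightarrow> real^2) \<Rightarrow> real^2 \<Rightarrow> real \<Rightarrow> real" where
  "saddle_rho \<beta> \<delta> F x t =
     (F x t $ 1 * \<beta> t + F x t $ 2) * (F x t $ 1 * \<delta> t - F x t $ 2)"

definition opening_angle :: "(real \<Rightarrow> real) \<Rightarrow> (real \<Rightarrow> real) \<Rightarrow> real \<Rightarrow> real" where
  "opening_angle \<beta> \<delta> t = \<beta> t + \<delta> t"

text \<open>
  The center of the saddle at time \<open>t\<close> is the point \<open>x\<close> with \<open>F x t = 0\<close>. It moves in \<open>U\<close> over
  the closed time interval on which the coordinate change \<open>F\<close> is defined.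
\<close>

definition simple_saddle ::
  "real \<Rightarrow> (real^2) set \<Rightarrow> (real \<Rightarrow> real) \<Rightarrow> (real \<Rightarrow> real) \<Rightarrow> (real^2 \<Rightarrow> real \<Rightarrow> real^2) \<Rightarrow> bool"
where
  "simple_saddle T U \<beta> \<delta> F \<longleftrightarrow>
     open U \<and> 0 \<in> U \<and>
     C_upto 1 {0<..<T} {0..<T} \<beta> \<and> C_upto 1 {0<..<T} {0..<T} \<delta> \<and>
     (\<forall>i. C_upto 2 (U \<times> {0<..<T}) (closure U \<times> {0..T}) (\<lambda>(x, t). F x t $ i)) \<and>
     (\<exists>C. \<forall>t\<in>{0..<T}. \<bar>\<beta> t\<bar> \<le> C \<and> \<bar>\<delta> t\<bar> \<le> C) \<and>
     (\<forall>t\<in>{0..<T}. 0 \<le> \<beta> t + \<delta> t) \<and>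
     (\<exists>c>0. \<forall>x\<in>U. \<forall>t\<in>{0..T}.
        c \<le> \<bar>det (matrix (frechet_derivative (\<lambda>z. F z t) (at x)))\<bar>) \<and>
     (\<forall>t\<in>{0..T}. inj_on (\<lambda>x. F x t) U) \<and>
     (\<forall>t\<in>{0..T}. \<exists>x\<in>U. F x t = 0)"

text \<open>
  A curve \<open>\<rho> = const\<close> is a connected component of a level set of \<open>\<rho>\<close> in \<open>U\<close>: different branches
  of one level set may carry different values of \<open>\<theta>\<close>.
\<close>

definition constant_along_saddle ::
  "real \<Rightarrow> (real^2) set \<Rightarrow> (real \<Rightarrow> real) \<Rightarrow> (real \<Rightarrow> real) \<Rightarrow> (real^2 \<Rightarrow> real \<Rightarrow> real^2) \<Rightarrow>
   (real^2 \<Rightarrow> real \<Rightarrow> real) \<Rightarrow> bool" where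
  "constant_along_saddle T U \<beta> \<delta> F \<theta> \<longleftrightarrow>
     (\<forall>t\<in>{0..<T}. \<forall>k. \<forall>\<Gamma>\<in>components {x\<in>U. saddle_rho \<beta> \<delta> F x t = k}.
        (\<lambda>x. \<theta> x t) constant_on \<Gamma>)"

end

theory Submission
  imports Defs "HOL-Probability.Probability" "HOL-Real_Asymp.Real_Asymp"
begin

text \<open>
  Testing \<open>(-\<Delta>)\<^bsup>1/2\<^esup> \<psi> = - \<theta>\<close> against translated heat kernels \<open>p\<close> and integrating over their widths
  \<open>\<sigma>\<close> represents differences of \<open>\<psi>\<close> as \<open>\<integral> (\<theta> * p)(z\<^sub>2) - (\<theta> * p)(z\<^sub>1) d\<sigma>\<close> up to a constant factor. The
  integrand is at most a multiple of \<open>1\<close>, of \<open>d/\<sigma>\<close> (as \<open>\<theta>\<close> is bounded) and of \<open>d/\<sigma>\<^sup>2\<close> (as \<open>\<theta>\<close> is square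
  integrable), where \<open>d = \<bar>z\<^sub>1 - z\<^sub>2\<bar>\<close>; so \<open>\<psi>\<close> has modulus of continuity \<open>d (1 + \<bar>ln d\<bar>)\<close> uniformly in time.

  Since \<open>\<theta>\<close> is transported and depends on \<open>\<rho>\<close> only, the material derivative of \<open>\<rho>\<close> is constant along
  each hyperbola in a sector of the saddle; letting the hyperbola approach the center, the two separatrices
  bounding the sector move with the flow. This determines the derivatives of \<open>\<psi>\<close> along them in
  terms of the derivatives of \<open>\<beta>\<close>, \<open>\<delta>\<close> and the chart \<open>F\<close>. The difference of the two derivatives is the time
  derivative of the angle \<open>\<gamma>\<close> up to \<open>O(\<gamma>)\<close>, while the difference of \<open>\<psi>\<close> between the separatrices is
  \<open>O(\<gamma> (1 + \<bar>ln \<gamma>\<bar>))\<close>. Hence \<open>\<bar>\<gamma>'\<bar> \<le> C \<gamma> (1 + \<bar>ln \<gamma>\<bar>)\<close>, and Osgood's criterion keeps \<open>\<gamma>\<close> away from \<open>0\<close> in finite time.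
\<close>

section \<open>Fourier transforms of Gaussians\<close>

text \<open>Two degenerations shape the argument. A point of the sector is described by the two
  factors of \<rho>, but recovering it from them divides by \<gamma>, so derivatives in these
  coordinates need not stay bounded as \<gamma> tends to 0. They are used only qualitatively, at a
  fixed time with \<gamma> > 0, to see how the separatrices move. All quantitative bounds are taken
  in the chart \<open>F\<close>, whose inverse and Jacobian are controlled uniformly up to the final
  time. Moreover \<psi> is controlled only through its modulus of continuity, without a gradient
  bound up to \<open>T\<close>: its derivatives along the separatrices are reached by the mean value
  theorem on a fixed parameter interval away from the vertex, after an a priori bound for the
  derivative of \<delta>. The saddle only guarantees \<gamma> \<ge> 0, so the differential
  inequality is available only while \<gamma> > 0. It is proved on every interval of positivity that
  starts at a time \<open>t0\<close> supplied by \<open>nondegenerate\<close>; the same estimate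
  excludes a first zero before \<open>T\<close> and yields the limit at \<open>T\<close>.\<close>

lemma
  fixes f :: "'a::euclidean_space \<Rightarrow> real \<Rightarrow> 'b::{real_normed_field,banach,second_countable_topology}"
  assumes f: "\<And>b. b \<in> Basis \<Longrightarrow> integrable lborel (f b)"
  shows integrable_lborel_prod: "integrable lborel (\<lambda>x. \<Prod>b\<in>Basis. f b (x \<bullet> b))"
    and integral_lborel_prod:
      "(LINT x|lborel. (\<Prod>b\<in>Basis. f b (x \<bullet> b))) = (\<Prod>b\<in>Basis. LINT u|lborel. f b u)"
proof -
  interpret product_sigma_finite "\<lambda>b::'a. lborel :: real measure" ..
  have [measurable]: "f b \<in> borel_measurable borel" if "b \<in> Basis" for b
    using borel_measurable_integrable[OF f[OF that]] by simp
  have m: "(\<lambda>x::'a. \<Prod>b\<in>Basis. f b (x \<bullet> b)) \<in> borel_measurable borel"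
    by measurable
  have t: "(\<lambda>f. \<Sum>b\<in>Basis. f b *\<^sub>R b) \<in> measurable (\<Pi>\<^sub>M b\<in>(Basis::'a set). lborel) (borel :: 'a measure)"
    by measurable
  have eq: "(\<Prod>b\<in>Basis. f b ((\<Sum>c\<in>Basis. g c *\<^sub>R c) \<bullet> b)) = (\<Prod>b\<in>Basis. f b (g b))" for g :: "'a \<Rightarrow> real"
    by (intro prod.cong) (simp_all add: inner_sum_left_Basis)
  show "integrable lborel (\<lambda>x. \<Prod>b\<in>Basis. f b (x \<bullet> b))"
    unfolding lborel_eq[where 'a='a] integrable_distr_eq[OF t m] eq
    by (intro product_integrable_prod f) auto
  show "(LINT x|lborel. (\<Prod>b\<in>Basis. f b (x \<bullet> b))) = (\<Prod>b\<in>Basis. LINT u|lborel. f b u)"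
    unfolding lborel_eq[where 'a='a] integral_distr[OF t m] eq
    by (subst product_integral_prod) (auto simp: f)
qed

lemma integrable_power_gaussian:
  fixes a :: real
  assumes "0 < a"
  shows "integrable lborel (\<lambda>u. u ^ k * exp (- a * u\<^sup>2))"
proof -
  have "integrable lborel (\<lambda>u. std_normal_density (0 + sqrt (2 * a) * u) * (0 + sqrt (2 * a) * u) ^ k)"
    using assms by (intro lborel_integrable_real_affine[OF integrable_std_normal_moment]) auto
  then have "integrable lborel (\<lambda>u. sqrt (2 * pi) / sqrt (2 * a) ^ k *
      (std_normal_density (0 + sqrt (2 * a) * u) * (0 + sqrt (2 * a) * u) ^ k))"
    by (rule integrable_mult_right)
  moreover have "(\<lambda>u. sqrt (2 * pi) / sqrt (2 * a) ^ k *
      (std_normal_density (0 + sqrt (2 * a) * u) * (0 + sqrt (2 * a) * u) ^ k))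
      = (\<lambda>u. u ^ k * exp (- a * u\<^sup>2))"
    using assms by (auto simp: std_normal_density_def power_mult_distrib real_sqrt_mult fun_eq_iff)
  ultimately show ?thesis by simp
qed

lemma integrable_power_gaussian_cis:
  fixes a :: real
  assumes "0 < a"
  shows "integrable lborel (\<lambda>u. complex_of_real (u ^ k * exp (- a * u\<^sup>2)) * cis (x * u))"
proof (rule Bochner_Integration.integrable_bound[OF integrable_power_gaussian[OF assms, of k]])
  show "(\<lambda>u. complex_of_real (u ^ k * exp (- a * u\<^sup>2)) * cis (x * u)) \<in> borel_measurable lborel"
    by (auto intro!: borel_measurable_continuous_onI continuous_intros simp: cis_conv_exp)
qed (auto simp: norm_mult norm_power abs_mult power_abs)

lemma gaussian_fourier_1d:
  fixes a x :: real
  assumes a: "0 < a"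
  shows "(LINT u|lborel. complex_of_real (exp (- a * u\<^sup>2)) * cis (x * u))
    = complex_of_real (sqrt (pi / a) * exp (- x\<^sup>2 / (4 * a)))"
proof -
  \<comment> \<open>Scaling the argument of the standard normal density by
    \<open>sqrt (2 * a)\<close> turns it into a multiple of exp (- a u^2), so the integral is the
    characteristic function of the normal distribution, read at \<open>t\<close>.\<close>
  define t where "t = x / sqrt (2 * a)"
  have s: "sqrt (2 * a) > 0" using a by simp
  have "char std_normal_distribution t =
      (LINT u|lborel. complex_of_real (std_normal_density u) * cis (t * u))"
    unfolding char_def by (subst integral_density) (auto simp: cis_conv_exp scaleR_conv_of_real normal_density_nonneg)
  also have "\<dots> = \<bar>sqrt (2 * a)\<bar> *\<^sub>R (LINT u|lborel. complex_of_real (std_normal_density (0 + sqrt (2 * a) * u))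
       * cis (t * (0 + sqrt (2 * a) * u)))"
    using s by (intro lborel_integral_real_affine) auto
  also have "(\<lambda>u. complex_of_real (std_normal_density (0 + sqrt (2 * a) * u)) * cis (t * (0 + sqrt (2 * a) * u)))
     = (\<lambda>u. (1 / sqrt (2 * pi)) *\<^sub>R (complex_of_real (exp (- a * u\<^sup>2)) * cis (x * u)))"
    using a s by (auto simp: std_normal_density_def power_mult_distrib real_sqrt_mult t_def fun_eq_iff scaleR_conv_of_real)
  finally have "complex_of_real (exp (- (t\<^sup>2) / 2)) =
      (sqrt (2 * a) / sqrt (2 * pi)) *\<^sub>R (LINT u|lborel. (complex_of_real (exp (- a * u\<^sup>2)) * cis (x * u)))"
    using s by (simp add: char_std_normal_distribution)
  moreover have "t\<^sup>2 / 2 = x\<^sup>2 / (4 * a)" using a by (simp add: t_def power_divide)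
  moreover have "sqrt (2 * a) / sqrt (2 * pi) = inverse (sqrt (pi / a))"
    using a by (simp add: real_sqrt_divide real_sqrt_mult field_simps)
  ultimately have e: "complex_of_real (exp (- x\<^sup>2 / (4 * a))) =
      inverse (sqrt (pi / a)) *\<^sub>R (LINT u|lborel. (complex_of_real (exp (- a * u\<^sup>2)) * cis (x * u)))"
    by (metis minus_divide_left)
  show ?thesis
    unfolding of_real_mult e using a by (simp add: scaleR_conv_of_real)
qed

text \<open>Integration by parts without boundary terms; it produces the relations between Gaussian
  moments.\<close>

lemma integral_real_line_deriv_eq_0:
  fixes F :: "real \<Rightarrow> complex"
  assumes "\<And>x. (F has_vector_derivative f x) (at x)"
    and "continuous_on UNIV f" and "integrable lborel f"
    and "(F \<longlongrightarrow> 0) at_bot" and "(F \<longlongrightarrow> 0) at_top"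
  shows "(LINT u|lborel. f u) = 0"
proof -
  have "(LBINT x=-\<infinity>..\<infinity>. f x) = 0 - 0"
  proof (rule interval_integral_FTC_integrable)
    show "set_integrable lborel (einterval (-\<infinity>) \<infinity>) f"
      using assms(3) by (simp add: set_integrable_def)
    show "((F \<circ> real_of_ereal) \<longlongrightarrow> 0) (at_right (-\<infinity>))" "((F \<circ> real_of_ereal) \<longlongrightarrow> 0) (at_left \<infinity>)"
      using assms(4,5) by (simp_all add: ereal_tendsto_simps)
  qed (use assms in \<open>auto simp: continuous_on_eq_continuous_at\<close>)
  then show ?thesis
    by (simp add: interval_lebesgue_integral_def set_lebesgue_integral_def)
qed

text \<open>The derivatives of \<open>g 0\<close> and \<open>g 1\<close> integrate to 0, and both
  are combinations of \<open>g 0\<close>, \<open>g 1\<close> and \<open>g 2\<close>. These two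
  linear relations express the second moment through the zeroth.\<close>

lemma gaussian_fourier_1d_moment2:
  fixes a x :: real
  assumes a: "0 < a"
  shows "(LINT u|lborel. complex_of_real (u\<^sup>2 * exp (- a * u\<^sup>2)) * cis (x * u))
    = complex_of_real ((1 / (2 * a) - x\<^sup>2 / (4 * a\<^sup>2)) * (sqrt (pi / a) * exp (- x\<^sup>2 / (4 * a))))"
proof -
  \<comment> \<open>\<open>G\<close> lives on the complex plane so that the rules for field
    derivatives apply; \<open>g\<close> restricts it to the real axis.\<close>
  define G where "G k z = z ^ k * exp (- of_real a * z\<^sup>2 + \<i> * of_real x * z)" for k and z :: complex
  define g where "g k u = G k (complex_of_real u)" for k u
  have g_eq: "g k u = complex_of_real (u ^ k * exp (- a * u\<^sup>2)) * cis (x * u)" for k u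
    by (simp add: g_def G_def cis_conv_exp exp_of_real[symmetric] exp_add[symmetric] mult.assoc)
  have g_fun: "g k = (\<lambda>u. complex_of_real (u ^ k * exp (- a * u\<^sup>2)) * cis (x * u))" for k
    by (rule ext) (rule g_eq)
  have int: "integrable lborel (g k)" for k
    unfolding g_eq using integrable_power_gaussian_cis[OF a, of k x] by simp
  have cont: "continuous_on UNIV (g k)" for k
    unfolding g_def G_def by (intro continuous_intros)
  have ng: "norm (g k u) = \<bar>u\<bar> ^ k * exp (- a * u\<^sup>2)" for k u
    by (simp add: g_eq norm_mult norm_power abs_mult power_abs)
  have "((\<lambda>u. norm (g 0 u)) \<longlongrightarrow> 0) at_top" "((\<lambda>u. norm (g 0 u)) \<longlongrightarrow> 0) at_bot"
    "((\<lambda>u. norm (g 1 u)) \<longlongrightarrow> 0) at_top" "((\<lambda>u. norm (g 1 u)) \<longlongrightarrow> 0) at_bot"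
    unfolding ng using a by (simp_all, real_asymp+)
  then have lim: "(g 0 \<longlongrightarrow> 0) at_top" "(g 0 \<longlongrightarrow> 0) at_bot" "(g 1 \<longlongrightarrow> 0) at_top" "(g 1 \<longlongrightarrow> 0) at_bot"
    by (simp_all only: tendsto_norm_zero_iff)
  \<comment> \<open>For \<open>k = 0\<close> the truncated \<open>k - 1\<close> is harmless, since
    its coefficient is 0.\<close>
  have d: "(g k has_vector_derivative of_nat k * g (k - 1) u + (- 2 * of_real a) * g (k + 1) u + \<i> * x * g k u) (at u)" for k u
  proof -
    have "(G k has_field_derivative of_nat k * G (k - 1) z + (- 2 * of_real a) * G (k + 1) z + \<i> * x * G k z) (at z)" for z
      unfolding G_def by (rule derivative_eq_intros refl)+ (simp add: algebra_simps)
    from has_vector_derivative_real_field[OF this] show ?thesis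
      unfolding g_def .
  qed
  have 1: "(LINT u|lborel. of_nat k * g (k - 1) u + (- 2 * of_real a) * g (k + 1) u + \<i> * x * g k u) = 0" if "k = 0 \<or> k = 1" for k
    using that by (intro integral_real_line_deriv_eq_0[OF d] continuous_intros continuous_on_compose2[OF cont]
        Bochner_Integration.integrable_add integrable_mult_right int) (use lim in auto)
  have "2 * of_real a * integral\<^sup>L lborel (g 1) = \<i> * x * integral\<^sup>L lborel (g 0)"
    using 1[of 0] int by (simp add: algebra_simps)
  moreover have "integral\<^sup>L lborel (g 0) - 2 * of_real a * integral\<^sup>L lborel (g 2) + \<i> * x * integral\<^sup>L lborel (g 1) = 0"
    using 1[of 1] int by (simp add: algebra_simps numeral_2_eq_2)
  moreover have "\<i>\<^sup>2 = -1" by simp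
  ultimately have "4 * (complex_of_real a)\<^sup>2 * integral\<^sup>L lborel (g 2)
      = (2 * of_real a - (of_real x)\<^sup>2) * integral\<^sup>L lborel (g 0)"
    by algebra
  then have "integral\<^sup>L lborel (g 2) = (1 / (2 * of_real a) - of_real x ^ 2 / (4 * of_real a ^ 2)) * integral\<^sup>L lborel (g 0)"
    using a by (simp add: divide_simps) algebra
  moreover have "integral\<^sup>L lborel (g 0) = complex_of_real (sqrt (pi / a) * exp (- x\<^sup>2 / (4 * a)))"
    using gaussian_fourier_1d[OF a, of x] by (simp add: g_fun)
  ultimately show ?thesis by (simp add: g_fun)
qed

definition heat_kernel :: "real \<Rightarrow> real^2 \<Rightarrow> real" where
  "heat_kernel a y = exp (- (norm y)\<^sup>2 / (4 * a)) / (4 * pi * a)"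

text \<open>
  Minus the derivative of the heat kernel in its time parameter; its Fourier transform is
  \<open>\<bar>\<xi>\<bar>\<^sup>2 exp (- a \<bar>\<xi>\<bar>\<^sup>2)\<close>.
\<close>

definition heat_decay :: "real \<Rightarrow> real^2 \<Rightarrow> real" where
  "heat_decay a y = (1 / a - (norm y)\<^sup>2 / (4 * a\<^sup>2)) * heat_kernel a y"

lemma integral_real_gaussian:
  fixes a :: real
  assumes "0 < a"
  shows "(LINT u|lborel. exp (- a * u\<^sup>2)) = sqrt (pi / a)"
proof -
  have "complex_of_real (LINT u|lborel. exp (- a * u\<^sup>2)) = complex_of_real (sqrt (pi / a))"
    using gaussian_fourier_1d[OF assms, of 0] unfolding integral_complex_of_real[symmetric] by simp
  then show ?thesis by (simp only: of_real_eq_iff)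
qed

lemma
  fixes f :: "'a::euclidean_space \<Rightarrow> 'b::{banach,second_countable_topology}"
  assumes [measurable]: "f \<in> borel_measurable borel"
  shows integral_lborel_translate: "(LINT x|lborel. f (x - z)) = (LINT x|lborel. f x)"
    and integrable_lborel_translate: "integrable lborel (\<lambda>x. f (x - z)) \<longleftrightarrow> integrable lborel f"
proof -
  have d: "lborel = distr lborel borel ((+) (-z))" by (rule lborel_distr_plus[symmetric])
  show "(LINT x|lborel. f (x - z)) = (LINT x|lborel. f x)"
    by (subst (2) d, subst integral_distr) (simp_all add: algebra_simps)
  show "integrable lborel (\<lambda>x. f (x - z)) \<longleftrightarrow> integrable lborel f"
    by (subst (2) d, subst integrable_distr_eq) (simp_all add: algebra_simps)
qed

lemma norm_power2_Basis: "(norm (x::'a::euclidean_space))\<^sup>2 = (\<Sum>b\<in>Basis. (x \<bullet> b)\<^sup>2)"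
  unfolding power2_norm_eq_inner by (subst euclidean_inner) (simp add: power2_eq_square)

lemma cis_sum: "finite A \<Longrightarrow> cis (sum f A) = (\<Prod>x\<in>A. cis (f x))"
  by (induction rule: finite_induct) (simp_all add: cis_mult[symmetric])

lemma gaussian_cis_prod:
  fixes x y :: "'a::euclidean_space"
  shows "complex_of_real (exp (- a * (norm x)\<^sup>2)) * cis (y \<bullet> x)
    = (\<Prod>b\<in>Basis. complex_of_real (exp (- a * (x \<bullet> b)\<^sup>2)) * cis ((y \<bullet> b) * (x \<bullet> b)))"
proof -
  have "exp (- a * (norm x)\<^sup>2) = (\<Prod>b\<in>Basis. exp (- a * (x \<bullet> b)\<^sup>2))"
    by (simp only: norm_power2_Basis[of x] sum_distrib_left exp_sum[OF finite_Basis])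
  moreover have "cis (y \<bullet> x) = (\<Prod>b\<in>Basis. cis ((y \<bullet> b) * (x \<bullet> b)))"
    by (subst euclidean_inner) (rule cis_sum[OF finite_Basis])
  ultimately show ?thesis by (simp only: of_real_prod prod.distrib)
qed

lemma prod_gaussian_factors:
  fixes y :: "real^2"
  assumes a: "0 < a"
  shows "(\<Prod>b\<in>Basis. sqrt (pi / a) * exp (- (y \<bullet> b)\<^sup>2 / (4 * a)))
    = pi / a * exp (- (norm y)\<^sup>2 / (4 * a))"
proof -
  have "- (norm y)\<^sup>2 / (4 * a) = (\<Sum>b\<in>Basis. - (y \<bullet> b)\<^sup>2 / (4 * a))"
    by (simp only: norm_power2_Basis[of y] sum_negf[symmetric] sum_divide_distrib)
  then have "exp (- (norm y)\<^sup>2 / (4 * a)) = (\<Prod>b\<in>Basis. exp (- (y \<bullet> b)\<^sup>2 / (4 * a)))"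
    by (simp only: exp_sum[OF finite_Basis])
  moreover have "(\<Prod>b\<in>(Basis :: (real^2) set). sqrt (pi / a)) = pi / a"
    using a by simp
  ultimately show ?thesis by (simp only: prod.distrib)
qed

lemma
  fixes y :: "real^2"
  assumes a: "0 < a"
  shows integrable_gaussian_cis: "integrable lborel (\<lambda>x. complex_of_real (exp (- a * (norm x)\<^sup>2)) * cis (y \<bullet> x))"
    and gaussian_fourier: "(LINT x|lborel. complex_of_real (exp (- a * (norm x)\<^sup>2)) * cis (y \<bullet> x))
      = complex_of_real (pi / a * exp (- (norm y)\<^sup>2 / (4 * a)))"
proof -
  have i: "integrable lborel (\<lambda>u. complex_of_real (exp (- a * u\<^sup>2)) * cis (t * u))" for t
    using integrable_power_gaussian_cis[OF a, of 0 t] by simp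
  show "integrable lborel (\<lambda>x. complex_of_real (exp (- a * (norm x)\<^sup>2)) * cis (y \<bullet> x))"
    unfolding gaussian_cis_prod by (intro integrable_lborel_prod i)
  show "(LINT x|lborel. complex_of_real (exp (- a * (norm x)\<^sup>2)) * cis (y \<bullet> x))
      = complex_of_real (pi / a * exp (- (norm y)\<^sup>2 / (4 * a)))"
    unfolding gaussian_cis_prod integral_lborel_prod[OF i] gaussian_fourier_1d[OF a]
    by (simp only: of_real_prod[symmetric] prod_gaussian_factors[OF a])
qed

lemma
  fixes y :: "real^2"
  assumes a: "0 < a"
  shows integrable_gaussian_cis_moment2:
      "integrable lborel (\<lambda>x. complex_of_real ((norm x)\<^sup>2 * exp (- a * (norm x)\<^sup>2)) * cis (y \<bullet> x))"
    and gaussian_fourier_moment2: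
      "(LINT x|lborel. complex_of_real ((norm x)\<^sup>2 * exp (- a * (norm x)\<^sup>2)) * cis (y \<bullet> x))
      = complex_of_real ((2 * pi)\<^sup>2 * heat_decay a y)"
proof -
  \<comment> \<open>The factor |x|^2 is the sum of the squared coordinates. In the summand of
    coordinate \<open>c\<close> only the factor for \<open>c\<close> carries u^2, so every summand
    is a product of one-dimensional integrands.\<close>
  define h where "h c b u = (if b = c then of_real (u\<^sup>2) else 1) * (complex_of_real (exp (- a * u\<^sup>2)) * cis ((y \<bullet> b) * u))"
    for b c :: "real^2" and u
  have eq: "complex_of_real ((norm x)\<^sup>2 * exp (- a * (norm x)\<^sup>2)) * cis (y \<bullet> x)
    = (\<Sum>c\<in>Basis. \<Prod>b\<in>Basis. h c b (x \<bullet> b))" for x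
  proof -
    have "(\<Prod>b\<in>Basis. h c b (x \<bullet> b)) = of_real ((x \<bullet> c)\<^sup>2) * (complex_of_real (exp (- a * (norm x)\<^sup>2)) * cis (y \<bullet> x))"
      if "c \<in> Basis" for c
      unfolding h_def gaussian_cis_prod by (subst prod.distrib) (use that in \<open>simp add: prod.delta\<close>)
    then have "(\<Sum>c\<in>Basis. \<Prod>b\<in>Basis. h c b (x \<bullet> b))
      = (\<Sum>c\<in>Basis. of_real ((x \<bullet> c)\<^sup>2) * (complex_of_real (exp (- a * (norm x)\<^sup>2)) * cis (y \<bullet> x)))"
      by (rule sum.cong[OF refl])
    also have "\<dots> = of_real ((norm x)\<^sup>2) * (complex_of_real (exp (- a * (norm x)\<^sup>2)) * cis (y \<bullet> x))"
      by (subst (2) norm_power2_Basis) (simp only: of_real_sum sum_distrib_right)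
    finally show ?thesis by (simp only: of_real_mult mult.assoc)
  qed
  have hc: "h c c = (\<lambda>u. complex_of_real (u\<^sup>2 * exp (- a * u\<^sup>2)) * cis ((y \<bullet> c) * u))" for c
    by (simp add: h_def fun_eq_iff)
  have hn: "h c b = (\<lambda>u. complex_of_real (exp (- a * u\<^sup>2)) * cis ((y \<bullet> b) * u))" if "b \<noteq> c" for b c
    using that by (simp add: h_def fun_eq_iff)
  have i: "integrable lborel (h c b)" for b c
    using integrable_power_gaussian_cis[OF a, of 0 "y \<bullet> b"] integrable_power_gaussian_cis[OF a, of 2 "y \<bullet> b"]
    by (cases "b = c") (simp_all only: hc hn power_0 mult_1 not_False_eq_True)
  have I: "integral\<^sup>L lborel (h c b) = of_real ((if b = c then 1 / (2 * a) - (y \<bullet> b)\<^sup>2 / (4 * a\<^sup>2) else 1)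
     * (sqrt (pi / a) * exp (- (y \<bullet> b)\<^sup>2 / (4 * a))))" for b c
    by (cases "b = c") (simp_all only: hc hn gaussian_fourier_1d[OF a] gaussian_fourier_1d_moment2[OF a] simp_thms if_True if_False mult_1)
  show "integrable lborel (\<lambda>x. complex_of_real ((norm x)\<^sup>2 * exp (- a * (norm x)\<^sup>2)) * cis (y \<bullet> x))"
    unfolding eq by (intro integrable_lborel_prod i Bochner_Integration.integrable_sum)
  have "(LINT x|lborel. complex_of_real ((norm x)\<^sup>2 * exp (- a * (norm x)\<^sup>2)) * cis (y \<bullet> x))
     = (\<Sum>c\<in>Basis. \<Prod>b\<in>Basis. integral\<^sup>L lborel (h c b))"
    unfolding eq integral_lborel_prod[OF i, symmetric]
    by (intro Bochner_Integration.integral_sum integrable_lborel_prod i)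
  also have "\<dots> = (\<Sum>c\<in>Basis. of_real ((1 / (2 * a) - (y \<bullet> c)\<^sup>2 / (4 * a\<^sup>2)) * (pi / a * exp (- (norm y)\<^sup>2 / (4 * a)))))"
  proof (rule sum.cong)
    fix c :: "real^2" assume "c \<in> Basis"
    then show "(\<Prod>b\<in>Basis. integral\<^sup>L lborel (h c b)) = of_real ((1 / (2 * a) - (y \<bullet> c)\<^sup>2 / (4 * a\<^sup>2)) * (pi / a * exp (- (norm y)\<^sup>2 / (4 * a))))"
      unfolding I of_real_prod[symmetric]
      unfolding prod.distrib prod_gaussian_factors[OF a, unfolded prod.distrib] by (simp add: prod.delta)
  qed simp
  also have "\<dots> = of_real ((1 / a - (norm y)\<^sup>2 / (4 * a\<^sup>2)) * (pi / a * exp (- (norm y)\<^sup>2 / (4 * a))))"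
    by (subst of_real_sum[symmetric], subst sum_distrib_right[symmetric], subst sum_subtractf,
       subst sum_divide_distrib[symmetric], subst norm_power2_Basis[symmetric]) simp
  also have "\<dots> = complex_of_real ((2 * pi)\<^sup>2 * heat_decay a y)"
    using a by (simp add: heat_decay_def heat_kernel_def power2_eq_square)
  finally show "(LINT x|lborel. complex_of_real ((norm x)\<^sup>2 * exp (- a * (norm x)\<^sup>2)) * cis (y \<bullet> x))
      = complex_of_real ((2 * pi)\<^sup>2 * heat_decay a y)" .
qed

lemma continuous_on_heat_kernel [continuous_intros]:
  "a > 0 \<Longrightarrow> continuous_on A (heat_kernel a)"
  unfolding heat_kernel_def[abs_def] by (intro continuous_intros) auto

lemma heat_kernel_pos: "a > 0 \<Longrightarrow> heat_kernel a y > 0"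
  by (simp add: heat_kernel_def)

lemma integrable_heat_kernel: assumes "a > 0" shows "integrable lborel (heat_kernel a)" and "(LINT y|lborel. heat_kernel a y) = 1"
proof -
  have e: "complex_of_real (heat_kernel a y) = (1 / (4 * pi * a)) *\<^sub>R (complex_of_real (exp (- (1 / (4 * a)) * (norm y)\<^sup>2)) * cis (0 \<bullet> y))" for y
    by (simp add: heat_kernel_def scaleR_conv_of_real)
  have p: "0 < 1 / (4 * a)" using assms by simp
  have "integrable lborel (\<lambda>y. complex_of_real (heat_kernel a y))"
    unfolding e by (intro integrable_scaleR_right integrable_gaussian_cis p)
  then show "integrable lborel (heat_kernel a)" by (simp only: complex_of_real_integrable_eq)
  have "complex_of_real (LINT y|lborel. heat_kernel a y) = 1"
    unfolding integral_complex_of_real[symmetric] e integral_scaleR_right gaussian_fourier[OF p]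
    using assms by (simp add: scaleR_conv_of_real)
  then show "(LINT y|lborel. heat_kernel a y) = 1" by (simp only: of_real_eq_1_iff)
qed

lemma fourier_heat_kernel:
  assumes a: "a > 0"
  shows "fourier (\<lambda>x. heat_kernel a (x - z)) \<xi> = cis (- (z \<bullet> \<xi>)) * complex_of_real (exp (- a * (norm \<xi>)\<^sup>2))"
proof -
  define f where "f y = complex_of_real (heat_kernel a y) * cis (- (y \<bullet> \<xi>))" for y
  have [measurable]: "f \<in> borel_measurable borel"
    unfolding f_def cis_conv_exp using a
    by (intro borel_measurable_continuous_onI continuous_intros)
  have "fourier (\<lambda>x. heat_kernel a (x - z)) \<xi> = (LINT x|lborel. cis (- (z \<bullet> \<xi>)) * f (x - z))"
    unfolding fourier_def f_def
    by (intro Bochner_Integration.integral_cong) (simp_all add: cis_mult algebra_simps)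
  also have "\<dots> = cis (- (z \<bullet> \<xi>)) * (LINT x|lborel. f x)"
    by (simp add: integral_lborel_translate)
  also have "(LINT x|lborel. f x) = (1 / (4 * pi * a)) *\<^sub>R (LINT x|lborel. complex_of_real (exp (- (1 / (4 * a)) * (norm x)\<^sup>2)) * cis ((-\<xi>) \<bullet> x))"
    unfolding integral_scaleR_right[symmetric]
    by (intro Bochner_Integration.integral_cong) (simp_all add: f_def heat_kernel_def scaleR_conv_of_real inner_commute)
  also have "\<dots> = complex_of_real (exp (- a * (norm \<xi>)\<^sup>2))"
    using a by (subst gaussian_fourier) (simp_all add: scaleR_conv_of_real)
  finally show ?thesis .
qed

text \<open>The Gaussian integral in s contributes sqrt pi / r and so lowers r^2 to r; at r = 0 both
  sides vanish. This replaces the nonsmooth symbol |\<xi>| by an average of symbols |\<xi>|^2 exp (-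
  c |\<xi>|^2) with explicit inverse transforms.\<close>

lemma
  fixes r :: real
  assumes "0 \<le> r"
  shows integrable_gaussian_subord: "integrable lborel (\<lambda>s. r\<^sup>2 * exp (- (\<sigma>\<^sup>2 + s\<^sup>2) * r\<^sup>2))"
    and gaussian_subord: "(LINT s|lborel. r\<^sup>2 * exp (- (\<sigma>\<^sup>2 + s\<^sup>2) * r\<^sup>2)) = sqrt pi * (r * exp (- \<sigma>\<^sup>2 * r\<^sup>2))"
proof -
  have e: "r\<^sup>2 * exp (- (\<sigma>\<^sup>2 + s\<^sup>2) * r\<^sup>2) = (r\<^sup>2 * exp (- \<sigma>\<^sup>2 * r\<^sup>2)) * exp (- (r\<^sup>2) * s\<^sup>2)" for s
    unfolding mult.assoc mult_exp_exp by (simp add: algebra_simps)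
  show "integrable lborel (\<lambda>s. r\<^sup>2 * exp (- (\<sigma>\<^sup>2 + s\<^sup>2) * r\<^sup>2))"
    unfolding e using integrable_power_gaussian[of "r\<^sup>2" 0] by (cases "r = 0") simp_all
  show "(LINT s|lborel. r\<^sup>2 * exp (- (\<sigma>\<^sup>2 + s\<^sup>2) * r\<^sup>2)) = sqrt pi * (r * exp (- \<sigma>\<^sup>2 * r\<^sup>2))"
    unfolding e using assms integral_real_gaussian[of "r\<^sup>2"] by (cases "r = 0") (simp_all add: real_sqrt_divide power2_eq_square)
qed

text \<open>After \<open>gaussian_subord\<close>, Fubini leaves for each s the inverse transform of
  |\<xi>|^2 exp (- (\<sigma>^2 + s^2) |\<xi>|^2), which is \<open>heat_decay\<close>.\<close>

lemma half_laplacian_heat_kernel: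
  assumes \<sigma>: "\<sigma> > 0"
  shows "half_laplacian (\<lambda>x. heat_kernel (\<sigma>\<^sup>2) (x - z)) x = (LINT s|lborel. heat_decay (\<sigma>\<^sup>2 + s\<^sup>2) (x - z)) / sqrt pi"
proof -
  define y where "y = x - z"
  define f where "f \<xi> s = complex_of_real ((norm \<xi>)\<^sup>2 * exp (- (\<sigma>\<^sup>2 + s\<^sup>2) * (norm \<xi>)\<^sup>2)) * cis (y \<bullet> \<xi>)" for \<xi> :: "real^2" and s
  have m [measurable]: "case_prod f \<in> borel_measurable (lborel \<Otimes>\<^sub>M lborel)"
  proof -
    have "continuous_on UNIV (case_prod f)"
      unfolding f_def cis_conv_exp case_prod_unfold by (intro continuous_intros)
    then show ?thesis
      unfolding lborel_prod by (simp add: borel_measurable_continuous_onI)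
  qed
  have n: "norm (f \<xi> s) = (norm \<xi>)\<^sup>2 * exp (- (\<sigma>\<^sup>2 + s\<^sup>2) * (norm \<xi>)\<^sup>2)" for \<xi> s
    by (simp add: f_def norm_mult norm_power)
  have s2: "0 < \<sigma>\<^sup>2" using \<sigma> by simp
  \<comment> \<open>Fubini requires the first absolute moment of the Gaussian; r \<le> 1 + r^2
    reduces it to the moments of order 0 and 2.\<close>
  have int1: "integrable lborel (\<lambda>\<xi>::real^2. norm \<xi> * exp (- \<sigma>\<^sup>2 * (norm \<xi>)\<^sup>2))"
  proof (rule Bochner_Integration.integrable_bound)
    show "integrable lborel (\<lambda>\<xi>::real^2. norm (complex_of_real (exp (- \<sigma>\<^sup>2 * (norm \<xi>)\<^sup>2)) * cis (0 \<bullet> \<xi>))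
       + norm (complex_of_real ((norm \<xi>)\<^sup>2 * exp (- \<sigma>\<^sup>2 * (norm \<xi>)\<^sup>2)) * cis (0 \<bullet> \<xi>)))"
      by (intro Bochner_Integration.integrable_add integrable_norm integrable_gaussian_cis integrable_gaussian_cis_moment2 s2)
    have "r \<le> 1 + r\<^sup>2" for r :: real
      using zero_le_power2[of "r - 1/2"] by (simp add: power2_eq_square algebra_simps)
    then have "norm \<xi> * exp (- \<sigma>\<^sup>2 * (norm \<xi>)\<^sup>2) \<le> (1 + (norm \<xi>)\<^sup>2) * exp (- \<sigma>\<^sup>2 * (norm \<xi>)\<^sup>2)" for \<xi> :: "real^2"
      by (intro mult_right_mono) auto
    then show "AE \<xi>::real^2 in lborel. norm (norm \<xi> * exp (- \<sigma>\<^sup>2 * (norm \<xi>)\<^sup>2)) \<le> norm (norm (complex_of_real (exp (- \<sigma>\<^sup>2 * (norm \<xi>)\<^sup>2)) * cis (0 \<bullet> \<xi>))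
       + norm (complex_of_real ((norm \<xi>)\<^sup>2 * exp (- \<sigma>\<^sup>2 * (norm \<xi>)\<^sup>2)) * cis (0 \<bullet> \<xi>)))"
      by (auto simp: norm_mult norm_power algebra_simps)
  qed measurable
  have int: "integrable (lborel \<Otimes>\<^sub>M lborel) (case_prod f)"
  proof (rule lborel_pair.Fubini_integrable[OF m])
    show "integrable lborel (\<lambda>\<xi>. LINT s|lborel. norm (case (\<xi>, s) of (\<xi>, s) \<Rightarrow> f \<xi> s))"
      unfolding prod.case n gaussian_subord[OF norm_ge_zero] using int1 by (rule integrable_mult_right)
    show "AE \<xi> in lborel. integrable lborel (\<lambda>s. case (\<xi>, s) of (\<xi>, s) \<Rightarrow> f \<xi> s)"
      unfolding prod.case f_def by (intro AE_I2 integrable_mult_left integrable_of_real integrable_gaussian_subord) simp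
  qed
  have "(LINT \<xi>|lborel. complex_of_real (norm \<xi>) * fourier (\<lambda>x. heat_kernel (\<sigma>\<^sup>2) (x - z)) \<xi> * cis (x \<bullet> \<xi>))
      = (LINT \<xi>|lborel. (LINT s|lborel. f \<xi> s) /\<^sub>R sqrt pi)"
  proof (rule Bochner_Integration.integral_cong)
    fix \<xi> :: "real^2"
    have "(LINT s|lborel. f \<xi> s) = complex_of_real (sqrt pi * (norm \<xi> * exp (- \<sigma>\<^sup>2 * (norm \<xi>)\<^sup>2))) * cis (y \<bullet> \<xi>)"
      unfolding f_def by (subst gaussian_subord[symmetric, OF norm_ge_zero]) (simp only: integral_mult_left_zero integral_complex_of_real)
    then show "complex_of_real (norm \<xi>) * fourier (\<lambda>x. heat_kernel (\<sigma>\<^sup>2) (x - z)) \<xi> * cis (x \<bullet> \<xi>) = (LINT s|lborel. f \<xi> s) /\<^sub>R sqrt pi"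
      by (simp add: fourier_heat_kernel[OF s2] scaleR_conv_of_real y_def cis_mult inner_diff_left algebra_simps)
  qed simp
  also have "\<dots> = (LINT \<xi>|lborel. (LINT s|lborel. f \<xi> s)) /\<^sub>R sqrt pi" by simp
  also have "(LINT \<xi>|lborel. (LINT s|lborel. f \<xi> s)) = (LINT s|lborel. (LINT \<xi>|lborel. f \<xi> s))"
    by (rule lborel_pair.Fubini_integral[symmetric, OF int])
  also have "\<dots> = (LINT s|lborel. complex_of_real ((2 * pi)\<^sup>2 * heat_decay (\<sigma>\<^sup>2 + s\<^sup>2) y))"
    unfolding f_def using s2 by (intro Bochner_Integration.integral_cong gaussian_fourier_moment2) (auto simp: add_pos_nonneg)
  also have "\<dots> = complex_of_real ((2 * pi)\<^sup>2 * (LINT s|lborel. heat_decay (\<sigma>\<^sup>2 + s\<^sup>2) y))"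
    by (simp only: integral_complex_of_real integral_mult_right_zero)
  finally have "(LINT \<xi>|lborel. complex_of_real (norm \<xi>) * fourier (\<lambda>x. heat_kernel (\<sigma>\<^sup>2) (x - z)) \<xi> * cis (x \<bullet> \<xi>))
     = complex_of_real ((2 * pi)\<^sup>2 * ((LINT s|lborel. heat_decay (\<sigma>\<^sup>2 + s\<^sup>2) y) / sqrt pi))"
    by (simp only: scaleR_conv_of_real of_real_mult[symmetric]) (simp add: divide_inverse)
  then show ?thesis
    unfolding half_laplacian_def y_def[symmetric] by simp
qed

section \<open>Kernel bounds\<close>

text \<open>A rational majorant common to the heat kernel, its increments and its time derivative.
  Unlike a Gaussian it can be integrated in closed form over the subordination variable; the
  constant 3 comes from \<open>exp_cubic_bound\<close>.\<close>

definition heat_majorant :: "real \<Rightarrow> real^2 \<Rightarrow> real" where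
  "heat_majorant c y = 3 * c / (c + (norm y)\<^sup>2 / 4)\<^sup>2"

lemma heat_majorant_nonneg: "c > 0 \<Longrightarrow> 0 \<le> heat_majorant c y"
  by (simp add: heat_majorant_def)

lemma heat_majorant_le: assumes "c > 0" shows "heat_majorant c y \<le> 3 / c"
proof -
  have "c\<^sup>2 \<le> (c + (norm y)\<^sup>2 / 4)\<^sup>2" using assms by (intro power_mono) auto
  then have "heat_majorant c y \<le> 3 * c / c\<^sup>2" unfolding heat_majorant_def using assms
    by (intro divide_left_mono) (auto intro!: mult_pos_pos zero_less_power add_pos_nonneg)
  then show ?thesis using assms by (simp add: power2_eq_square)
qed

text \<open>The chain is (1 + u)^3 \<le> 27 (1 + u/3)^3 \<le> 27 exp u, and 27 < 12 pi.\<close>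

lemma exp_cubic_bound:
  fixes u :: real assumes "0 \<le> u" shows "(1 + u) * exp (- u) / (4 * pi) \<le> 3 / (1 + u)\<^sup>2"
proof -
  have "(1 + u / real 3) ^ 3 \<le> exp u"
    by (rule exp_ge_one_plus_x_over_n_power_n) (use assms in auto)
  moreover have "(1 + u) ^ 3 \<le> 27 * (1 + u / 3) ^ 3"
  proof -
    have "(1 + u) ^ 3 \<le> (3 * (1 + u / 3)) ^ 3" using assms by (intro power_mono) auto
    then show ?thesis unfolding power_mult_distrib by simp
  qed
  ultimately have "(1 + u) ^ 3 \<le> 27 * exp u" by simp
  also have "\<dots> \<le> 3 * (4 * pi) * exp u" using pi_gt3 by (intro mult_right_mono) auto
  finally have "(1 + u) ^ 3 * exp (- u) \<le> 3 * (4 * pi)" by (simp add: exp_minus field_simps)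
  then show ?thesis using assms by (simp add: divide_simps power2_eq_square power3_eq_cube mult_ac)
qed

lemma heat_majorant_alt: assumes "c > 0" shows "heat_majorant c y = 3 / (1 + (norm y)\<^sup>2 / (4 * c))\<^sup>2 / c"
proof -
  have "c + (norm y)\<^sup>2 / 4 = c * (1 + (norm y)\<^sup>2 / (4 * c))" using assms by (simp add: field_simps)
  then show ?thesis unfolding heat_majorant_def using assms by (simp add: power_mult_distrib power2_eq_square[of c])
qed

lemma gaussian_poly_le_heat_majorant:
  assumes "c > 0" shows "(1 + (norm y)\<^sup>2 / (4 * c)) * heat_kernel c y \<le> heat_majorant c y"
proof -
  have "(1 + (norm y)\<^sup>2 / (4 * c)) * heat_kernel c y = (1 + (norm y)\<^sup>2 / (4 * c)) * exp (- ((norm y)\<^sup>2 / (4 * c))) / (4 * pi) / c"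
    by (simp add: heat_kernel_def)
  also have "\<dots> \<le> 3 / (1 + (norm y)\<^sup>2 / (4 * c))\<^sup>2 / c"
    using assms by (intro divide_right_mono exp_cubic_bound) auto
  finally show ?thesis by (simp only: heat_majorant_alt[OF assms])
qed

lemma heat_kernel_le_heat_majorant: assumes "c > 0" shows "heat_kernel c y \<le> heat_majorant c y"
proof -
  have "1 * heat_kernel c y \<le> (1 + (norm y)\<^sup>2 / (4 * c)) * heat_kernel c y"
    using assms heat_kernel_pos[OF assms, of y] by (intro mult_right_mono) auto
  with gaussian_poly_le_heat_majorant[OF assms, of y] show ?thesis by simp
qed

lemma abs_heat_decay_le_heat_majorant: assumes "c > 0" shows "\<bar>heat_decay c y\<bar> \<le> heat_majorant c y / c"
proof -
  have "heat_decay c y = (1 - (norm y)\<^sup>2 / (4 * c)) * heat_kernel c y / c"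
    using assms by (simp add: heat_decay_def field_simps power2_eq_square)
  then have "\<bar>heat_decay c y\<bar> = \<bar>1 - (norm y)\<^sup>2 / (4 * c)\<bar> * heat_kernel c y / c"
    using assms heat_kernel_pos[OF assms, of y] by (simp add: abs_mult)
  also have "\<dots> \<le> (1 + (norm y)\<^sup>2 / (4 * c)) * heat_kernel c y / c"
    using assms heat_kernel_pos[OF assms, of y] by (intro divide_right_mono mult_right_mono) (auto simp: abs_le_iff)
  also have "\<dots> \<le> heat_majorant c y / c"
    using assms gaussian_poly_le_heat_majorant[OF assms, of y] by (intro divide_right_mono) auto
  finally show ?thesis .
qed

text \<open>The exponent \<open>A\<close> changes by at most d / sqrt c times 1 + \<open>A\<close>
  over a distance d \<le> sqrt c, and exp (- A) changes by at most that amount times its larger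
  value. The point with the smaller exponent carries this larger value, and
  \<open>gaussian_poly_le_heat_majorant\<close> absorbs the factor 1 + \<open>A\<close>.\<close>

lemma heat_kernel_diff_le_heat_majorant:
  assumes c: "c > 0" and d: "norm (y1 - y2) \<le> d" "d \<le> sqrt c"
  shows "\<bar>heat_kernel c y1 - heat_kernel c y2\<bar> \<le> d / sqrt c * (heat_majorant c y1 + heat_majorant c y2)"
proof -
  define A where "A y = (norm y)\<^sup>2 / (4 * c)" for y :: "real^2"
  have A0: "A y \<ge> 0" for y using c by (simp add: A_def)
  have d0: "0 \<le> d" using d norm_ge_zero order_trans by blast
  have key: "\<bar>A x - A y\<bar> \<le> d / sqrt c * (1 + A x)" if "norm (x - y) \<le> d" for x y
  proof -
    have n: "\<bar>norm x - norm y\<bar> \<le> d" using norm_triangle_ineq3[of x y] that by linarith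
    have "\<bar>A x - A y\<bar> = \<bar>norm x - norm y\<bar> * (norm x + norm y) / (4 * c)"
      using c by (simp add: A_def diff_divide_distrib[symmetric] power2_eq_square square_diff_square_factored abs_mult abs_divide)
    also have "\<dots> \<le> d * (2 * norm x + d) / (4 * c)"
      using n c d0 by (intro divide_right_mono mult_mono) auto
    also have "\<dots> \<le> d * (2 * norm x + sqrt c) / (4 * c)"
      using d d0 c by (intro divide_right_mono mult_left_mono) auto
    also have "\<dots> = d / sqrt c * ((norm x / (2 * sqrt c)) + 1 / 4)"
      using c by (simp add: field_simps)
    also have "\<dots> \<le> d / sqrt c * (1 + A x)"
    proof (intro mult_left_mono)
      have "A x = (norm x / (2 * sqrt c))\<^sup>2" using c by (simp add: A_def power_divide power_mult_distrib)
      moreover have "t + 1/4 \<le> 1 + t\<^sup>2" for t :: real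
        using zero_le_power2[of "t - 1/2"] by (simp add: power2_eq_square algebra_simps)
      ultimately show "norm x / (2 * sqrt c) + 1 / 4 \<le> 1 + A x" by metis
    qed (use d0 c in auto)
    finally show ?thesis .
  qed
  have ex: "\<bar>exp (- a) - exp (- b)\<bar> \<le> \<bar>a - b\<bar> * exp (- a)" if "a \<le> b" for a b :: real
  proof -
    have "1 - exp (a - b) \<le> b - a" using exp_ge_add_one_self[of "a - b"] by linarith
    then have "exp (-a) * (1 - exp (a - b)) \<le> exp (- a) * (b - a)" by simp
    then have "exp (- a) - exp (- b) \<le> exp (- a) * (b - a)" by (simp add: algebra_simps mult_exp_exp)
    with that show ?thesis by (simp add: mult.commute)
  qed
  have heat_kernel_A: "heat_kernel c y = exp (- A y) / (4 * pi * c)" for y by (simp add: heat_kernel_def A_def)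
  have main: "\<bar>heat_kernel c x - heat_kernel c y\<bar> \<le> d / sqrt c * heat_majorant c x" if "norm (x - y) \<le> d" "A x \<le> A y" for x y
  proof -
    have "\<bar>heat_kernel c x - heat_kernel c y\<bar> = \<bar>exp (- A x) - exp (- A y)\<bar> / (4 * pi * c)"
      using c by (simp add: heat_kernel_A diff_divide_distrib[symmetric] abs_divide)
    also have "\<dots> \<le> (d / sqrt c * (1 + A x) * exp (- A x)) / (4 * pi * c)"
      using c ex[OF that(2)] mult_right_mono[OF key[OF that(1)], of "exp (- A x)"] by (intro divide_right_mono) auto
    also have "\<dots> = d / sqrt c * ((1 + A x) * heat_kernel c x)" by (simp add: heat_kernel_A)
    also have "\<dots> \<le> d / sqrt c * heat_majorant c x"
      using gaussian_poly_le_heat_majorant[OF c, of x] d0 c by (intro mult_left_mono) (auto simp: A_def)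
    finally show ?thesis .
  qed
  have nn: "0 \<le> d / sqrt c * heat_majorant c y" for y using heat_majorant_nonneg[OF c] d0 c by simp
  show ?thesis
  proof (cases "A y1 \<le> A y2")
    case True
    from main[OF d(1) True] nn[of y2] show ?thesis by (simp add: distrib_left)
  next
    case False
    then have "\<bar>heat_kernel c y2 - heat_kernel c y1\<bar> \<le> d / sqrt c * heat_majorant c y2" using d by (intro main) (auto simp: norm_minus_commute)
    with nn[of y1] show ?thesis by (simp add: distrib_left abs_minus_commute)
  qed
qed

lemma
  shows integrable_cauchy: "integrable lborel (\<lambda>v::real. 1 / (1 + v\<^sup>2))"
    and integral_cauchy: "(LINT v|lborel. 1 / (1 + v\<^sup>2)) = pi"
  using integrable_inverse_1_plus_square LBINT_inverse_1_plus_square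
  by (simp_all add: set_integrable_def interval_lebesgue_integral_def set_lebesgue_integral_def inverse_eq_divide)

lemma
  fixes e m :: real
  assumes e: "e > 0" and m: "m > 0"
  shows integrable_inverse_quadratic: "integrable lborel (\<lambda>v. 1 / (m\<^sup>2 + e\<^sup>2 * v\<^sup>2))"
    and integral_inverse_quadratic: "(LINT v|lborel. 1 / (m\<^sup>2 + e\<^sup>2 * v\<^sup>2)) = pi / (e * m)"
proof -
  have eq: "1 / (1 + (0 + (e / m) * v)\<^sup>2) = m\<^sup>2 * (1 / (m\<^sup>2 + e\<^sup>2 * v\<^sup>2))" for v
    using m by (simp add: power_mult_distrib power_divide field_simps)
  have "integrable lborel (\<lambda>v. 1 / (1 + (0 + (e / m) * v)\<^sup>2))"
    using e m by (intro lborel_integrable_real_affine integrable_cauchy) auto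
  then show "integrable lborel (\<lambda>v. 1 / (m\<^sup>2 + e\<^sup>2 * v\<^sup>2))"
    unfolding eq integrable_mult_left_iff using m by simp
  have "pi = \<bar>e / m\<bar> *\<^sub>R (LINT v|lborel. 1 / (1 + (0 + (e / m) * v)\<^sup>2))"
    unfolding integral_cauchy[symmetric] using e m by (intro lborel_integral_real_affine) auto
  then show "(LINT v|lborel. 1 / (m\<^sup>2 + e\<^sup>2 * v\<^sup>2)) = pi / (e * m)"
    unfolding eq integral_mult_right_zero using m e by (simp add: field_simps power2_eq_square)
qed

text \<open>One of the two factors is at least m^2, and the other is left to
  \<open>integral_inverse_quadratic\<close>. The resulting m^-3 is the decay of all subordinated
  kernels below.\<close>

lemma
  fixes e m :: real
  assumes e: "e > 0" and m: "m > 0"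
  shows integrable_inverse_quadratic_square: "integrable lborel (\<lambda>v. 1 / (m\<^sup>2 + e\<^sup>2 * v\<^sup>2)\<^sup>2)"
    and integral_inverse_quadratic_square: "(LINT v|lborel. 1 / (m\<^sup>2 + e\<^sup>2 * v\<^sup>2)\<^sup>2) \<le> pi / (e * m ^ 3)"
proof -
  have le: "1 / (m\<^sup>2 + e\<^sup>2 * v\<^sup>2)\<^sup>2 \<le> (1 / m\<^sup>2) * (1 / (m\<^sup>2 + e\<^sup>2 * v\<^sup>2))" for v
  proof -
    have "m\<^sup>2 \<le> m\<^sup>2 + e\<^sup>2 * v\<^sup>2" "0 < m\<^sup>2" using m by auto
    then have "m\<^sup>2 * (m\<^sup>2 + e\<^sup>2 * v\<^sup>2) \<le> (m\<^sup>2 + e\<^sup>2 * v\<^sup>2) * (m\<^sup>2 + e\<^sup>2 * v\<^sup>2)"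
      by (intro mult_right_mono) auto
    then have "1 / ((m\<^sup>2 + e\<^sup>2 * v\<^sup>2) * (m\<^sup>2 + e\<^sup>2 * v\<^sup>2)) \<le> 1 / (m\<^sup>2 * (m\<^sup>2 + e\<^sup>2 * v\<^sup>2))"
      using \<open>0 < m\<^sup>2\<close> by (intro divide_left_mono) (auto intro!: mult_pos_pos add_pos_nonneg)
    then show ?thesis by (simp add: power2_eq_square)
  qed
  have i: "integrable lborel (\<lambda>v. (1 / m\<^sup>2) * (1 / (m\<^sup>2 + e\<^sup>2 * v\<^sup>2)))"
    by (intro integrable_mult_right integrable_inverse_quadratic e m)
  show I: "integrable lborel (\<lambda>v. 1 / (m\<^sup>2 + e\<^sup>2 * v\<^sup>2)\<^sup>2)"
    by (rule Bochner_Integration.integrable_bound[OF i]) (use le in auto)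
  have "(LINT v|lborel. 1 / (m\<^sup>2 + e\<^sup>2 * v\<^sup>2)\<^sup>2) \<le> (LINT v|lborel. (1 / m\<^sup>2) * (1 / (m\<^sup>2 + e\<^sup>2 * v\<^sup>2)))"
    by (intro integral_mono I i le)
  also have "\<dots> = pi / (e * m ^ 3)"
    using m unfolding integral_mult_right_zero integral_inverse_quadratic[OF e m] by (simp add: power2_eq_square power3_eq_cube)
  finally show "(LINT v|lborel. 1 / (m\<^sup>2 + e\<^sup>2 * v\<^sup>2)\<^sup>2) \<le> pi / (e * m ^ 3)" .
qed

lemma borel_measurable_heat_majorant [measurable]: "heat_majorant c \<in> borel_measurable borel"
  unfolding heat_majorant_def[abs_def] by measurable

text \<open>The square (c + |y|^2 / 4)^2 dominates the product of c + y_i^2 / 4 over the two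
  coordinates, so a product of one-dimensional functions with integral 2 pi / sqrt c each bounds the
  majorant; 3 c times (2 pi / sqrt c)^2 is 12 pi^2.\<close>

lemma
  assumes c: "c > 0"
  shows integrable_heat_majorant: "integrable lborel (heat_majorant c)"
    and integral_heat_majorant_le: "(LINT y|lborel. heat_majorant c y) \<le> 12 * pi\<^sup>2"
proof -
  define f where "f u = 1 / ((sqrt c)\<^sup>2 + (1/2)\<^sup>2 * u\<^sup>2)" for u :: real
  have f_int: "integrable lborel f" and f_val: "integral\<^sup>L lborel f = 2 * pi / sqrt c"
    using integrable_inverse_quadratic[of "1/2" "sqrt c"] integral_inverse_quadratic[of "1/2" "sqrt c"] c
    by (simp_all add: f_def[abs_def])
  have f_pos: "f u > 0" for u using c by (auto simp: f_def intro!: divide_pos_pos add_pos_nonneg)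
  have heat_majorant_f: "heat_majorant c y \<le> 3 * c * (\<Prod>b\<in>Basis. f (y \<bullet> b))" for y
  proof -
    have s: "(c + (norm y)\<^sup>2 / 4) = c + (\<Sum>b\<in>Basis. (y \<bullet> b)\<^sup>2) / 4" by (simp only: norm_power2_Basis)
    have "(\<Prod>b\<in>Basis. c + (y \<bullet> b)\<^sup>2 / 4) \<le> (\<Prod>b\<in>(Basis::(real^2) set). c + (norm y)\<^sup>2 / 4)"
    proof (intro prod_mono conjI)
      fix b :: "real^2" assume "b \<in> Basis"
      then have "(y \<bullet> b)\<^sup>2 \<le> (norm y)\<^sup>2" by (metis Basis_le_norm abs_ge_zero power2_abs power_mono)
      then show "c + (y \<bullet> b)\<^sup>2 / 4 \<le> c + (norm y)\<^sup>2 / 4" by simp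
    qed (use c in auto)
    then have le: "(\<Prod>b\<in>Basis. c + (y \<bullet> b)\<^sup>2 / 4) \<le> (c + (norm y)\<^sup>2 / 4)\<^sup>2" by simp
    have pos: "0 < (\<Prod>b\<in>Basis. c + (y \<bullet> b)\<^sup>2 / 4)" using c by (intro prod_pos) (auto intro: add_pos_nonneg)
    have "heat_majorant c y \<le> 3 * c / (\<Prod>b\<in>Basis. c + (y \<bullet> b)\<^sup>2 / 4)"
      unfolding heat_majorant_def using le pos c by (intro divide_left_mono) (auto intro!: mult_pos_pos add_pos_nonneg)
    also have "\<dots> = 3 * c * (\<Prod>b\<in>Basis. f (y \<bullet> b))"
      using c by (simp add: f_def prod_dividef power2_eq_square)
    finally show ?thesis .
  qed
  have i: "integrable lborel (\<lambda>y::real^2. 3 * c * (\<Prod>b\<in>Basis. f (y \<bullet> b)))"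
    by (intro integrable_mult_right integrable_lborel_prod f_int)
  show I: "integrable lborel (heat_majorant c)"
    by (rule Bochner_Integration.integrable_bound[OF i])
      (use heat_majorant_nonneg[OF c] heat_majorant_f in \<open>auto intro: order_trans[OF _ abs_ge_self]\<close>)
  have "(LINT y|lborel. heat_majorant c y) \<le> (LINT y::real^2|lborel. 3 * c * (\<Prod>b\<in>Basis. f (y \<bullet> b)))"
    by (intro integral_mono I i heat_majorant_f)
  also have "\<dots> = 12 * pi\<^sup>2"
    unfolding integral_mult_right_zero integral_lborel_prod[OF f_int] f_val
    using c by (simp add: power2_eq_square)
  finally show "(LINT y|lborel. heat_majorant c y) \<le> 12 * pi\<^sup>2" .
qed

text \<open>
  Subordination of \<open>\<bar>\<xi>\<bar>\<close> to Gaussians: \<open>\<bar>\<xi>\<bar> = \<pi>\<^bsup>-1/2\<^esup> \<integral> \<bar>\<xi>\<bar>\<^sup>2 exp (- s\<^sup>2 \<bar>\<xi>\<bar>\<^sup>2) ds\<close>, rescaled by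
  \<open>s = \<sigma> v\<close>. The Fourier transform of \<open>mollifier e\<close> is \<open>erfc (e \<bar>\<xi>\<bar>)\<close>, whose derivative in \<open>e\<close> is
  a multiple of the transform \<open>\<bar>\<xi>\<bar> exp (- e\<^sup>2 \<bar>\<xi>\<bar>\<^sup>2)\<close> of \<open>heat_half_laplacian e\<close>.
\<close>

definition heat_half_laplacian :: "real \<Rightarrow> real^2 \<Rightarrow> real" where
  "heat_half_laplacian \<sigma> y = (LINT v|lborel. \<sigma> * heat_decay (\<sigma>\<^sup>2 * (1 + v\<^sup>2)) y) / sqrt pi"

definition mollifier :: "real \<Rightarrow> real^2 \<Rightarrow> real" where
  "mollifier e y = (LINT v|lborel. heat_kernel (e\<^sup>2 * (1 + v\<^sup>2)) y / (1 + v\<^sup>2)) / pi"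

text \<open>A regularised distance comparable to e + |y|. Its inverse cube matches the weight under
  which \<open>has_half_laplacian\<close> makes the stream function integrable.\<close>

definition reach :: "real \<Rightarrow> real^2 \<Rightarrow> real" where
  "reach e y = sqrt (e\<^sup>2 + (norm y)\<^sup>2 / 4)"

lemma reach_power2: "(reach e y)\<^sup>2 = e\<^sup>2 + (norm y)\<^sup>2 / 4"
  by (simp add: reach_def)

lemma reach_pos: "e > 0 \<Longrightarrow> 0 < reach e y"
  by (simp add: reach_def add_pos_nonneg)

lemma measurable_heat_kernel_comp [measurable (raw)]:
  assumes [measurable]: "f \<in> borel_measurable M" "g \<in> borel_measurable M"
  shows "(\<lambda>x. heat_kernel (f x) (g x)) \<in> borel_measurable M"
  unfolding heat_kernel_def by measurable

lemma measurable_heat_decay_comp [measurable (raw)]: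
  assumes [measurable]: "f \<in> borel_measurable M" "g \<in> borel_measurable M"
  shows "(\<lambda>x. heat_decay (f x) (g x)) \<in> borel_measurable M"
  unfolding heat_decay_def heat_kernel_def by measurable

lemma measurable_heat_half_laplacian_comp [measurable (raw)]:
  assumes [measurable]: "f \<in> borel_measurable M" "g \<in> borel_measurable M"
  shows "(\<lambda>x. heat_half_laplacian (f x) (g x)) \<in> borel_measurable M"
  unfolding heat_half_laplacian_def by measurable

lemma measurable_mollifier_comp [measurable (raw)]:
  assumes [measurable]: "f \<in> borel_measurable M" "g \<in> borel_measurable M"
  shows "(\<lambda>x. mollifier (f x) (g x)) \<in> borel_measurable M"
  unfolding mollifier_def by measurable

lemma dilation_pos: "e > 0 \<Longrightarrow> 0 < e\<^sup>2 * (1 + (v::real)\<^sup>2)"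
  by (intro mult_pos_pos add_pos_nonneg) auto

lemma one_plus_square_pos: "0 < 1 + (v::real)\<^sup>2"
  by (simp add: add_pos_nonneg)

text \<open>The division by 1 + v^2 cancels the same factor in the numerator, which leaves exactly
  the integrand of \<open>integral_inverse_quadratic_square\<close> with m =
  \<open>reach e y\<close>.\<close>

lemma heat_majorant_dilation:
  "heat_majorant (e\<^sup>2 * (1 + v\<^sup>2)) y / (1 + v\<^sup>2) = 3 * e\<^sup>2 * (1 / ((reach e y)\<^sup>2 + e\<^sup>2 * v\<^sup>2)\<^sup>2)"
proof -
  have "(reach e y)\<^sup>2 + e\<^sup>2 * v\<^sup>2 = e\<^sup>2 * (1 + v\<^sup>2) + (norm y)\<^sup>2 / 4"
    by (simp add: reach_power2 algebra_simps)
  then show ?thesis using one_plus_square_pos[of v] unfolding heat_majorant_def by simp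
qed

lemma half_laplacian_heat_kernel_scaled:
  assumes "\<sigma> > 0"
  shows "half_laplacian (\<lambda>x. heat_kernel (\<sigma>\<^sup>2) (x - z)) x = heat_half_laplacian \<sigma> (x - z)"
proof -
  have "(LINT s|lborel. heat_decay (\<sigma>\<^sup>2 + s\<^sup>2) (x - z)) = \<bar>\<sigma>\<bar> *\<^sub>R (LINT v|lborel. heat_decay (\<sigma>\<^sup>2 + (0 + \<sigma> * v)\<^sup>2) (x - z))"
    using assms by (intro lborel_integral_real_affine) auto
  also have "\<dots> = (LINT v|lborel. \<sigma> * heat_decay (\<sigma>\<^sup>2 * (1 + v\<^sup>2)) (x - z))"
    using assms by (simp add: algebra_simps power_mult_distrib)
  finally show ?thesis unfolding half_laplacian_heat_kernel[OF assms] heat_half_laplacian_def by simp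
qed

lemma heat_decay_dilation_le:
  assumes "\<sigma> > 0"
  shows "\<bar>\<sigma> * heat_decay (\<sigma>\<^sup>2 * (1 + v\<^sup>2)) y\<bar> \<le> 3 * \<sigma> * (1 / ((reach \<sigma> y)\<^sup>2 + \<sigma>\<^sup>2 * v\<^sup>2)\<^sup>2)"
proof -
  have "\<bar>\<sigma> * heat_decay (\<sigma>\<^sup>2 * (1 + v\<^sup>2)) y\<bar> \<le> \<sigma> * (heat_majorant (\<sigma>\<^sup>2 * (1 + v\<^sup>2)) y / (\<sigma>\<^sup>2 * (1 + v\<^sup>2)))"
    unfolding abs_mult using assms abs_heat_decay_le_heat_majorant[OF dilation_pos[OF assms]] by (intro mult_mono) auto
  also have "\<dots> = \<sigma> * ((heat_majorant (\<sigma>\<^sup>2 * (1 + v\<^sup>2)) y / (1 + v\<^sup>2)) / \<sigma>\<^sup>2)" by simp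
  also have "\<dots> = 3 * \<sigma> * (1 / ((reach \<sigma> y)\<^sup>2 + \<sigma>\<^sup>2 * v\<^sup>2)\<^sup>2)"
    unfolding heat_majorant_dilation using assms by simp
  finally show ?thesis .
qed

lemma abs_heat_half_laplacian_le:
  assumes "\<sigma> > 0"
  shows "\<bar>heat_half_laplacian \<sigma> y\<bar> \<le> 6 / (reach \<sigma> y) ^ 3"
proof -
  have r: "0 < reach \<sigma> y" by (rule reach_pos[OF assms])
  have i: "integrable lborel (\<lambda>v. 3 * \<sigma> * (1 / ((reach \<sigma> y)\<^sup>2 + \<sigma>\<^sup>2 * v\<^sup>2)\<^sup>2))"
    by (intro integrable_mult_right integrable_inverse_quadratic_square assms r)
  have I: "integrable lborel (\<lambda>v. \<sigma> * heat_decay (\<sigma>\<^sup>2 * (1 + v\<^sup>2)) y)"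
    by (rule Bochner_Integration.integrable_bound[OF i])
      (auto simp only: real_norm_def intro!: AE_I2 order_trans[OF heat_decay_dilation_le[OF assms] abs_ge_self], measurable)
  have "\<bar>heat_half_laplacian \<sigma> y\<bar> = \<bar>LINT v|lborel. \<sigma> * heat_decay (\<sigma>\<^sup>2 * (1 + v\<^sup>2)) y\<bar> / sqrt pi"
    by (simp add: heat_half_laplacian_def)
  also have "\<bar>LINT v|lborel. \<sigma> * heat_decay (\<sigma>\<^sup>2 * (1 + v\<^sup>2)) y\<bar> \<le> (LINT v|lborel. \<bar>\<sigma> * heat_decay (\<sigma>\<^sup>2 * (1 + v\<^sup>2)) y\<bar>)"
    by (rule integral_abs_bound)
  also have "\<dots> \<le> (LINT v|lborel. 3 * \<sigma> * (1 / ((reach \<sigma> y)\<^sup>2 + \<sigma>\<^sup>2 * v\<^sup>2)\<^sup>2))"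
    by (intro integral_mono integrable_abs I i heat_decay_dilation_le assms)
  also have "\<dots> \<le> 3 * \<sigma> * (pi / (\<sigma> * reach \<sigma> y ^ 3))"
    unfolding integral_mult_right_zero using assms r
    by (intro mult_left_mono integral_inverse_quadratic_square) auto
  also have "\<dots> = 3 * pi / reach \<sigma> y ^ 3" using assms by simp
  finally have "\<bar>heat_half_laplacian \<sigma> y\<bar> \<le> 3 * pi / reach \<sigma> y ^ 3 / sqrt pi" by (simp add: divide_right_mono)
  also have "\<dots> = 3 * (pi / sqrt pi) / reach \<sigma> y ^ 3" by simp
  also have "\<dots> = 3 * sqrt pi / reach \<sigma> y ^ 3" by (simp only: real_div_sqrt[OF pi_ge_zero])
  also have "\<dots> \<le> 6 / reach \<sigma> y ^ 3"
  proof -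
    have "sqrt pi \<le> sqrt 4" using pi_less_4 by (intro real_sqrt_le_mono) auto
    then show ?thesis using r by (intro divide_right_mono) auto
  qed
  finally show "\<bar>heat_half_laplacian \<sigma> y\<bar> \<le> 6 / (reach \<sigma> y) ^ 3" .
qed

lemma
  assumes "e > 0"
  shows integrable_heat_majorant_dilation: "integrable lborel (\<lambda>v. heat_majorant (e\<^sup>2 * (1 + v\<^sup>2)) y / (1 + v\<^sup>2))"
    and integral_heat_majorant_dilation_le: "(LINT v|lborel. heat_majorant (e\<^sup>2 * (1 + v\<^sup>2)) y / (1 + v\<^sup>2)) \<le> 3 * e * pi / (reach e y) ^ 3"
proof -
  have r: "0 < reach e y" by (rule reach_pos[OF assms])
  show "integrable lborel (\<lambda>v. heat_majorant (e\<^sup>2 * (1 + v\<^sup>2)) y / (1 + v\<^sup>2))"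
    unfolding heat_majorant_dilation by (intro integrable_mult_right integrable_inverse_quadratic_square assms r)
  have "(LINT v|lborel. heat_majorant (e\<^sup>2 * (1 + v\<^sup>2)) y / (1 + v\<^sup>2)) \<le> 3 * e\<^sup>2 * (pi / (e * reach e y ^ 3))"
    unfolding heat_majorant_dilation integral_mult_right_zero using assms r
    by (intro mult_left_mono integral_inverse_quadratic_square) auto
  then show "(LINT v|lborel. heat_majorant (e\<^sup>2 * (1 + v\<^sup>2)) y / (1 + v\<^sup>2)) \<le> 3 * e * pi / (reach e y) ^ 3"
    using assms by (simp add: power2_eq_square)
qed

lemma heat_kernel_dilation_nonneg: "e > 0 \<Longrightarrow> 0 \<le> heat_kernel (e\<^sup>2 * (1 + v\<^sup>2)) y / (1 + v\<^sup>2)"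
  using heat_kernel_pos[OF dilation_pos[of e v], of y] one_plus_square_pos[of v] by simp

lemma integrable_heat_kernel_dilation:
  assumes "e > 0"
  shows "integrable lborel (\<lambda>v. heat_kernel (e\<^sup>2 * (1 + v\<^sup>2)) y / (1 + v\<^sup>2))"
proof (rule Bochner_Integration.integrable_bound[OF integrable_heat_majorant_dilation[OF assms, of y]])
  show "AE v in lborel. norm (heat_kernel (e\<^sup>2 * (1 + v\<^sup>2)) y / (1 + v\<^sup>2)) \<le> norm (heat_majorant (e\<^sup>2 * (1 + v\<^sup>2)) y / (1 + v\<^sup>2))"
  proof (intro AE_I2)
    fix v :: real
    have "heat_kernel (e\<^sup>2 * (1 + v\<^sup>2)) y / (1 + v\<^sup>2) \<le> heat_majorant (e\<^sup>2 * (1 + v\<^sup>2)) y / (1 + v\<^sup>2)"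
      using heat_kernel_le_heat_majorant[OF dilation_pos[OF assms, of v], of y] one_plus_square_pos[of v] by (intro divide_right_mono) auto
    with heat_kernel_dilation_nonneg[OF assms, of v y]
    show "norm (heat_kernel (e\<^sup>2 * (1 + v\<^sup>2)) y / (1 + v\<^sup>2)) \<le> norm (heat_majorant (e\<^sup>2 * (1 + v\<^sup>2)) y / (1 + v\<^sup>2))"
      unfolding real_norm_def by linarith
  qed
qed measurable

lemma mollifier_nonneg: "e > 0 \<Longrightarrow> 0 \<le> mollifier e y"
  unfolding mollifier_def by (intro divide_nonneg_pos Bochner_Integration.integral_nonneg heat_kernel_dilation_nonneg) auto

lemma mollifier_le:
  assumes "e > 0"
  shows "mollifier e y \<le> 3 * e / (reach e y) ^ 3"
proof -
  have "(LINT v|lborel. heat_kernel (e\<^sup>2 * (1 + v\<^sup>2)) y / (1 + v\<^sup>2)) \<le> (LINT v|lborel. heat_majorant (e\<^sup>2 * (1 + v\<^sup>2)) y / (1 + v\<^sup>2))"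
    using heat_kernel_le_heat_majorant[OF dilation_pos[OF assms]] one_plus_square_pos
    by (intro integral_mono integrable_heat_kernel_dilation integrable_heat_majorant_dilation assms divide_right_mono) (auto intro: less_imp_le)
  also have "\<dots> \<le> 3 * e * pi / (reach e y) ^ 3" by (rule integral_heat_majorant_dilation_le[OF assms])
  finally have "mollifier e y \<le> 3 * e * pi / (reach e y) ^ 3 / pi"
    unfolding mollifier_def by (intro divide_right_mono) auto
  then show ?thesis by simp
qed

text \<open>Every kernel in the average has width at least e, so
  \<open>heat_kernel_diff_le_heat_majorant\<close> applies for all v with the common factor d / e.
  Compared with \<open>mollifier_le\<close> the factor e becomes d, which is what keeps the bound
  finite for large e.\<close>

lemma mollifier_diff_le:
  assumes "e > 0" and d: "norm (y1 - y2) \<le> d" "d \<le> e"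
  shows "\<bar>mollifier e y1 - mollifier e y2\<bar> \<le> 3 * d * (1 / reach e y1 ^ 3 + 1 / reach e y2 ^ 3)"
proof -
  define c where "c v = e\<^sup>2 * (1 + v\<^sup>2)" for v :: real
  have c0: "0 < c v" and ce: "e \<le> sqrt (c v)" for v
    using dilation_pos[OF assms(1), of v] assms(1) by (auto simp: c_def real_sqrt_mult)
  have d0: "0 \<le> d" using d norm_ge_zero order_trans by blast
  have I: "integrable lborel (\<lambda>v. heat_kernel (c v) y / (1 + v\<^sup>2))" "integrable lborel (\<lambda>v. heat_majorant (c v) y / (1 + v\<^sup>2))" for y
    unfolding c_def by (intro integrable_heat_kernel_dilation integrable_heat_majorant_dilation assms)+
  have pt: "\<bar>heat_kernel (c v) y1 / (1 + v\<^sup>2) - heat_kernel (c v) y2 / (1 + v\<^sup>2)\<bar> \<le> d / e * (heat_majorant (c v) y1 / (1 + v\<^sup>2) + heat_majorant (c v) y2 / (1 + v\<^sup>2))" for v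
  proof -
    have "\<bar>heat_kernel (c v) y1 - heat_kernel (c v) y2\<bar> \<le> d / sqrt (c v) * (heat_majorant (c v) y1 + heat_majorant (c v) y2)"
      using d ce[of v] by (intro heat_kernel_diff_le_heat_majorant c0) auto
    also have "\<dots> \<le> d / e * (heat_majorant (c v) y1 + heat_majorant (c v) y2)"
      using d0 ce[of v] assms(1) heat_majorant_nonneg[OF c0[of v]] c0[of v]
      by (intro mult_right_mono divide_left_mono) (auto intro!: mult_pos_pos)
    finally have "\<bar>heat_kernel (c v) y1 - heat_kernel (c v) y2\<bar> / (1 + v\<^sup>2) \<le> d / e * (heat_majorant (c v) y1 + heat_majorant (c v) y2) / (1 + v\<^sup>2)"
      using one_plus_square_pos[of v] by (intro divide_right_mono) auto
    then show ?thesis using one_plus_square_pos[of v]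
      by (simp add: diff_divide_distrib[symmetric] abs_divide add_divide_distrib[symmetric])
  qed
  have "\<bar>mollifier e y1 - mollifier e y2\<bar> = \<bar>LINT v|lborel. heat_kernel (c v) y1 / (1 + v\<^sup>2) - heat_kernel (c v) y2 / (1 + v\<^sup>2)\<bar> / pi"
    by (subst Bochner_Integration.integral_diff[OF I(1) I(1)]) (simp add: mollifier_def c_def[symmetric] diff_divide_distrib[symmetric])
  also have "\<bar>LINT v|lborel. heat_kernel (c v) y1 / (1 + v\<^sup>2) - heat_kernel (c v) y2 / (1 + v\<^sup>2)\<bar>
     \<le> (LINT v|lborel. \<bar>heat_kernel (c v) y1 / (1 + v\<^sup>2) - heat_kernel (c v) y2 / (1 + v\<^sup>2)\<bar>)"
    by (rule integral_abs_bound)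
  also have "\<dots> \<le> (LINT v|lborel. d / e * (heat_majorant (c v) y1 / (1 + v\<^sup>2) + heat_majorant (c v) y2 / (1 + v\<^sup>2)))"
    by (intro integral_mono integrable_abs Bochner_Integration.integrable_diff integrable_mult_right Bochner_Integration.integrable_add I pt)
  also have "\<dots> = d / e * ((LINT v|lborel. heat_majorant (c v) y1 / (1 + v\<^sup>2)) + (LINT v|lborel. heat_majorant (c v) y2 / (1 + v\<^sup>2)))"
    by (simp only: integral_mult_right_zero Bochner_Integration.integral_add[OF I(2) I(2)])
  also have "\<dots> \<le> d / e * (3 * e * pi / (reach e y1) ^ 3 + 3 * e * pi / (reach e y2) ^ 3)"
    unfolding c_def using d0 assms by (intro mult_left_mono add_mono integral_heat_majorant_dilation_le) auto
  also have "\<dots> = 3 * d * (1 / reach e y1 ^ 3 + 1 / reach e y2 ^ 3) * pi" using assms by (simp add: algebra_simps)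
  finally show ?thesis by (simp add: divide_right_mono pos_divide_le_eq)
qed

text \<open>Each heat kernel has mass 1 and the weights 1 / (1 + v^2) have total mass pi; hence the
  division by pi in \<open>mollifier\<close>.\<close>

lemma
  assumes "e > 0"
  shows integrable_mollifier: "integrable lborel (mollifier e)"
    and integral_mollifier: "(LINT y|lborel. mollifier e y) = 1"
proof -
  define f where "f v y = heat_kernel (e\<^sup>2 * (1 + v\<^sup>2)) y / (1 + v\<^sup>2)" for v :: real and y
  have [measurable]: "case_prod f \<in> borel_measurable (lborel \<Otimes>\<^sub>M lborel)"
    unfolding f_def by measurable
  have f0: "norm (f v y) = f v y" for v y unfolding f_def real_norm_def
    by (intro abs_of_nonneg heat_kernel_dilation_nonneg assms)
  have fy: "integrable lborel (f v)" and fy1: "(LINT y|lborel. f v y) = 1 / (1 + v\<^sup>2)" for v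
    using integrable_heat_kernel[OF dilation_pos[OF assms, of v]] by (auto simp: f_def[abs_def])
  have int: "integrable (lborel \<Otimes>\<^sub>M lborel) (case_prod f)"
    by (rule lborel_pair.Fubini_integrable) (simp_all only: prod.case f0 fy fy1 integrable_cauchy AE_I2 \<open>case_prod f \<in> _\<close>)
  have "mollifier e = (\<lambda>y. (LINT v|lborel. f v y) / pi)" by (simp add: mollifier_def[abs_def] f_def)
  moreover have "integrable lborel (\<lambda>y. LINT v|lborel. f v y)"
    using lborel_pair.integrable_snd[OF int] .
  moreover have "(LINT y|lborel. (LINT v|lborel. f v y)) = pi"
    unfolding lborel_pair.Fubini_integral[OF int] fy1 by (rule integral_cauchy)
  ultimately show "integrable lborel (mollifier e)" "(LINT y|lborel. mollifier e y) = 1"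
    by simp_all
qed

lemma integrable_lborel_pair_mult:
  fixes f :: "'a::euclidean_space \<Rightarrow> real" and g :: "'b::euclidean_space \<Rightarrow> real"
  assumes f: "integrable lborel f" and g: "integrable lborel g"
  shows "integrable (lborel \<Otimes>\<^sub>M lborel) (\<lambda>(x, y). f x * g y)"
proof (rule lborel_pair.Fubini_integrable)
  have [measurable]: "f \<in> borel_measurable borel" "g \<in> borel_measurable borel"
    using borel_measurable_integrable[OF f] borel_measurable_integrable[OF g] by simp_all
  show "(\<lambda>(x, y). f x * g y) \<in> borel_measurable (lborel \<Otimes>\<^sub>M lborel)"
    by measurable
  show "integrable lborel (\<lambda>x. LINT y|lborel. norm (case (x, y) of (x, y) \<Rightarrow> f x * g y))"
    unfolding prod.case norm_mult integral_mult_right_zero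
    by (intro integrable_mult_left integrable_norm f)
  show "AE x in lborel. integrable lborel (\<lambda>y. case (x, y) of (x, y) \<Rightarrow> f x * g y)"
    unfolding prod.case by (intro AE_I2 integrable_mult_right g)
qed

text \<open>For fixed v the integrand is the \<sigma>-derivative of - \<open>heat_kernel\<close>
  (\<sigma>^2 (1 + v^2)) / (2 (1 + v^2)), so the integral over widths telescopes, and averaging over
  v turns the two boundary terms into mollifiers.\<close>

lemma integral_heat_half_laplacian:
  assumes e: "0 < e" "e \<le> R"
  shows "(LINT \<sigma>|lborel. indicator {e..R} \<sigma> * heat_half_laplacian \<sigma> y) = sqrt pi / 2 * (mollifier e y - mollifier R y)"
proof -
  define f where "f v \<sigma> = indicator {e..R} \<sigma> * (\<sigma> * heat_decay (\<sigma>\<^sup>2 * (1 + v\<^sup>2)) y)" for v \<sigma> :: real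
  have [measurable]: "case_prod f \<in> borel_measurable (lborel \<Otimes>\<^sub>M lborel)"
    unfolding f_def by measurable
  \<comment> \<open>A crude product bound, degenerate as e tends to 0; it serves only to justify
    Fubini on the fixed interval.\<close>
  have bound: "norm (f v \<sigma>) \<le> (1 / (1 + v\<^sup>2)) * (3 * R / e ^ 4 * indicator {e..R} \<sigma>)" for v \<sigma>
  proof (cases "\<sigma> \<in> {e..R}")
    case True
    then have s: "\<sigma> > 0" using e by auto
    have "\<bar>\<sigma> * heat_decay (\<sigma>\<^sup>2 * (1 + v\<^sup>2)) y\<bar> \<le> 3 * \<sigma> * (1 / ((reach \<sigma> y)\<^sup>2 + \<sigma>\<^sup>2 * v\<^sup>2)\<^sup>2)"
      by (rule heat_decay_dilation_le[OF s])
    also have "\<dots> \<le> 3 * R * (1 / (e ^ 4 * (1 + v\<^sup>2)))"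
    proof (intro mult_mono divide_left_mono)
      have "e\<^sup>2 * (1 + v\<^sup>2) \<le> \<sigma>\<^sup>2 * (1 + v\<^sup>2)" using True e by (intro mult_right_mono power_mono) auto
      also have "\<dots> \<le> (reach \<sigma> y)\<^sup>2 + \<sigma>\<^sup>2 * v\<^sup>2" by (simp add: reach_power2 algebra_simps)
      finally have h1: "(e\<^sup>2 * (1 + v\<^sup>2))\<^sup>2 \<le> ((reach \<sigma> y)\<^sup>2 + \<sigma>\<^sup>2 * v\<^sup>2)\<^sup>2" using e by (intro power_mono) auto
      have h2: "e ^ 4 * (1 + v\<^sup>2) \<le> (e\<^sup>2 * (1 + v\<^sup>2))\<^sup>2"
      proof -
        have "1 + v\<^sup>2 \<le> (1 + v\<^sup>2)\<^sup>2" by (rule self_le_power) auto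
        then have "e ^ 4 * (1 + v\<^sup>2) \<le> e ^ 4 * (1 + v\<^sup>2)\<^sup>2" using e by (intro mult_left_mono) auto
        then show ?thesis by (simp add: power_mult_distrib)
      qed
      show "e ^ 4 * (1 + v\<^sup>2) \<le> ((reach \<sigma> y)\<^sup>2 + \<sigma>\<^sup>2 * v\<^sup>2)\<^sup>2" by (rule order_trans[OF h2 h1])
      show "0 < ((reach \<sigma> y)\<^sup>2 + \<sigma>\<^sup>2 * v\<^sup>2)\<^sup>2 * (e ^ 4 * (1 + v\<^sup>2))"
        using e s reach_pos[OF s, of y] by (auto intro!: mult_pos_pos zero_less_power add_pos_nonneg)
    qed (use True e in auto)
    finally show ?thesis using True by (simp add: f_def divide_inverse mult_ac)
  qed (use e in \<open>simp add: f_def\<close>)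
  have i2: "integrable lborel (\<lambda>\<sigma>. 3 * R / e ^ 4 * indicator {e..R} \<sigma>)"
    by (intro integrable_mult_right integrable_real_indicator) (auto simp: emeasure_lborel_Icc_eq)
  have int: "integrable (lborel \<Otimes>\<^sub>M lborel) (case_prod f)"
  proof (rule Bochner_Integration.integrable_bound)
    show "integrable (lborel \<Otimes>\<^sub>M lborel) (\<lambda>(v, \<sigma>). (1 / (1 + v\<^sup>2)) * (3 * R / e ^ 4 * indicator {e..R} \<sigma>))"
      by (rule integrable_lborel_pair_mult[OF integrable_cauchy i2])
    show "AE x in lborel \<Otimes>\<^sub>M lborel. norm (case_prod f x) \<le> norm (case x of (v, \<sigma>) \<Rightarrow> 1 / (1 + v\<^sup>2) * (3 * R / e ^ 4 * indicator {e..R} \<sigma>))"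
      unfolding case_prod_unfold by (intro AE_I2 order_trans[OF bound]) (simp only: real_norm_def abs_ge_self)
  qed simp
  have inner: "(LINT \<sigma>|lborel. f v \<sigma>) = (heat_kernel (e\<^sup>2 * (1 + v\<^sup>2)) y / (1 + v\<^sup>2) - heat_kernel (R\<^sup>2 * (1 + v\<^sup>2)) y / (1 + v\<^sup>2)) / 2" for v
  proof -
    define F where "F \<sigma> = - (heat_kernel (\<sigma>\<^sup>2 * (1 + v\<^sup>2)) y / (1 + v\<^sup>2)) / 2" for \<sigma>
    have w: "0 < 1 + v\<^sup>2" by (rule one_plus_square_pos)
    have gkD: "((\<lambda>c. heat_kernel c y) has_real_derivative - heat_decay c y) (at c)" if "c > 0" for c
      unfolding heat_kernel_def heat_decay_def using that
      by (auto intro!: derivative_eq_intros simp: field_simps power2_eq_square)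
    have D: "DERIV F \<sigma> :> \<sigma> * heat_decay (\<sigma>\<^sup>2 * (1 + v\<^sup>2)) y" if "\<sigma> \<in> {e..R}" for \<sigma>
    proof -
      have "0 < \<sigma>\<^sup>2 * (1 + v\<^sup>2)" using that e by (intro dilation_pos) auto
      then have "((\<lambda>\<sigma>. heat_kernel (\<sigma>\<^sup>2 * (1 + v\<^sup>2)) y) has_real_derivative (- heat_decay (\<sigma>\<^sup>2 * (1 + v\<^sup>2)) y) * (2 * \<sigma> * (1 + v\<^sup>2))) (at \<sigma>)"
        by (intro DERIV_chain2[OF gkD]) (auto intro!: derivative_eq_intros)
      then have "((\<lambda>\<sigma>. - (heat_kernel (\<sigma>\<^sup>2 * (1 + v\<^sup>2)) y / (1 + v\<^sup>2)) / 2) has_real_derivative - ((- heat_decay (\<sigma>\<^sup>2 * (1 + v\<^sup>2)) y) * (2 * \<sigma> * (1 + v\<^sup>2)) / (1 + v\<^sup>2)) / 2) (at \<sigma>)"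
        by (intro DERIV_cdivide DERIV_minus)
      then show ?thesis using w by (simp add: F_def[abs_def] mult.commute)
    qed
    have C: "continuous_on {e..R} (\<lambda>\<sigma>. \<sigma> * heat_decay (\<sigma>\<^sup>2 * (1 + v\<^sup>2)) y)"
      unfolding heat_decay_def heat_kernel_def using e w by (intro continuous_intros) auto
    have "(LINT \<sigma>|lborel. indicator {e..R} \<sigma> *\<^sub>R (\<sigma> * heat_decay (\<sigma>\<^sup>2 * (1 + v\<^sup>2)) y)) = F R - F e"
      using e D C by (intro integral_FTC_Icc) (auto simp: has_real_derivative_iff_has_vector_derivative[symmetric] intro: DERIV_subset)
    then show ?thesis by (simp add: f_def F_def diff_divide_distrib)
  qed
  have "(LINT \<sigma>|lborel. indicator {e..R} \<sigma> * heat_half_laplacian \<sigma> y) = (LINT \<sigma>|lborel. (LINT v|lborel. f v \<sigma>) / sqrt pi)"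
    unfolding f_def heat_half_laplacian_def by (intro Bochner_Integration.integral_cong) simp_all
  also have "\<dots> = (LINT v|lborel. (LINT \<sigma>|lborel. f v \<sigma>)) / sqrt pi"
    unfolding integral_divide_zero lborel_pair.Fubini_integral[OF int] ..
  also have "(LINT v|lborel. (LINT \<sigma>|lborel. f v \<sigma>)) = (pi * mollifier e y - pi * mollifier R y) / 2"
    unfolding inner integral_divide_zero using e
    by (subst Bochner_Integration.integral_diff) (auto simp: mollifier_def intro!: integrable_heat_kernel_dilation)
  also have "\<dots> / sqrt pi = (pi / sqrt pi) / 2 * (mollifier e y - mollifier R y)"
    by (simp add: algebra_simps diff_divide_distrib)
  also have "\<dots> = sqrt pi / 2 * (mollifier e y - mollifier R y)"
    by (simp only: real_div_sqrt[OF pi_ge_zero])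
  finally show ?thesis .
qed

section \<open>Gaussians are Schwartz functions\<close>

lemma real_polynomial_function_has_derivative:
  assumes "real_polynomial_function (p :: 'a::real_normed_vector \<Rightarrow> real)"
  shows "\<exists>p'. (\<forall>x. (p has_derivative p' x) (at x)) \<and> (\<forall>b. real_polynomial_function (\<lambda>x. p' x b))"
  using assms
proof (induction rule: real_polynomial_function.induct)
  case (linear f)
  then show ?case
    by (intro exI[of _ "\<lambda>x. f"]) (auto intro: bounded_linear_imp_has_derivative)
next
  case (const c)
  then show ?case by (intro exI[of _ "\<lambda>x b. 0"]) auto
next
  case (add f g)
  then obtain f' g' where *: "\<And>x. (f has_derivative f' x) (at x)" "\<And>b. real_polynomial_function (\<lambda>x. f' x b)"
    "\<And>x. (g has_derivative g' x) (at x)" "\<And>b. real_polynomial_function (\<lambda>x. g' x b)"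
    by metis
  then show ?case
    by (intro exI[of _ "\<lambda>x b. f' x b + g' x b"]) (auto intro!: has_derivative_add)
next
  case (mult f g)
  then obtain f' g' where *: "\<And>x. (f has_derivative f' x) (at x)" "\<And>b. real_polynomial_function (\<lambda>x. f' x b)"
    "\<And>x. (g has_derivative g' x) (at x)" "\<And>b. real_polynomial_function (\<lambda>x. g' x b)"
    by metis
  with mult.hyps show ?case
    by (intro exI[of _ "\<lambda>x b. f x * g' x b + f' x b * g x"]) (auto intro!: has_derivative_mult real_polynomial_function.intros(3,4))
qed

lemma real_polynomial_function_growth:
  assumes "real_polynomial_function (p :: 'a::real_normed_vector \<Rightarrow> real)"
  shows "\<exists>C n. \<forall>x. \<bar>p x\<bar> \<le> C * (1 + norm x) ^ n"
  using assms
proof (induction rule: real_polynomial_function.induct)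
  case (linear f)
  obtain K where K: "\<And>x. norm (f x) \<le> norm x * K" "0 < K"
    using bounded_linear.pos_bounded[OF linear] by blast
  have "\<bar>f x\<bar> \<le> K * (1 + norm x) ^ 1" for x
  proof -
    have "norm x * K \<le> (1 + norm x) * K" using K by (intro mult_right_mono) auto
    with K(1)[of x] show ?thesis by (simp add: mult.commute)
  qed
  then show ?case by blast
next
  case (const c)
  have "\<bar>c\<bar> \<le> \<bar>c\<bar> * (1 + norm x) ^ 0" for x :: 'a by simp
  then show ?case by blast
next
  case (add f g)
  then obtain C n D m where *: "\<And>x. \<bar>f x\<bar> \<le> C * (1 + norm x) ^ n" "\<And>x. \<bar>g x\<bar> \<le> D * (1 + norm x) ^ m"
    by metis
  have pos: "0 \<le> C" "0 \<le> D" using *[of 0] by (auto intro: order_trans[OF abs_ge_zero])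
  have "\<bar>f x + g x\<bar> \<le> (C + D) * (1 + norm x) ^ (n + m)" for x
  proof -
    have "(1 + norm x) ^ n \<le> (1 + norm x) ^ (n + m)" "(1 + norm x) ^ m \<le> (1 + norm x) ^ (n + m)"
      by (intro power_increasing; simp)+
    then have "C * (1 + norm x) ^ n + D * (1 + norm x) ^ m \<le> C * (1 + norm x) ^ (n + m) + D * (1 + norm x) ^ (n + m)"
      using pos by (intro add_mono mult_left_mono) auto
    with *[of x] show ?thesis by (simp add: distrib_right abs_le_iff)
  qed
  then show ?case by blast
next
  case (mult f g)
  then obtain C n D m where *: "\<And>x. \<bar>f x\<bar> \<le> C * (1 + norm x) ^ n" "\<And>x. \<bar>g x\<bar> \<le> D * (1 + norm x) ^ m"
    by metis
  have "\<bar>f x * g x\<bar> \<le> (C * D) * (1 + norm x) ^ (n + m)" for x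
  proof -
    have "\<bar>f x\<bar> * \<bar>g x\<bar> \<le> (C * (1 + norm x) ^ n) * (D * (1 + norm x) ^ m)"
      by (intro mult_mono * order_trans[OF abs_ge_zero *(1)]) auto
    then show ?thesis by (simp add: abs_mult power_add mult_ac)
  qed
  then show ?case by blast
qed

lemma heat_kernel_has_derivative:
  assumes "a > 0"
  shows "((\<lambda>x. heat_kernel a (x - z)) has_derivative (\<lambda>b. - ((x - z) \<bullet> b) / (2 * a) * heat_kernel a (x - z))) (at x)"
  unfolding heat_kernel_def power2_norm_eq_inner using assms
  by (auto intro!: derivative_eq_intros simp: fun_eq_iff inner_commute field_simps)

text \<open>Polynomials times the kernel form a class closed under partial derivatives, so it
  suffices to bound a polynomial times the kernel.\<close>

lemma schwartz_heat_kernel: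
  assumes a: "a > 0"
  shows "schwartz (\<lambda>x. heat_kernel a (x - z))"
proof -
  have d: "\<exists>p'. (\<forall>x. ((\<lambda>x. p x * heat_kernel a (x - z)) has_derivative (\<lambda>b. p' b x * heat_kernel a (x - z))) (at x)) \<and>
      (\<forall>b. real_polynomial_function (p' b))" if p: "real_polynomial_function p" for p
  proof -
    obtain p' where p': "\<And>x. (p has_derivative p' x) (at x)" "\<And>b. real_polynomial_function (\<lambda>x. p' x b)"
      using real_polynomial_function_has_derivative[OF p] by blast
    have "((\<lambda>x. p x * heat_kernel a (x - z)) has_derivative (\<lambda>b. (p x * (- ((x - z) \<bullet> b) / (2 * a)) + p' x b) * heat_kernel a (x - z))) (at x)" for x
      by (rule has_derivative_eq_rhs[OF has_derivative_mult[OF p'(1) heat_kernel_has_derivative[OF a]]]) (simp add: fun_eq_iff algebra_simps)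
    moreover have "real_polynomial_function (\<lambda>x. (p x * (- ((x - z) \<bullet> b) / (2 * a)) + p' x b))" for b
      by (intro real_polynomial_function.intros(3,4) p p' real_polynomial_function_divide real_polynomial_function_minus)
       (simp add: inner_diff_left real_polynomial_function_diff real_polynomial_function.intros(1) real_polynomial_function.intros(2) bounded_linear_inner_left)
    ultimately show ?thesis
      by (intro exI[of _ "\<lambda>b x. p x * (- ((x - z) \<bullet> b) / (2 * a)) + p' x b"]) blast
  qed
  have ip: "\<exists>p. real_polynomial_function p \<and> iter_partial bs (\<lambda>x. heat_kernel a (x - z)) = (\<lambda>x. p x * heat_kernel a (x - z))" for bs
  proof (induction bs)
    case Nil
    then show ?case by (intro exI[of _ "\<lambda>x. 1"]) (auto simp: real_polynomial_function.intros(2))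
  next
    case (Cons b bs)
    then obtain p where p: "real_polynomial_function p" "iter_partial bs (\<lambda>x. heat_kernel a (x - z)) = (\<lambda>x. p x * heat_kernel a (x - z))"
      by blast
    obtain p' where p': "\<And>x. ((\<lambda>x. p x * heat_kernel a (x - z)) has_derivative (\<lambda>b. p' b x * heat_kernel a (x - z))) (at x)"
      "\<And>b. real_polynomial_function (p' b)" using d[OF p(1)] by blast
    show ?case
      by (intro exI[of _ "p' b"]) (simp add: p(2) p'(2) frechet_derivative_at[OF p'(1), symmetric])
  qed
  have bd: "bounded (range (\<lambda>x. norm x ^ n * (p x * heat_kernel a (x - z))))" if p: "real_polynomial_function p" for n p
  proof -
    obtain C k where C: "\<And>x. \<bar>p x\<bar> \<le> C * (1 + norm x) ^ k"
      using real_polynomial_function_growth[OF p] by blast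
    have C0: "0 \<le> C" using C[of 0] by (auto intro: order_trans[OF abs_ge_zero])
    define m where "m = n + k"
    \<comment> \<open>With r = |x - z|, three estimates enter: 1 + |x| \<le> (1 + |z|) (1 + r), (1 +
      r)^m \<le> m! exp (1 + r), and r \<le> a + r^2 / (4 a). The last one trades the exponential
      against the Gaussian.\<close>
    define B where "B = C * (1 + norm z) ^ m * (fact m * exp (1 + a)) / (4 * pi * a)"
    have "norm (norm x ^ n * (p x * heat_kernel a (x - z))) \<le> B" for x
    proof -
      define r where "r = norm (x - z)"
      have r0: "0 \<le> r" by (simp add: r_def)
      have "1 + norm x \<le> (1 + norm z) * (1 + r)"
      proof -
        have "norm x \<le> norm z + r" unfolding r_def by (metis add.commute norm_triangle_sub)
        moreover have "0 \<le> norm z * r" using r0 by simp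
        ultimately show ?thesis by (simp add: algebra_simps)
      qed
      then have "(1 + norm x) ^ m \<le> ((1 + norm z) * (1 + r)) ^ m" by (intro power_mono) auto
      moreover have "norm x ^ n \<le> (1 + norm x) ^ n" by (intro power_mono) auto
      ultimately have 1: "norm x ^ n * \<bar>p x\<bar> \<le> C * ((1 + norm z) ^ m * (1 + r) ^ m)"
      proof -
        assume A: "(1 + norm x) ^ m \<le> ((1 + norm z) * (1 + r)) ^ m" "norm x ^ n \<le> (1 + norm x) ^ n"
        have "norm x ^ n * \<bar>p x\<bar> \<le> (1 + norm x) ^ n * (C * (1 + norm x) ^ k)"
          using A C by (intro mult_mono) auto
        also have "\<dots> = C * (1 + norm x) ^ m" by (simp add: m_def power_add)
        also have "\<dots> \<le> C * ((1 + norm z) * (1 + r)) ^ m" using A C0 by (intro mult_left_mono) auto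
        finally show ?thesis by (simp add: power_mult_distrib)
      qed
      have "(1 + r) ^ m / fact m \<le> exp (1 + r)"
      proof -
        have "(1 + r) ^ m / fact m \<le> (\<Sum>i. (1 + r) ^ i /\<^sub>R fact i)"
          using sum_le_suminf[OF summable_exp_generic[of "1 + r"], of "{m}"] r0 by (simp add: divide_inverse mult.commute)
        then show ?thesis by (simp add: exp_def)
      qed
      then have 2: "(1 + r) ^ m \<le> fact m * exp (1 + r)" by (simp add: field_simps)
      have "r \<le> a + r\<^sup>2 / (4 * a)"
      proof -
        have "0 \<le> (r - 2 * a)\<^sup>2 / (4 * a)" using a by simp
        also have "\<dots> = r\<^sup>2 / (4 * a) - r + a" using a by (simp add: field_simps power2_eq_square)
        finally show ?thesis by simp
      qed
      then have "exp (1 + r) \<le> exp (1 + a) * exp (r\<^sup>2 / (4 * a))" by (simp add: mult_exp_exp)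
      then have "(1 + r) ^ m \<le> fact m * (exp (1 + a) * exp (r\<^sup>2 / (4 * a)))"
        using 2 by (meson fact_ge_zero mult_left_mono order_trans)
      then have "(1 + r) ^ m * exp (- r\<^sup>2 / (4 * a)) \<le> fact m * exp (1 + a)"
        by (simp add: exp_minus field_simps)
      then have "(1 + r) ^ m * exp (- r\<^sup>2 / (4 * a)) / (4 * pi * a) \<le> fact m * exp (1 + a) / (4 * pi * a)"
        using a by (intro divide_right_mono) auto
      then have 3: "(1 + r) ^ m * heat_kernel a (x - z) \<le> fact m * exp (1 + a) / (4 * pi * a)"
        by (simp add: heat_kernel_def r_def)
      have "norm (norm x ^ n * (p x * heat_kernel a (x - z))) = norm x ^ n * \<bar>p x\<bar> * heat_kernel a (x - z)"
        using heat_kernel_pos[OF a, of "x - z"] by (simp add: abs_mult)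
      also have "\<dots> \<le> C * ((1 + norm z) ^ m * (1 + r) ^ m) * heat_kernel a (x - z)"
        using 1 heat_kernel_pos[OF a, of "x - z"] by (intro mult_right_mono) auto
      also have "\<dots> = C * (1 + norm z) ^ m * ((1 + r) ^ m * heat_kernel a (x - z))" by simp
      also have "\<dots> \<le> C * (1 + norm z) ^ m * (fact m * exp (1 + a) / (4 * pi * a))"
        using 3 C0 by (intro mult_left_mono) auto
      finally show ?thesis by (simp add: B_def)
    qed
    then show ?thesis by (intro boundedI[of _ B]) auto
  qed
  show ?thesis
    unfolding schwartz_def
  proof (intro allI impI conjI)
    fix bs x and n :: nat
    obtain p where p: "real_polynomial_function p" "iter_partial bs (\<lambda>x. heat_kernel a (x - z)) = (\<lambda>x. p x * heat_kernel a (x - z))"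
      using ip by blast
    show "iter_partial bs (\<lambda>x. heat_kernel a (x - z)) differentiable at x"
      unfolding p(2) using d[OF p(1)] unfolding differentiable_def by blast
    show "bounded (range (\<lambda>x. norm x ^ n * iter_partial bs (\<lambda>x. heat_kernel a (x - z)) x))"
      unfolding p(2) by (rule bd[OF p(1)])
  qed
qed

section \<open>Inverse cubes of the regularised distance\<close>

lemma reach_mono: "0 \<le> e \<Longrightarrow> e \<le> e' \<Longrightarrow> reach e y \<le> reach e' y"
  unfolding reach_def by (intro real_sqrt_le_mono add_right_mono power_mono)

lemma reach_ge: "0 \<le> e \<Longrightarrow> e \<le> reach e y"
  unfolding reach_def by (rule real_le_rsqrt) simp

lemma reach_ge_norm: "norm y / 2 \<le> reach e y"
  unfolding reach_def by (rule real_le_rsqrt) (simp add: power_divide)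

lemma measurable_reach [measurable]: "reach e \<in> borel_measurable borel"
  unfolding reach_def[abs_def] by measurable

text \<open>Moves the weight at the origin to any center z and width e: \<open>reach\<close>
  dominates both e and half the norm, whence 1 + |x - z| \<le> (1 / e + 2)
  \<open>reach e (x - z)\<close>.\<close>

lemma inverse_reach_cube_le_weight:
  assumes "e > 0"
  shows "1 / reach e (x - z) ^ 3 \<le> ((1 + norm z) * (1 / e + 2)) ^ 3 * (1 / (1 + norm x) ^ 3)"
proof -
  define K where "K = (1 + norm z) * (1 / e + 2)"
  have r: "0 < reach e (x - z)" by (rule reach_pos[OF assms])
  have "1 + norm (x - z) \<le> (1 / e + 2) * reach e (x - z)"
    using reach_ge[of e "x - z"] reach_ge_norm[of "x - z" e] assms by (simp add: field_simps add_mono)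
  then have "(1 + norm z) * (1 + norm (x - z)) \<le> K * reach e (x - z)"
    unfolding K_def mult.assoc by (intro mult_left_mono) auto
  moreover have "1 + norm x \<le> (1 + norm z) * (1 + norm (x - z))"
  proof -
    have "norm x \<le> norm z + norm (x - z)" by (metis add.commute norm_triangle_sub)
    moreover have "0 \<le> norm z * norm (x - z)" by simp
    ultimately have "1 + norm x \<le> 1 + norm z + norm (x - z) + norm z * norm (x - z)" by linarith
    then show ?thesis by (simp add: algebra_simps)
  qed
  ultimately have "(1 + norm x) ^ 3 \<le> (K * reach e (x - z)) ^ 3" by (intro power_mono) auto
  moreover have "0 < (1 + norm x) ^ 3" by (intro zero_less_power add_pos_nonneg) auto
  ultimately show ?thesis
    using r unfolding K_def[symmetric] by (simp add: field_simps power_mult_distrib)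
qed

text \<open>The function is recovered, up to the positive factor 3 c, as the integral over v of
  dilated majorants. Integrating these in y first gives at most 12 pi^2 / (1 + v^2), so Fubini
  yields integrability in the other order.\<close>

lemma integrable_inverse_reach_cube: "integrable lborel (\<lambda>y. 1 / reach 1 y ^ 3)"
proof -
  define c where "c = (LINT w|lborel. 1 / (1 + w\<^sup>2)\<^sup>2 :: real)"
  define f where "f v y = heat_majorant (1\<^sup>2 * (1 + v\<^sup>2)) y / (1 + v\<^sup>2)" for v :: real and y
  have i1: "integrable lborel (\<lambda>w::real. 1 / (1 + w\<^sup>2)\<^sup>2)"
    using integrable_inverse_quadratic_square[of 1 1] by simp
  have c: "c > 0"
  proof -
    have "(LINT w::real|lborel. indicator {0..1} w * (1/4)) \<le> c"
      unfolding c_def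
    proof (intro integral_mono i1)
      show "integrable lborel (\<lambda>w::real. indicator {0..1} w * (1/4) :: real)"
        by (intro integrable_mult_left integrable_real_indicator) (auto simp: emeasure_lborel_Icc_eq)
      fix w :: real
      show "indicator {0..1} w * (1/4) \<le> 1 / (1 + w\<^sup>2)\<^sup>2"
      proof (cases "w \<in> {0..1}")
        case True
        then have "1 + w\<^sup>2 \<le> 2" by (simp add: power_le_one)
        then have "(1 + w\<^sup>2)\<^sup>2 \<le> 2\<^sup>2" by (intro power_mono) auto
        then show ?thesis using True one_plus_square_pos[of w] by (simp add: field_simps)
      qed simp
    qed
    then show ?thesis by simp
  qed
  have [measurable]: "case_prod f \<in> borel_measurable (lborel \<Otimes>\<^sub>M lborel)"
    unfolding f_def heat_majorant_def by measurable
  have f0: "norm (f v y) = f v y" for v y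
    unfolding f_def real_norm_def using dilation_pos[of 1 v] one_plus_square_pos[of v]
    by (intro abs_of_nonneg divide_nonneg_pos heat_majorant_nonneg) auto
  have fi: "integrable lborel (f v)" for v
    unfolding f_def using dilation_pos[of 1 v] by (intro integrable_divide integrable_heat_majorant) auto
  have "integrable lborel (\<lambda>v. LINT y|lborel. f v y)"
  proof (rule Bochner_Integration.integrable_bound)
    show "integrable lborel (\<lambda>v::real. 12 * pi\<^sup>2 * (1 / (1 + v\<^sup>2)))"
      by (intro integrable_mult_right integrable_cauchy)
    show "AE v in lborel. norm (LINT y|lborel. f v y) \<le> norm (12 * pi\<^sup>2 * (1 / (1 + v\<^sup>2)))"
    proof (intro AE_I2)
      fix v :: real
      have "0 \<le> (LINT y|lborel. f v y)" using f0 by (intro Bochner_Integration.integral_nonneg) (metis norm_ge_zero)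
      moreover have "(LINT y|lborel. f v y) = (LINT y|lborel. heat_majorant (1 + v\<^sup>2) y) / (1 + v\<^sup>2)"
        by (simp add: f_def)
      moreover have "\<dots> \<le> 12 * pi\<^sup>2 / (1 + v\<^sup>2)"
        using one_plus_square_pos[of v] by (intro divide_right_mono integral_heat_majorant_le) auto
      ultimately show "norm (LINT y|lborel. f v y) \<le> norm (12 * pi\<^sup>2 * (1 / (1 + v\<^sup>2)))"
        by simp
    qed
  qed measurable
  then have int: "integrable (lborel \<Otimes>\<^sub>M lborel) (case_prod f)"
    by (intro lborel_pair.Fubini_integrable) (simp_all only: prod.case f0 fi AE_I2 \<open>case_prod f \<in> _\<close>)
  have val: "(LINT v|lborel. f v y) = 3 * c * (1 / reach 1 y ^ 3)" for y
  proof -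
    define m where "m = reach 1 y"
    have m: "0 < m" unfolding m_def by (intro reach_pos) auto
    have "(LINT v|lborel. f v y) = 3 * (LINT v|lborel. 1 / (m\<^sup>2 + v\<^sup>2)\<^sup>2)"
      unfolding f_def heat_majorant_dilation m_def integral_mult_right_zero by simp
    also have "(LINT v|lborel. 1 / (m\<^sup>2 + v\<^sup>2)\<^sup>2) = \<bar>m\<bar> *\<^sub>R (LINT v|lborel. 1 / (m\<^sup>2 + (0 + m * v)\<^sup>2)\<^sup>2)"
      using m by (intro lborel_integral_real_affine) auto
    also have "(\<lambda>v. 1 / (m\<^sup>2 + (0 + m * v)\<^sup>2)\<^sup>2) = (\<lambda>v. (1 / m ^ 4) * (1 / (1 + v\<^sup>2)\<^sup>2))"
    proof
      fix v
      have "m\<^sup>2 + (0 + m * v)\<^sup>2 = m\<^sup>2 * (1 + v\<^sup>2)" by (simp add: algebra_simps power_mult_distrib)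
      then show "1 / (m\<^sup>2 + (0 + m * v)\<^sup>2)\<^sup>2 = (1 / m ^ 4) * (1 / (1 + v\<^sup>2)\<^sup>2)"
        by (simp add: power_mult_distrib)
    qed
    also have "\<bar>m\<bar> *\<^sub>R (LINT v|lborel. (1 / m ^ 4) * (1 / (1 + v\<^sup>2)\<^sup>2)) = c / m ^ 3"
      unfolding integral_mult_right_zero c_def[symmetric] using m by (simp add: field_simps power_numeral_reduce)
    finally show ?thesis by (simp add: m_def)
  qed
  have "integrable lborel (\<lambda>y. 3 * c * (1 / reach 1 y ^ 3))"
    using lborel_pair.integrable_snd[OF int] unfolding val .
  then show ?thesis using c unfolding integrable_mult_left_iff by simp
qed

section \<open>The modulus of continuity of the stream function\<close>

text \<open>One time slice. In the application \<open>M\<close> and \<open>L\<close> do not depend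
  on time, hence neither does the modulus obtained from them.\<close>

locale half_laplacian_pair =
  fixes \<psi> \<theta> :: "real^2 \<Rightarrow> real" and M L :: real
  assumes cont_psi: "continuous_on UNIV \<psi>"
    and cont_theta: "continuous_on UNIV \<theta>"
    and hl: "has_half_laplacian \<psi> (\<lambda>x. - \<theta> x)"
    and theta_bound: "\<And>x. \<bar>\<theta> x\<bar> \<le> M"
    and theta_L2: "integrable lborel (\<lambda>x. (\<theta> x)\<^sup>2)" "(LINT x|lborel. (\<theta> x)\<^sup>2) \<le> L"
begin

lemma measurable_psi [measurable]: "\<psi> \<in> borel_measurable borel"
  by (rule borel_measurable_continuous_onI[OF cont_psi])

lemma measurable_theta [measurable]: "\<theta> \<in> borel_measurable borel"
  by (rule borel_measurable_continuous_onI[OF cont_theta])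

lemma integrable_weighted_psi:
  assumes "e > 0"
  shows "integrable lborel (\<lambda>x. \<bar>\<psi> x\<bar> * (1 / reach e (x - z) ^ 3))"
proof (rule Bochner_Integration.integrable_bound)
  define K where "K = ((1 + norm z) * (1 / e + 2)) ^ 3"
  show "integrable lborel (\<lambda>x. K * (\<psi> x / (1 + norm x) ^ 3))"
    using hl unfolding has_half_laplacian_def by (intro integrable_mult_right) auto
  have K: "0 \<le> K" using assms by (simp add: K_def)
  have "\<bar>\<psi> x\<bar> * (1 / reach e (x - z) ^ 3) \<le> K * (\<bar>\<psi> x\<bar> / (1 + norm x) ^ 3)" for x
    using mult_left_mono[OF inverse_reach_cube_le_weight[OF assms, of x z], of "\<bar>\<psi> x\<bar>"]
    by (simp add: K_def mult_ac)
  then show "AE x in lborel. norm (\<bar>\<psi> x\<bar> * (1 / reach e (x - z) ^ 3)) \<le> norm (K * (\<psi> x / (1 + norm x) ^ 3))"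
    using reach_pos[OF assms] K by (auto simp: abs_mult abs_divide power_abs abs_of_pos intro!: AE_I2)
qed measurable

lemma integrable_psi_mollifier:
  assumes "e > 0"
  shows "integrable lborel (\<lambda>x. \<psi> x * mollifier e (x - z))"
proof (rule Bochner_Integration.integrable_bound)
  show "integrable lborel (\<lambda>x. 3 * e * (\<bar>\<psi> x\<bar> * (1 / reach e (x - z) ^ 3)))"
    by (intro integrable_mult_right integrable_weighted_psi assms)
  have "\<bar>\<psi> x\<bar> * mollifier e (x - z) \<le> \<bar>\<psi> x\<bar> * (3 * e / reach e (x - z) ^ 3)" for x
    by (intro mult_left_mono mollifier_le assms) auto
  then have "\<bar>\<psi> x * mollifier e (x - z)\<bar> \<le> 3 * e * (\<bar>\<psi> x\<bar> * (1 / reach e (x - z) ^ 3))" for x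
    using mollifier_nonneg[OF assms, of "x - z"] by (simp add: abs_mult mult_ac)
  then show "AE x in lborel. norm (\<psi> x * mollifier e (x - z)) \<le> norm (3 * e * (\<bar>\<psi> x\<bar> * (1 / reach e (x - z) ^ 3)))"
    unfolding real_norm_def by (intro AE_I2 order_trans[OF _ abs_ge_self])
qed measurable

section \<open>Representation of the stream function by heat averages\<close>

definition mollified :: "real \<Rightarrow> real^2 \<Rightarrow> real" where
  "mollified e z = (LINT x|lborel. \<psi> x * mollifier e (x - z))"

definition avg :: "real \<Rightarrow> real^2 \<Rightarrow> real" where
  "avg \<sigma> z = (LINT x|lborel. \<theta> x * heat_kernel (\<sigma>\<^sup>2) (x - z))"

lemma avg_eq:
  assumes "\<sigma> > 0"
  shows "(LINT x|lborel. \<psi> x * heat_half_laplacian \<sigma> (x - z)) = - avg \<sigma> z"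
proof -
  have "schwartz (\<lambda>x. heat_kernel (\<sigma>\<^sup>2) (x - z))" using assms by (intro schwartz_heat_kernel) auto
  then have "(LINT x|lborel. \<psi> x * half_laplacian (\<lambda>x. heat_kernel (\<sigma>\<^sup>2) (x - z)) x) = (LINT x|lborel. - \<theta> x * heat_kernel (\<sigma>\<^sup>2) (x - z))"
    using hl unfolding has_half_laplacian_def by blast
  then show ?thesis by (simp add: half_laplacian_heat_kernel_scaled[OF assms] avg_def)
qed

text \<open>\<open>avg_eq\<close> integrated over the widths, with Fubini and
  \<open>integral_heat_half_laplacian\<close>: the averages of \<theta> between widths e and R
  measure how much the mollification of \<psi> changes between these scales.\<close>

lemma
  assumes e: "0 < e" "e \<le> R"
  shows integrable_avg: "integrable lborel (\<lambda>\<sigma>. indicator {e..R} \<sigma> * avg \<sigma> z)"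
    and integral_avg: "(LINT \<sigma>|lborel. indicator {e..R} \<sigma> * avg \<sigma> z)
      = - (sqrt pi / 2 * (mollified e z - mollified R z))"
proof -
  define f where "f \<sigma> x = indicator {e..R} \<sigma> * (\<psi> x * heat_half_laplacian \<sigma> (x - z))" for \<sigma> :: real and x
  have [measurable]: "case_prod f \<in> borel_measurable (lborel \<Otimes>\<^sub>M lborel)"
    unfolding f_def by measurable
  have bound: "norm (f \<sigma> x) \<le> indicator {e..R} \<sigma> * (6 * (\<bar>\<psi> x\<bar> * (1 / reach e (x - z) ^ 3)))" for \<sigma> x
  proof (cases "\<sigma> \<in> {e..R}")
    case True
    then have s: "\<sigma> > 0" using e by auto
    have "\<bar>heat_half_laplacian \<sigma> (x - z)\<bar> \<le> 6 / reach \<sigma> (x - z) ^ 3" by (rule abs_heat_half_laplacian_le[OF s])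
    also have "\<dots> \<le> 6 / reach e (x - z) ^ 3"
      using True e reach_pos[OF e(1), of "x - z"] reach_pos[OF s, of "x - z"] reach_mono[of e \<sigma> "x - z"]
      by (intro divide_left_mono power_mono) auto
    finally have "\<bar>\<psi> x\<bar> * \<bar>heat_half_laplacian \<sigma> (x - z)\<bar> \<le> \<bar>\<psi> x\<bar> * (6 / reach e (x - z) ^ 3)" by (intro mult_left_mono) auto
    then show ?thesis using True by (simp add: f_def abs_mult mult_ac)
  qed (simp add: f_def)
  have int: "integrable (lborel \<Otimes>\<^sub>M lborel) (case_prod f)"
  proof (rule Bochner_Integration.integrable_bound)
    show "integrable (lborel \<Otimes>\<^sub>M lborel) (\<lambda>(\<sigma>, x). indicator {e..R} \<sigma> * (6 * (\<bar>\<psi> x\<bar> * (1 / reach e (x - z) ^ 3))))"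
      by (intro integrable_lborel_pair_mult integrable_real_indicator integrable_mult_right integrable_weighted_psi e)
        (auto simp: emeasure_lborel_Icc_eq)
    show "AE p in lborel \<Otimes>\<^sub>M lborel. norm (case_prod f p) \<le> norm (case p of (\<sigma>, x) \<Rightarrow> indicator {e..R} \<sigma> * (6 * (\<bar>\<psi> x\<bar> * (1 / reach e (x - z) ^ 3))))"
      unfolding case_prod_unfold by (intro AE_I2 order_trans[OF bound]) (simp only: real_norm_def abs_ge_self)
  qed measurable
  have inner: "(LINT x|lborel. f \<sigma> x) = - (indicator {e..R} \<sigma> * avg \<sigma> z)" for \<sigma>
    using avg_eq[of \<sigma> z] e by (cases "\<sigma> \<in> {e..R}") (simp_all add: f_def)
  show "integrable lborel (\<lambda>\<sigma>. indicator {e..R} \<sigma> * avg \<sigma> z)"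
    using lborel_pair.integrable_fst[OF int] unfolding inner by simp
  have "(LINT \<sigma>|lborel. indicator {e..R} \<sigma> * avg \<sigma> z) = - (LINT \<sigma>|lborel. (LINT x|lborel. f \<sigma> x))"
    unfolding inner by simp
  also have "(LINT \<sigma>|lborel. (LINT x|lborel. f \<sigma> x)) = (LINT x|lborel. (LINT \<sigma>|lborel. f \<sigma> x))"
    by (rule lborel_pair.Fubini_integral[symmetric, OF int])
  also have "\<dots> = (LINT x|lborel. sqrt pi / 2 * (\<psi> x * mollifier e (x - z) - \<psi> x * mollifier R (x - z)))"
  proof (rule Bochner_Integration.integral_cong)
    fix x
    have "(LINT \<sigma>|lborel. f \<sigma> x) = \<psi> x * (LINT \<sigma>|lborel. indicator {e..R} \<sigma> * heat_half_laplacian \<sigma> (x - z))"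
      unfolding f_def integral_mult_right_zero[symmetric] by (intro Bochner_Integration.integral_cong) simp_all
    then show "(LINT \<sigma>|lborel. f \<sigma> x) = sqrt pi / 2 * (\<psi> x * mollifier e (x - z) - \<psi> x * mollifier R (x - z))"
      unfolding integral_heat_half_laplacian[OF e] by (simp add: algebra_simps)
  qed simp
  also have "\<dots> = sqrt pi / 2 * (mollified e z - mollified R z)"
    unfolding integral_mult_right_zero mollified_def using e
    by (subst Bochner_Integration.integral_diff) (auto intro!: integrable_psi_mollifier)
  finally show "(LINT \<sigma>|lborel. indicator {e..R} \<sigma> * avg \<sigma> z)
      = - (sqrt pi / 2 * (mollified e z - mollified R z))" .
qed

text \<open>Near z continuity of \<psi> suffices because the mollifier has mass 1. Far from z the
  mollifier is of order e times an inverse cube, against which \<psi> is integrable.\<close>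

lemma mollified_tendsto: "(\<lambda>n. mollified (inverse (real (Suc n))) z) \<longlonglongrightarrow> \<psi> z"
proof (rule tendstoI)
  fix \<epsilon> :: real assume "\<epsilon> > 0"
  then have e2: "\<epsilon> / 2 > 0" by simp
  obtain r where r: "r > 0" "\<And>x. dist x z < r \<Longrightarrow> dist (\<psi> x) (\<psi> z) < \<epsilon> / 2"
    using cont_psi e2 unfolding continuous_on_iff by (metis UNIV_I)
  \<comment> \<open>Outside the ball of radius r this bounds the ratio of \<open>reach 1\<close> to
    \<open>reach e\<close> uniformly in e.\<close>
  define k where "k = sqrt (4 / r\<^sup>2 + 1)"
  define g where "g x = \<bar>\<psi> x - \<psi> z\<bar>" for x
  have [measurable]: "g \<in> borel_measurable borel" unfolding g_def by measurable
  have gi: "integrable lborel (\<lambda>x. g x * (1 / reach 1 (x - z) ^ 3))"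
  proof (rule Bochner_Integration.integrable_bound)
    have "integrable lborel (\<lambda>x. 1 / reach 1 (x - z) ^ 3)"
      using integrable_inverse_reach_cube by (subst integrable_lborel_translate) auto
    then show "integrable lborel (\<lambda>x. \<bar>\<psi> x\<bar> * (1 / reach 1 (x - z) ^ 3) + \<bar>\<psi> z\<bar> * (1 / reach 1 (x - z) ^ 3))"
      by (intro Bochner_Integration.integrable_add integrable_weighted_psi integrable_mult_right) auto
    have "norm (g x * (1 / reach 1 (x - z) ^ 3)) \<le> \<bar>\<psi> x\<bar> * (1 / reach 1 (x - z) ^ 3) + \<bar>\<psi> z\<bar> * (1 / reach 1 (x - z) ^ 3)" for x
    proof -
      have "0 \<le> 1 / reach 1 (x - z) ^ 3" using reach_pos[of 1 "x - z"] by simp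
      moreover have "g x \<le> \<bar>\<psi> x\<bar> + \<bar>\<psi> z\<bar>" unfolding g_def by (rule abs_triangle_ineq4)
      ultimately have "g x * (1 / reach 1 (x - z) ^ 3) \<le> (\<bar>\<psi> x\<bar> + \<bar>\<psi> z\<bar>) * (1 / reach 1 (x - z) ^ 3)"
        by (rule mult_right_mono[rotated])
      moreover have "norm (g x * (1 / reach 1 (x - z) ^ 3)) = g x * (1 / reach 1 (x - z) ^ 3)"
        using \<open>0 \<le> 1 / reach 1 (x - z) ^ 3\<close> unfolding real_norm_def by (intro abs_of_nonneg mult_nonneg_nonneg) (auto simp: g_def)
      ultimately show ?thesis by (simp only: distrib_right)
    qed
    then show "AE x in lborel. norm (g x * (1 / reach 1 (x - z) ^ 3)) \<le> norm (\<bar>\<psi> x\<bar> * (1 / reach 1 (x - z) ^ 3) + \<bar>\<psi> z\<bar> * (1 / reach 1 (x - z) ^ 3))"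
      unfolding real_norm_def by (intro AE_I2 order_trans[OF _ abs_ge_self])
  qed measurable
  define G where "G = (LINT x|lborel. g x * (1 / reach 1 (x - z) ^ 3))"
  have main: "\<bar>mollified e z - \<psi> z\<bar> \<le> \<epsilon> / 2 + 3 * e * k ^ 3 * G" if e: "e > 0" for e
  proof -
    have eti: "integrable lborel (\<lambda>x. mollifier e (x - z))" and et1: "(LINT x|lborel. mollifier e (x - z)) = 1"
      using integrable_mollifier[OF e] integral_mollifier[OF e] integral_lborel_translate[of "mollifier e" z] integrable_lborel_translate[of "mollifier e" z]
      by (simp_all add: measurable_mollifier_comp)
    have "mollified e z - \<psi> z = (LINT x|lborel. \<psi> x * mollifier e (x - z)) - \<psi> z * (LINT x|lborel. mollifier e (x - z))"
      by (simp add: et1 mollified_def)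
    also have "\<dots> = (LINT x|lborel. \<psi> x * mollifier e (x - z) - \<psi> z * mollifier e (x - z))"
      unfolding integral_mult_right_zero[symmetric]
      by (subst Bochner_Integration.integral_diff) (auto intro!: integrable_psi_mollifier e eti)
    finally have "\<bar>mollified e z - \<psi> z\<bar> \<le> (LINT x|lborel. \<bar>\<psi> x * mollifier e (x - z) - \<psi> z * mollifier e (x - z)\<bar>)"
      by (simp only: integral_abs_bound)
    also have "\<dots> \<le> (LINT x|lborel. \<epsilon> / 2 * mollifier e (x - z) + 3 * e * k ^ 3 * (g x * (1 / reach 1 (x - z) ^ 3)))"
    proof (intro integral_mono integrable_abs Bochner_Integration.integrable_diff Bochner_Integration.integrable_add integrable_mult_right
          integrable_psi_mollifier e eti gi)
      fix x
      have a: "\<bar>\<psi> x * mollifier e (x - z) - \<psi> z * mollifier e (x - z)\<bar> = g x * mollifier e (x - z)"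
        unfolding left_diff_distrib[symmetric] abs_mult g_def using mollifier_nonneg[OF e, of "x - z"] by simp
      have t2: "0 \<le> 3 * e * k ^ 3 * (g x * (1 / reach 1 (x - z) ^ 3))"
        using e reach_pos[of 1 "x - z"] by (auto simp: g_def k_def intro!: mult_nonneg_nonneg)
      have t1: "0 \<le> \<epsilon> / 2 * mollifier e (x - z)" using e2 mollifier_nonneg[OF e, of "x - z"] by simp
      show "\<bar>\<psi> x * mollifier e (x - z) - \<psi> z * mollifier e (x - z)\<bar>
          \<le> \<epsilon> / 2 * mollifier e (x - z) + 3 * e * k ^ 3 * (g x * (1 / reach 1 (x - z) ^ 3))"
      proof (cases "dist x z < r")
        case True
        then have "g x \<le> \<epsilon> / 2" using r(2)[of x] by (simp add: g_def dist_real_def)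
        then have "g x * mollifier e (x - z) \<le> \<epsilon> / 2 * mollifier e (x - z)" using mollifier_nonneg[OF e, of "x - z"] by (rule mult_right_mono)
        with a t2 show ?thesis by linarith
      next
        case False
        define y where "y = x - z"
        have y: "r \<le> norm y" using False by (simp add: y_def dist_norm)
        have "reach 1 y \<le> k * reach e y"
        proof -
          have "r\<^sup>2 \<le> (norm y)\<^sup>2" using y r(1) by (intro power_mono) auto
          then have "1 \<le> (norm y)\<^sup>2 / r\<^sup>2" using r(1) by (subst le_divide_eq_1_pos) auto
          then have "1 + (norm y)\<^sup>2 / 4 \<le> (4 / r\<^sup>2 + 1) * ((norm y)\<^sup>2 / 4)"
            by (simp add: distrib_right)
          also have "\<dots> \<le> (4 / r\<^sup>2 + 1) * (e\<^sup>2 + (norm y)\<^sup>2 / 4)"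
            using r(1) by (intro mult_left_mono) auto
          finally show ?thesis unfolding reach_def k_def real_sqrt_mult[symmetric] by simp
        qed
        then have "reach 1 y ^ 3 \<le> (k * reach e y) ^ 3" using reach_pos[of 1 y] by (intro power_mono) auto
        then have "1 / reach e y ^ 3 \<le> k ^ 3 * (1 / reach 1 y ^ 3)"
          using reach_pos[of 1 y] reach_pos[OF e, of y] by (simp add: field_simps power_mult_distrib)
        then have "3 * e * (1 / reach e y ^ 3) \<le> 3 * e * (k ^ 3 * (1 / reach 1 y ^ 3))"
          using e by (intro mult_left_mono) auto
        with mollifier_le[OF e, of y] have "mollifier e y \<le> 3 * e * k ^ 3 * (1 / reach 1 y ^ 3)" by simp
        then have "g x * mollifier e y \<le> g x * (3 * e * k ^ 3 * (1 / reach 1 y ^ 3))"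
          by (intro mult_left_mono) (auto simp: g_def)
        also have "\<dots> = 3 * e * k ^ 3 * (g x * (1 / reach 1 (x - z) ^ 3))" by (simp add: y_def)
        finally show ?thesis using a t1 unfolding y_def by linarith
      qed
    qed
    also have "\<dots> = \<epsilon> / 2 + 3 * e * k ^ 3 * G"
      unfolding G_def
      by (simp only: Bochner_Integration.integral_add[OF integrable_mult_right[OF eti] integrable_mult_right[OF gi]]
          integral_mult_right_zero et1 mult_1_right)
    finally show ?thesis .
  qed
  have "(\<lambda>n. 3 * inverse (real (Suc n)) * k ^ 3 * G) \<longlonglongrightarrow> 3 * 0 * k ^ 3 * G"
    by (intro tendsto_intros LIMSEQ_inverse_real_of_nat)
  then have "\<forall>\<^sub>F n in sequentially. 3 * inverse (real (Suc n)) * k ^ 3 * G < \<epsilon> / 2"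
    using e2 by (intro order_tendstoD) auto
  then show "\<forall>\<^sub>F n in sequentially. dist (mollified (inverse (real (Suc n))) z) (\<psi> z) < \<epsilon>"
  proof eventually_elim
    case (elim n)
    have "0 < inverse (real (Suc n))" by simp
    from main[OF this] elim show ?case unfolding dist_real_def by linarith
  qed
qed

text \<open>The growth of \<psi> may prevent each mollification from converging at large scales. In
  the difference the factor R of \<open>mollifier_le\<close> is replaced by the distance of the
  centers, so dominated convergence applies.\<close>

lemma mollified_diff_tendsto: "(\<lambda>n. mollified (norm (z1 - z2) + real (Suc n)) z1 - mollified (norm (z1 - z2) + real (Suc n)) z2) \<longlonglongrightarrow> 0"
proof -
  define d where "d = norm (z1 - z2)"
  \<comment> \<open>The summand d guarantees d \<le> \<open>R n\<close>, as
    \<open>mollifier_diff_le\<close> demands; \<open>Suc n\<close> keeps the scale at least 1, so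
    one dominating function serves all n.\<close>
  define R where "R n = d + real (Suc n)" for n
  have d0: "0 \<le> d" by (simp add: d_def)
  have R: "R n > 0" "d \<le> R n" "1 \<le> R n" "real (Suc n) \<le> R n" for n using d0 by (auto simp: R_def)
  define s where "s n x = \<psi> x * mollifier (R n) (x - z1) - \<psi> x * mollifier (R n) (x - z2)" for n x
  define w where "w x = 3 * d * (\<bar>\<psi> x\<bar> * (1 / reach 1 (x - z1) ^ 3) + \<bar>\<psi> x\<bar> * (1 / reach 1 (x - z2) ^ 3))" for x
  have s_le: "\<bar>s n x\<bar> \<le> \<bar>\<psi> x\<bar> * (3 * d * (1 / reach (R n) (x - z1) ^ 3 + 1 / reach (R n) (x - z2) ^ 3))" for n x
    unfolding s_def right_diff_distrib[symmetric] abs_mult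
    by (intro mult_left_mono mollifier_diff_le R) (auto simp: d_def norm_minus_commute)
  have rl: "1 / reach (R n) y ^ 3 \<le> 1 / t ^ 3" if "0 < t" "t \<le> reach (R n) y" for n y t
    using that by (intro divide_left_mono power_mono) auto
  have "(\<lambda>n. LINT x|lborel. s n x) \<longlonglongrightarrow> (LINT x::real^2|lborel. 0 :: real)"
  proof (rule integral_dominated_convergence)
    show "integrable lborel w"
      unfolding w_def by (intro integrable_mult_right Bochner_Integration.integrable_add integrable_weighted_psi) auto
    show "AE x in lborel. norm (s n x) \<le> w x" for n
    proof (intro AE_I2)
      fix x
      have "\<bar>s n x\<bar> \<le> \<bar>\<psi> x\<bar> * (3 * d * (1 / reach (R n) (x - z1) ^ 3 + 1 / reach (R n) (x - z2) ^ 3))" by (rule s_le)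
      also have "\<dots> \<le> \<bar>\<psi> x\<bar> * (3 * d * (1 / reach 1 (x - z1) ^ 3 + 1 / reach 1 (x - z2) ^ 3))"
        using d0 R by (intro mult_left_mono add_mono rl reach_pos reach_mono) auto
      also have "\<dots> = w x" by (simp add: w_def algebra_simps)
      finally show "norm (s n x) \<le> w x" by simp
    qed
    show "AE x in lborel. (\<lambda>n. s n x) \<longlonglongrightarrow> 0"
    proof (intro AE_I2)
      fix x
      have le: "norm (s n x) \<le> \<bar>\<psi> x\<bar> * (3 * d * (2 * inverse (real (Suc n)) ^ 3))" for n
      proof -
        have t: "real (Suc n) \<le> reach (R n) y" for y
          by (rule order_trans[OF R(4) reach_ge[OF less_imp_le[OF R(1)]]])
        have "\<bar>s n x\<bar> \<le> \<bar>\<psi> x\<bar> * (3 * d * (1 / reach (R n) (x - z1) ^ 3 + 1 / reach (R n) (x - z2) ^ 3))" by (rule s_le)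
        also have "\<dots> \<le> \<bar>\<psi> x\<bar> * (3 * d * (1 / real (Suc n) ^ 3 + 1 / real (Suc n) ^ 3))"
          using d0 by (intro mult_left_mono add_mono rl t) auto
        finally show ?thesis by (simp add: divide_inverse power_inverse)
      qed
      have "(\<lambda>n. \<bar>\<psi> x\<bar> * (3 * d * (2 * inverse (real (Suc n)) ^ 3))) \<longlonglongrightarrow> \<bar>\<psi> x\<bar> * (3 * d * (2 * 0 ^ 3))"
        by (intro tendsto_intros LIMSEQ_inverse_real_of_nat)
      then have "(\<lambda>n. \<bar>\<psi> x\<bar> * (3 * d * (2 * inverse (real (Suc n)) ^ 3))) \<longlonglongrightarrow> 0" by simp
      then show "(\<lambda>n. s n x) \<longlonglongrightarrow> 0"
        by (rule Lim_null_comparison[OF always_eventually[OF allI[OF le]]])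
    qed
  qed (simp_all add: s_def)
  moreover have "(LINT x|lborel. s n x) = mollified (R n) z1 - mollified (R n) z2" for n
    unfolding s_def mollified_def
    by (intro Bochner_Integration.integral_diff integrable_psi_mollifier R)
  ultimately show ?thesis by (simp add: R_def d_def)
qed

end

section \<open>Logarithmic modulus of continuity from the heat averages\<close>

context half_laplacian_pair begin

lemma M_nonneg: "0 \<le> M"
  using theta_bound[of 0] by (rule order_trans[OF abs_ge_zero])

lemma L_nonneg: "0 \<le> L"
proof -
  have "0 \<le> (LINT x|lborel. (\<theta> x)\<^sup>2)" by (rule Bochner_Integration.integral_nonneg) simp
  with theta_L2(2) show ?thesis by linarith
qed

lemma integrable_theta_mult:
  assumes "integrable lborel g"
  shows "integrable lborel (\<lambda>x. \<theta> x * g x)"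
proof (rule Bochner_Integration.integrable_bound)
  have [measurable]: "g \<in> borel_measurable borel" using borel_measurable_integrable[OF assms] by simp
  show "integrable lborel (\<lambda>x. M * norm (g x))" by (intro integrable_mult_right integrable_norm assms)
  show "AE x in lborel. norm (\<theta> x * g x) \<le> norm (M * norm (g x))"
    using theta_bound M_nonneg by (auto simp: abs_mult intro!: AE_I2 mult_right_mono)
  show "(\<lambda>x. \<theta> x * g x) \<in> borel_measurable lborel" by measurable
qed

text \<open>The first bound uses the supremum of \<theta>. The second uses only its square integral:
  2 \<sigma> |\<theta>| g \<le> \<theta>^2 + \<sigma>^2 g^2, and \<sigma>^2 g \<le> 3 by
  \<open>heat_majorant_le\<close>; it gains the factor 1 / \<sigma> that makes large widths
  integrable.\<close>

lemma integral_abs_theta_heat_majorant_le: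
  assumes \<sigma>: "\<sigma> > 0"
  shows "(LINT x|lborel. \<bar>\<theta> x\<bar> * heat_majorant (\<sigma>\<^sup>2) (x - z)) \<le> 12 * pi\<^sup>2 * M"
    and "(LINT x|lborel. \<bar>\<theta> x\<bar> * heat_majorant (\<sigma>\<^sup>2) (x - z)) \<le> (L + 36 * pi\<^sup>2) / (2 * \<sigma>)"
    and "integrable lborel (\<lambda>x. \<bar>\<theta> x\<bar> * heat_majorant (\<sigma>\<^sup>2) (x - z))"
proof -
  have s2: "\<sigma>\<^sup>2 > 0" using \<sigma> by simp
  have i: "integrable lborel (\<lambda>x. heat_majorant (\<sigma>\<^sup>2) (x - z))"
    using integrable_heat_majorant[OF s2] by (subst integrable_lborel_translate) auto
  have I: "(LINT x|lborel. heat_majorant (\<sigma>\<^sup>2) (x - z)) \<le> 12 * pi\<^sup>2"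
    using integral_heat_majorant_le[OF s2] by (subst integral_lborel_translate) auto
  have n: "0 \<le> heat_majorant (\<sigma>\<^sup>2) y" for y by (rule heat_majorant_nonneg[OF s2])
  show int: "integrable lborel (\<lambda>x. \<bar>\<theta> x\<bar> * heat_majorant (\<sigma>\<^sup>2) (x - z))"
    using integrable_abs[OF integrable_theta_mult[OF i]] n by (simp add: abs_mult)
  have "(LINT x|lborel. \<bar>\<theta> x\<bar> * heat_majorant (\<sigma>\<^sup>2) (x - z)) \<le> (LINT x|lborel. M * heat_majorant (\<sigma>\<^sup>2) (x - z))"
    by (intro integral_mono int integrable_mult_right i mult_right_mono theta_bound n)
  also have "\<dots> \<le> M * (12 * pi\<^sup>2)"
    unfolding integral_mult_right_zero by (intro mult_left_mono I M_nonneg)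
  finally show "(LINT x|lborel. \<bar>\<theta> x\<bar> * heat_majorant (\<sigma>\<^sup>2) (x - z)) \<le> 12 * pi\<^sup>2 * M"
    by (simp only: mult.commute[of M])
  have "(LINT x|lborel. \<bar>\<theta> x\<bar> * heat_majorant (\<sigma>\<^sup>2) (x - z)) \<le> (LINT x|lborel. 1 / (2 * \<sigma>) * (\<theta> x)\<^sup>2 + 3 / (2 * \<sigma>) * heat_majorant (\<sigma>\<^sup>2) (x - z))"
  proof (intro integral_mono int integrable_mult_right i Bochner_Integration.integrable_add theta_L2)
    fix x
    define g where "g = heat_majorant (\<sigma>\<^sup>2) (x - z)"
    have "0 \<le> (\<bar>\<theta> x\<bar> - \<sigma> * g)\<^sup>2" by simp
    then have "2 * \<sigma> * (\<bar>\<theta> x\<bar> * g) \<le> (\<theta> x)\<^sup>2 + \<sigma>\<^sup>2 * g * g" by (simp add: power2_eq_square algebra_simps)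
    moreover have "\<sigma>\<^sup>2 * g * g \<le> 3 * g"
    proof -
      have "g \<le> 3 / \<sigma>\<^sup>2" unfolding g_def by (rule heat_majorant_le[OF s2])
      then have "\<sigma>\<^sup>2 * g \<le> 3" using s2 by (simp add: field_simps)
      then show ?thesis using n by (intro mult_right_mono) (auto simp: g_def)
    qed
    ultimately have "2 * \<sigma> * (\<bar>\<theta> x\<bar> * g) \<le> (\<theta> x)\<^sup>2 + 3 * g" by linarith
    then show "\<bar>\<theta> x\<bar> * heat_majorant (\<sigma>\<^sup>2) (x - z) \<le> 1 / (2 * \<sigma>) * (\<theta> x)\<^sup>2 + 3 / (2 * \<sigma>) * heat_majorant (\<sigma>\<^sup>2) (x - z)"
      unfolding g_def[symmetric] using \<sigma> by (simp add: field_simps)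
  qed
  also have "\<dots> = 1 / (2 * \<sigma>) * (LINT x|lborel. (\<theta> x)\<^sup>2) + 3 / (2 * \<sigma>) * (LINT x|lborel. heat_majorant (\<sigma>\<^sup>2) (x - z))"
    by (simp only: Bochner_Integration.integral_add[OF integrable_mult_right[OF theta_L2(1)] integrable_mult_right[OF i]] integral_mult_right_zero)
  also have "\<dots> \<le> 1 / (2 * \<sigma>) * L + 3 / (2 * \<sigma>) * (12 * pi\<^sup>2)"
    using \<sigma> by (intro add_mono mult_left_mono theta_L2 I) auto
  also have "\<dots> = (L + 36 * pi\<^sup>2) / (2 * \<sigma>)" using \<sigma> by (simp add: field_simps)
  finally show "(LINT x|lborel. \<bar>\<theta> x\<bar> * heat_majorant (\<sigma>\<^sup>2) (x - z)) \<le> (L + 36 * pi\<^sup>2) / (2 * \<sigma>)" .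
qed

lemma avg_diff_le:
  assumes \<sigma>: "\<sigma> > 0"
  shows "\<bar>avg \<sigma> z1 - avg \<sigma> z2\<bar> \<le> 2 * M"
    and "norm (z1 - z2) \<le> D \<Longrightarrow> D \<le> \<sigma> \<Longrightarrow> \<bar>avg \<sigma> z1 - avg \<sigma> z2\<bar> \<le> 24 * pi\<^sup>2 * M * D * (1 / \<sigma>)"
    and "norm (z1 - z2) \<le> D \<Longrightarrow> D \<le> \<sigma> \<Longrightarrow> \<bar>avg \<sigma> z1 - avg \<sigma> z2\<bar> \<le> (L + 36 * pi\<^sup>2) * D * (1 / \<sigma>\<^sup>2)"
proof -
  have s2: "\<sigma>\<^sup>2 > 0" using \<sigma> by simp
  have i: "integrable lborel (\<lambda>x. heat_kernel (\<sigma>\<^sup>2) (x - z))" for z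
    using integrable_heat_kernel[OF s2] by (subst integrable_lborel_translate) auto
  have I: "(LINT x|lborel. heat_kernel (\<sigma>\<^sup>2) (x - z)) = 1" for z
    using integrable_heat_kernel[OF s2] by (subst integral_lborel_translate) auto
  have ti: "integrable lborel (\<lambda>x. \<theta> x * heat_kernel (\<sigma>\<^sup>2) (x - z))" for z
    by (rule integrable_theta_mult[OF i])
  have "\<bar>avg \<sigma> z\<bar> \<le> M" for z
  proof -
    have "\<bar>avg \<sigma> z\<bar> \<le> (LINT x|lborel. \<bar>\<theta> x * heat_kernel (\<sigma>\<^sup>2) (x - z)\<bar>)" unfolding avg_def by (rule integral_abs_bound)
    also have "\<dots> \<le> (LINT x|lborel. M * heat_kernel (\<sigma>\<^sup>2) (x - z))"
      using heat_kernel_pos[OF s2] theta_bound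
      by (intro integral_mono integrable_abs ti integrable_mult_right i) (auto simp: abs_mult less_imp_le intro!: mult_right_mono)
    also have "\<dots> = M" unfolding integral_mult_right_zero I by simp
    finally show ?thesis .
  qed
  from this[of z1] this[of z2] show "\<bar>avg \<sigma> z1 - avg \<sigma> z2\<bar> \<le> 2 * M" by linarith
  have key: "\<bar>avg \<sigma> z1 - avg \<sigma> z2\<bar> \<le> D / \<sigma> * ((LINT x|lborel. \<bar>\<theta> x\<bar> * heat_majorant (\<sigma>\<^sup>2) (x - z1)) + (LINT x|lborel. \<bar>\<theta> x\<bar> * heat_majorant (\<sigma>\<^sup>2) (x - z2)))"
    if D: "norm (z1 - z2) \<le> D" "D \<le> \<sigma>"
  proof -
    have "avg \<sigma> z1 - avg \<sigma> z2 = (LINT x|lborel. \<theta> x * heat_kernel (\<sigma>\<^sup>2) (x - z1) - \<theta> x * heat_kernel (\<sigma>\<^sup>2) (x - z2))"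
      unfolding avg_def by (rule Bochner_Integration.integral_diff[OF ti ti, symmetric])
    then have "\<bar>avg \<sigma> z1 - avg \<sigma> z2\<bar> \<le> (LINT x|lborel. \<bar>\<theta> x * heat_kernel (\<sigma>\<^sup>2) (x - z1) - \<theta> x * heat_kernel (\<sigma>\<^sup>2) (x - z2)\<bar>)"
      by (simp only: integral_abs_bound)
    also have "\<dots> \<le> (LINT x|lborel. D / \<sigma> * (\<bar>\<theta> x\<bar> * heat_majorant (\<sigma>\<^sup>2) (x - z1) + \<bar>\<theta> x\<bar> * heat_majorant (\<sigma>\<^sup>2) (x - z2)))"
    proof (intro integral_mono integrable_abs Bochner_Integration.integrable_diff ti integrable_mult_right
          Bochner_Integration.integrable_add integral_abs_theta_heat_majorant_le(3) \<sigma>)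
      fix x
      have "\<bar>heat_kernel (\<sigma>\<^sup>2) (x - z1) - heat_kernel (\<sigma>\<^sup>2) (x - z2)\<bar> \<le> D / sqrt (\<sigma>\<^sup>2) * (heat_majorant (\<sigma>\<^sup>2) (x - z1) + heat_majorant (\<sigma>\<^sup>2) (x - z2))"
        using D \<sigma> by (intro heat_kernel_diff_le_heat_majorant s2) (auto simp: norm_minus_commute)
      then have "\<bar>\<theta> x\<bar> * \<bar>heat_kernel (\<sigma>\<^sup>2) (x - z1) - heat_kernel (\<sigma>\<^sup>2) (x - z2)\<bar> \<le> \<bar>\<theta> x\<bar> * (D / \<sigma> * (heat_majorant (\<sigma>\<^sup>2) (x - z1) + heat_majorant (\<sigma>\<^sup>2) (x - z2)))"
        using \<sigma> by (intro mult_left_mono) auto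
      then show "\<bar>\<theta> x * heat_kernel (\<sigma>\<^sup>2) (x - z1) - \<theta> x * heat_kernel (\<sigma>\<^sup>2) (x - z2)\<bar>
          \<le> D / \<sigma> * (\<bar>\<theta> x\<bar> * heat_majorant (\<sigma>\<^sup>2) (x - z1) + \<bar>\<theta> x\<bar> * heat_majorant (\<sigma>\<^sup>2) (x - z2))"
        unfolding right_diff_distrib[symmetric] abs_mult by (simp add: algebra_simps)
    qed
    also have "\<dots> = D / \<sigma> * ((LINT x|lborel. \<bar>\<theta> x\<bar> * heat_majorant (\<sigma>\<^sup>2) (x - z1)) + (LINT x|lborel. \<bar>\<theta> x\<bar> * heat_majorant (\<sigma>\<^sup>2) (x - z2)))"
      unfolding integral_mult_right_zero
      by (subst Bochner_Integration.integral_add) (auto intro!: integral_abs_theta_heat_majorant_le(3) \<sigma>)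
    finally show ?thesis .
  qed
  {
    assume D: "norm (z1 - z2) \<le> D" "D \<le> \<sigma>"
    then have D0: "0 \<le> D" using norm_ge_zero order_trans by blast
    have "\<bar>avg \<sigma> z1 - avg \<sigma> z2\<bar> \<le> D / \<sigma> * (12 * pi\<^sup>2 * M + 12 * pi\<^sup>2 * M)"
      using \<sigma> D0 by (intro order_trans[OF key[OF D]] mult_left_mono add_mono integral_abs_theta_heat_majorant_le(1)) auto
    then show "\<bar>avg \<sigma> z1 - avg \<sigma> z2\<bar> \<le> 24 * pi\<^sup>2 * M * D * (1 / \<sigma>)" by (simp add: algebra_simps)
    have "\<bar>avg \<sigma> z1 - avg \<sigma> z2\<bar> \<le> D / \<sigma> * ((L + 36 * pi\<^sup>2) / (2 * \<sigma>) + (L + 36 * pi\<^sup>2) / (2 * \<sigma>))"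
      using \<sigma> D0 by (intro order_trans[OF key[OF D]] mult_left_mono add_mono integral_abs_theta_heat_majorant_le(2)) auto
    also have "\<dots> = (L + 36 * pi\<^sup>2) * D * (1 / \<sigma>\<^sup>2)" using \<sigma> by (simp add: field_simps power2_eq_square)
    finally show "\<bar>avg \<sigma> z1 - avg \<sigma> z2\<bar> \<le> (L + 36 * pi\<^sup>2) * D * (1 / \<sigma>\<^sup>2)" .
  }
qed

lemma integral_avg_diff_le:
  assumes e: "0 < e" "e \<le> R" and D: "norm (z1 - z2) \<le> D" "0 < D"
  shows "\<bar>LINT \<sigma>|lborel. indicator {e..R} \<sigma> * avg \<sigma> z1 - indicator {e..R} \<sigma> * avg \<sigma> z2\<bar>
    \<le> (2 * M + 24 * pi\<^sup>2 * M + L + 36 * pi\<^sup>2) * (D * (1 + \<bar>ln D\<bar>))"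
proof -
  \<comment> \<open>The widths split at D and at m: the three bounds of \<open>avg_diff_le\<close>
    contribute multiples of D, of D ln (m / D) and of D / m. Taking m at least 1 makes the last term
    at most a multiple of D.\<close>
  define m where "m = max 1 D"
  \<comment> \<open>R may be smaller than m; enlarging it keeps the third interval nonempty and only
    adds nonnegative mass.\<close>
  define R' where "R' = max R m"
  have m: "1 \<le> m" "D \<le> m" "m \<le> R'" "R \<le> R'" "0 < m" using D by (auto simp: m_def R'_def)
  define K where "K = L + 36 * pi\<^sup>2"
  have K: "0 \<le> K" using L_nonneg by (simp add: K_def)
  define W where "W \<sigma> = indicator {e..R} \<sigma> * avg \<sigma> z1 - indicator {e..R} \<sigma> * avg \<sigma> z2" for \<sigma>
  define b1 where "b1 \<sigma> = indicator {0..D} \<sigma> *\<^sub>R (2 * M)" for \<sigma> :: real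
  define b2 where "b2 \<sigma> = indicator {D..m} \<sigma> *\<^sub>R (24 * pi\<^sup>2 * M * D * (1 / \<sigma>))" for \<sigma> :: real
  define b3 where "b3 \<sigma> = indicator {m..R'} \<sigma> *\<^sub>R (K * D * (1 / \<sigma>\<^sup>2))" for \<sigma> :: real
  have "has_bochner_integral lborel b1 ((2 * M) * D - (2 * M) * 0)"
    unfolding b1_def using D(2)
    by (intro has_bochner_integral_FTC_Icc) (auto intro!: derivative_eq_intros continuous_intros simp: has_real_derivative_iff_has_vector_derivative[symmetric])
  then have B1: "has_bochner_integral lborel b1 (2 * M * D)" by simp
  have "has_bochner_integral lborel b2 (24 * pi\<^sup>2 * M * D * ln m - 24 * pi\<^sup>2 * M * D * ln D)"
    unfolding b2_def
  proof (rule has_bochner_integral_FTC_Icc[OF m(2)])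
    fix x assume "D \<le> x" "x \<le> m"
    then show "((\<lambda>x. 24 * pi\<^sup>2 * M * D * ln x) has_vector_derivative 24 * pi\<^sup>2 * M * D * (1 / x)) (at x within {D..m})"
      using D(2) unfolding has_real_derivative_iff_has_vector_derivative[symmetric]
      by (auto intro!: derivative_eq_intros)
  qed (use D(2) in \<open>auto intro!: continuous_intros\<close>)
  then have B2: "has_bochner_integral lborel b2 (24 * pi\<^sup>2 * M * D * (ln m - ln D))" by (simp add: algebra_simps)
  have "has_bochner_integral lborel b3 (- (K * D) / R' - - (K * D) / m)"
    unfolding b3_def
  proof (rule has_bochner_integral_FTC_Icc[OF m(3)])
    fix x assume "m \<le> x" "x \<le> R'"
    then show "((\<lambda>x. - (K * D) / x) has_vector_derivative K * D * (1 / x\<^sup>2)) (at x within {m..R'})"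
      using m unfolding has_real_derivative_iff_has_vector_derivative[symmetric]
      by (auto intro!: derivative_eq_intros simp: power2_eq_square)
  qed (use m in \<open>auto intro!: continuous_intros\<close>)
  then have B3: "has_bochner_integral lborel b3 (K * D / m - K * D / R')" by (simp add: algebra_simps)
  have nn: "0 \<le> b1 \<sigma>" "0 \<le> b2 \<sigma>" "0 \<le> b3 \<sigma>" for \<sigma>
    using M_nonneg K D(2) m by (auto simp: b1_def b2_def b3_def indicator_def)
  have le: "\<bar>W \<sigma>\<bar> \<le> b1 \<sigma> + b2 \<sigma> + b3 \<sigma>" for \<sigma>
  proof (cases "\<sigma> \<in> {e..R}")
    case True
    then have s: "\<sigma> > 0" "\<sigma> \<le> R'" using e m by auto
    have W: "W \<sigma> = avg \<sigma> z1 - avg \<sigma> z2" using True by (simp add: W_def)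
    consider "\<sigma> \<le> D" | "D \<le> \<sigma>" "\<sigma> \<le> m" | "m \<le> \<sigma>" by linarith
    then show ?thesis
    proof cases
      case 1
      then have "\<bar>W \<sigma>\<bar> \<le> b1 \<sigma>" using avg_diff_le(1)[OF s(1), of z1 z2] s by (simp add: W b1_def)
      then show ?thesis using nn[of \<sigma>] by linarith
    next
      case 2
      then have "\<bar>W \<sigma>\<bar> \<le> b2 \<sigma>" using avg_diff_le(2)[OF s(1) D(1)] s by (simp add: W b2_def)
      then show ?thesis using nn[of \<sigma>] by linarith
    next
      case 3
      then have "\<bar>W \<sigma>\<bar> \<le> b3 \<sigma>" using avg_diff_le(3)[OF s(1) D(1)] s m by (simp add: W b3_def K_def)
      then show ?thesis using nn[of \<sigma>] by linarith
    qed
  qed (use nn[of \<sigma>] in \<open>simp add: W_def\<close>)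
  have "\<bar>LINT \<sigma>|lborel. W \<sigma>\<bar> \<le> (LINT \<sigma>|lborel. \<bar>W \<sigma>\<bar>)" by (rule integral_abs_bound)
  also have "\<dots> \<le> (LINT \<sigma>|lborel. b1 \<sigma> + b2 \<sigma> + b3 \<sigma>)"
    using B1 B2 B3 unfolding W_def[symmetric]
    by (intro integral_mono integrable_abs Bochner_Integration.integrable_add le)
      (auto simp: W_def[abs_def] has_bochner_integral_iff intro!: integrable_avg e)
  also have "\<dots> = 2 * M * D + 24 * pi\<^sup>2 * M * D * (ln m - ln D) + (K * D / m - K * D / R')"
    by (intro has_bochner_integral_integral_eq has_bochner_integral_add B1 B2 B3)
  also have "\<dots> \<le> 2 * M * (D * (1 + \<bar>ln D\<bar>)) + 24 * pi\<^sup>2 * M * (D * (1 + \<bar>ln D\<bar>)) + K * (D * (1 + \<bar>ln D\<bar>))"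
  proof -
    have l: "ln m - ln D \<le> 1 + \<bar>ln D\<bar>" using D(2) by (cases "D \<le> 1") (auto simp: m_def max_def)
    have "24 * pi\<^sup>2 * M * (D * (ln m - ln D)) \<le> 24 * pi\<^sup>2 * M * (D * (1 + \<bar>ln D\<bar>))"
      using M_nonneg D(2) by (intro mult_left_mono l) auto
    moreover have "2 * M * (D * 1) \<le> 2 * M * (D * (1 + \<bar>ln D\<bar>))"
      using M_nonneg D(2) by (intro mult_left_mono) auto
    moreover have "K * D / m - K * D / R' \<le> K * (D * (1 + \<bar>ln D\<bar>))"
    proof -
      have "0 \<le> K * D / R'" using K D(2) m by auto
      moreover have "K * D / m \<le> K * D / 1" using K D(2) m by (intro divide_left_mono) auto
      moreover have "K * (D * 1) \<le> K * (D * (1 + \<bar>ln D\<bar>))" using K D(2) by (intro mult_left_mono) auto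
      ultimately show ?thesis by simp
    qed
    ultimately show ?thesis unfolding mult.assoc[of _ D] by linarith
  qed
  also have "\<dots> = (2 * M + 24 * pi\<^sup>2 * M + K) * (D * (1 + \<bar>ln D\<bar>))" by (simp only: distrib_right)
  finally show ?thesis unfolding W_def K_def by (simp add: add.assoc)
qed

text \<open>Small widths recover \<psi> itself and large widths drop out of the difference, so the
  bound of \<open>integral_avg_diff_le\<close>, uniform in both cutoffs, passes to the limit. An
  upper bound D in place of the distance itself also covers coinciding points.\<close>

theorem log_lipschitz:
  assumes D: "norm (z1 - z2) \<le> D" "0 < D"
  shows "\<bar>\<psi> z1 - \<psi> z2\<bar> \<le> 2 * (2 * M + 24 * pi\<^sup>2 * M + L + 36 * pi\<^sup>2) * (D * (1 + \<bar>ln D\<bar>))"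
proof -
  define B where "B = (2 * M + 24 * pi\<^sup>2 * M + L + 36 * pi\<^sup>2) * (D * (1 + \<bar>ln D\<bar>))"
  define e where "e n = inverse (real (Suc n))" for n
  define R where "R n = norm (z1 - z2) + real (Suc n)" for n
  have e: "0 < e n" "e n \<le> R n" for n
  proof -
    show "0 < e n" by (simp add: e_def)
    have "e n \<le> 1" by (simp add: e_def field_simps)
    also have "1 \<le> R n" by (simp add: R_def)
    finally show "e n \<le> R n" .
  qed
  have "0 \<le> B" using integral_avg_diff_le[OF e[of 0] D] unfolding B_def by linarith
  define S where "S n = (mollified (e n) z1 - mollified (e n) z2) - (mollified (R n) z1 - mollified (R n) z2)" for n
  have lim: "S \<longlonglongrightarrow> (\<psi> z1 - \<psi> z2) - 0"
    unfolding S_def e_def R_def by (intro tendsto_diff mollified_tendsto mollified_diff_tendsto)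
  have "\<bar>S n\<bar> \<le> 2 * B" for n
  proof -
    have "(LINT \<sigma>|lborel. indicator {e n..R n} \<sigma> * avg \<sigma> z1 - indicator {e n..R n} \<sigma> * avg \<sigma> z2) = - (sqrt pi / 2 * S n)"
      unfolding Bochner_Integration.integral_diff[OF integrable_avg[OF e] integrable_avg[OF e]] integral_avg[OF e] S_def
      by (simp add: algebra_simps)
    then have "sqrt pi / 2 * \<bar>S n\<bar> \<le> B"
      using integral_avg_diff_le[OF e[of n] D] unfolding B_def by (simp add: abs_mult)
    \<comment> \<open>Here sqrt pi \<ge> 1 is used; dividing by sqrt pi / 2 therefore costs at most
      the factor 2 of the statement.\<close>
    moreover have "1 / 2 * \<bar>S n\<bar> \<le> sqrt pi / 2 * \<bar>S n\<bar>"
      using pi_ge_two by (intro mult_right_mono) auto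
    ultimately show ?thesis by linarith
  qed
  then have "\<bar>\<psi> z1 - \<psi> z2\<bar> \<le> 2 * B"
    using tendsto_rabs[OF lim] by (intro tendsto_upperbound[of "\<lambda>n. \<bar>S n\<bar>"]) auto
  then show ?thesis by (simp only: B_def mult.assoc)
qed

end

section \<open>Osgood's criterion\<close>

lemma at_within_Ioo_eq_at_left: "(a::real) < b \<Longrightarrow> at b within {a<..<b} = at_left b"
  by (rule at_within_nhd[of _ "{a<..}"]) auto

lemma lipschitz_tendsto_at_left:
  fixes f :: "real \<Rightarrow> real"
  assumes ab: "a < b" and D: "\<And>t. t \<in> {a<..<b} \<Longrightarrow> (f has_real_derivative f' t) (at t)"
    and B: "\<And>t. t \<in> {a<..<b} \<Longrightarrow> \<bar>f' t\<bar> \<le> B"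
  shows "\<exists>l. (f \<longlongrightarrow> l) (at_left b)"
proof -
  have "0 \<le> B" using B[of "(a + b) / 2"] ab by (auto intro: order_trans[OF abs_ge_zero])
  have "B-lipschitz_on {a<..<b} f"
  proof (rule lipschitz_onI)
    fix x y assume "x \<in> {a<..<b}" "y \<in> {a<..<b}"
    then have "norm (f x - f y) \<le> B * norm (x - y)"
      by (intro field_differentiable_bound[where S = "{a<..<b}" and f' = f'] DERIV_subset[OF D]) (auto intro: B)
    then show "dist (f x) (f y) \<le> B * dist x y" by (simp add: dist_norm)
  qed (rule \<open>0 \<le> B\<close>)
  then have "uniformly_continuous_on {a<..<b} f" by (rule lipschitz_on_uniformly_continuous)
  moreover have "b \<in> closure {a<..<b}" using ab by simp
  ultimately obtain l where "(f \<longlongrightarrow> l) (at b within {a<..<b})"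
    by (rule uniformly_continuous_on_extension_at_closure)
  then show ?thesis using ab by (auto simp: at_within_Ioo_eq_at_left)
qed

text \<open>The logarithm f of \<gamma> satisfies |f'| \<le> C (1 + |f|), a linear growth condition.
  Hence f stays bounded on the finite interval, then f' is bounded, so f converges and \<gamma>
  converges to an exponential.\<close>

lemma osgood_positive_limit:
  fixes \<gamma> :: "real \<Rightarrow> real"
  assumes ab: "a < b" and D: "\<And>t. t \<in> {a<..<b} \<Longrightarrow> (\<gamma> has_real_derivative \<gamma>' t) (at t)"
    and pos: "\<And>t. t \<in> {a<..<b} \<Longrightarrow> 0 < \<gamma> t"
    and le: "\<And>t. t \<in> {a<..<b} \<Longrightarrow> \<bar>\<gamma>' t\<bar> \<le> C * (\<gamma> t * (1 + \<bar>ln (\<gamma> t)\<bar>))"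
  shows "\<exists>l>0. (\<gamma> \<longlongrightarrow> l) (at_left b)"
proof -
  define c where "c = (a + b) / 2"
  have c: "c \<in> {a<..<b}" using ab by (simp add: c_def)
  define f where "f t = ln (\<gamma> t)" for t
  define f' where "f' t = \<gamma>' t / \<gamma> t" for t
  have f: "(f has_real_derivative f' t) (at t)" if "t \<in> {a<..<b}" for t
    unfolding f_def f'_def using D[OF that] pos[OF that] by (auto intro!: derivative_eq_intros)
  have f'_le: "\<bar>f' t\<bar> \<le> C * (1 + \<bar>f t\<bar>)" if "t \<in> {a<..<b}" for t
    using le[OF that] pos[OF that] unfolding f'_def f_def by (simp add: abs_divide pos_divide_le_eq mult_ac)
  have C: "0 \<le> C"
  proof -
    have "0 \<le> C * (1 + \<bar>f c\<bar>)" using f'_le[OF c] abs_ge_zero[of "f' c"] by linarith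
    then show ?thesis using abs_ge_zero[of "f c"] by (simp add: zero_le_mult_iff)
  qed
  \<comment> \<open>A differentiable substitute for ln (1 + |f|): its derivative is bounded by 4 C,
    since |f| + f^2 \<le> 2 (1 + f^2).\<close>
  define h where "h t = ln (1 + (f t)\<^sup>2)" for t
  have h: "(h has_real_derivative 2 * f t * f' t / (1 + (f t)\<^sup>2)) (at t)" if "t \<in> {a<..<b}" for t
    unfolding h_def using f[OF that] one_plus_square_pos[of "f t"]
    by (auto intro!: derivative_eq_intros)
  have h': "\<bar>2 * f t * f' t / (1 + (f t)\<^sup>2)\<bar> \<le> 4 * C" if "t \<in> {a<..<b}" for t
  proof -
    have "\<bar>f t\<bar> * \<bar>f' t\<bar> \<le> \<bar>f t\<bar> * (C * (1 + \<bar>f t\<bar>))" by (intro mult_left_mono f'_le that) auto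
    also have "\<dots> = C * (\<bar>f t\<bar> + (f t)\<^sup>2)" by (simp add: algebra_simps power2_eq_square abs_mult_self_eq)
    also have "\<dots> \<le> C * (2 * (1 + (f t)\<^sup>2))"
    proof (intro mult_left_mono C)
      have "0 \<le> (\<bar>f t\<bar> - 1)\<^sup>2" by simp
      also have "\<dots> = (f t)\<^sup>2 - 2 * \<bar>f t\<bar> + 1" by (simp add: power2_diff)
      finally show "\<bar>f t\<bar> + (f t)\<^sup>2 \<le> 2 * (1 + (f t)\<^sup>2)"
        using zero_le_power2[of "f t"] by (smt (verit))
    qed
    finally have "2 * \<bar>f t\<bar> * \<bar>f' t\<bar> \<le> 4 * C * (1 + (f t)\<^sup>2)" by (simp add: algebra_simps)
    then have "2 * \<bar>f t\<bar> * \<bar>f' t\<bar> / (1 + (f t)\<^sup>2) \<le> 4 * C"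
      using one_plus_square_pos[of "f t"] by (simp add: pos_divide_le_eq)
    then show ?thesis using one_plus_square_pos[of "f t"] by (simp add: abs_mult abs_divide)
  qed
  define B where "B = exp (h c + 4 * C * (b - a))"
  have fB: "\<bar>f t\<bar> \<le> B" if t: "t \<in> {a<..<b}" for t
  proof -
    have "norm (h t - h c) \<le> 4 * C * norm (t - c)"
      using h' c t
      by (intro field_differentiable_bound[where S = "{a<..<b}" and f' = "\<lambda>t. 2 * f t * f' t / (1 + (f t)\<^sup>2)"] DERIV_subset[OF h]) auto
    also have "\<dots> \<le> 4 * C * (b - a)" using C t c by (intro mult_left_mono) auto
    finally have "h t \<le> h c + 4 * C * (b - a)" by simp
    then have "exp (h t) \<le> B" by (simp add: B_def)
    then have "1 + (f t)\<^sup>2 \<le> B" using one_plus_square_pos[of "f t"] by (simp add: h_def)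
    moreover have "0 \<le> (\<bar>f t\<bar> - 1)\<^sup>2" by simp
    then have "2 * \<bar>f t\<bar> \<le> 1 + (f t)\<^sup>2" by (simp add: power2_diff)
    ultimately show ?thesis by linarith
  qed
  have "\<exists>l. (f \<longlongrightarrow> l) (at_left b)"
  proof (rule lipschitz_tendsto_at_left[OF ab f])
    fix t assume t: "t \<in> {a<..<b}"
    show "\<bar>f' t\<bar> \<le> C * (1 + B)"
      using f'_le[OF t] mult_left_mono[OF add_left_mono[OF fB[OF t], of 1] C] by linarith
  qed
  then obtain l where "(f \<longlongrightarrow> l) (at_left b)" by blast
  then have "((\<lambda>t. exp (f t)) \<longlongrightarrow> exp l) (at_left b)" by (intro tendsto_intros)
  moreover have "\<forall>\<^sub>F t in at_left b. exp (f t) = \<gamma> t"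
    using eventually_at_left_real[OF ab] by eventually_elim (use pos in \<open>auto simp: f_def\<close>)
  ultimately have "(\<gamma> \<longlongrightarrow> exp l) (at_left b)" by (rule Lim_transform_eventually)
  then show ?thesis by (intro exI[of _ "exp l"]) simp
qed

text \<open>At a first zero s after \<open>t0\<close> the function would be positive on the whole
  interval before s, so \<open>loc\<close> would give a positive left limit there, against
  continuity. Hence \<open>loc\<close> may be applied with endpoint \<open>T\<close>.\<close>

lemma positive_limit_continuation:
  fixes \<gamma> :: "real \<Rightarrow> real"
  assumes cont: "continuous_on {0..<T} \<gamma>" and t0: "t0 \<in> {0..<T}" "0 < \<gamma> t0"
    and loc: "\<And>t1. t0 < t1 \<Longrightarrow> t1 \<le> T \<Longrightarrow> (\<forall>t\<in>{t0<..<t1}. 0 < \<gamma> t) \<Longrightarrow> \<exists>l>0. (\<gamma> \<longlongrightarrow> l) (at_left t1)"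
  shows "\<exists>l>0. (\<gamma> \<longlongrightarrow> l) (at_left T)"
proof -
  have "0 < \<gamma> z" if z: "t0 < z" "z < T" for z
  proof (rule ccontr)
    assume "\<not> 0 < \<gamma> z"
    define Z where "Z = {t \<in> {t0..z}. \<gamma> t \<le> 0}"
    have cz: "continuous_on {t0..z} \<gamma>" using t0 z by (intro continuous_on_subset[OF cont]) auto
    have "compact Z"
    proof -
      have "closed Z" unfolding Z_def by (intro continuous_on_closed_Collect_le cz) auto
      moreover have "bounded Z" by (rule bounded_subset[of "{t0..z}"]) (auto simp: Z_def)
      ultimately show ?thesis by (simp add: compact_eq_bounded_closed)
    qed
    moreover have "z \<in> Z" using \<open>\<not> 0 < \<gamma> z\<close> z by (simp add: Z_def)
    ultimately obtain s where s: "s \<in> Z" "\<And>t. t \<in> Z \<Longrightarrow> s \<le> t" using compact_attains_inf[of Z] by blast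
    have s0: "t0 < s" using s(1) t0(2) by (cases "s = t0") (auto simp: Z_def)
    have "\<forall>t\<in>{t0<..<s}. 0 < \<gamma> t"
    proof
      fix t assume t: "t \<in> {t0<..<s}"
      then have "t \<notin> Z" using s(2)[of t] by auto
      with t s(1) show "0 < \<gamma> t" by (auto simp: Z_def)
    qed
    moreover have "s \<le> T" using s(1) z by (auto simp: Z_def)
    ultimately obtain l where l: "l > 0" "(\<gamma> \<longlongrightarrow> l) (at_left s)" using loc[OF s0] by blast
    have "(\<gamma> \<longlongrightarrow> \<gamma> s) (at s within {t0..z})" using cz s(1) by (auto simp: continuous_on_def Z_def)
    then have "(\<gamma> \<longlongrightarrow> \<gamma> s) (at s within {t0<..<s})"
      by (rule tendsto_within_subset) (use s(1) in \<open>auto simp: Z_def\<close>)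
    then have "(\<gamma> \<longlongrightarrow> \<gamma> s) (at_left s)" using s0 by (simp add: at_within_Ioo_eq_at_left)
    with l(2) have "l = \<gamma> s" by (intro tendsto_unique[OF _ l(2)]) auto
    with l(1) s(1) show False by (auto simp: Z_def)
  qed
  then show ?thesis using loc[of T] t0 by auto
qed

section \<open>Transport along hyperbolas\<close>

text \<open>The coordinates a and b stand for the two factors of \<rho>, so the hyperbolas are a b =
  const and the axes are the separatrices. \<open>H\<close> is \<theta> in these coordinates,
  \<open>A'\<close> and \<open>B'\<close> are the material derivatives of a and b. The latter are
  continuous up to the axes, whereas \<open>H\<close> is examined only in the open sector;
  \<open>nondeg\<close> provides regular hyperbolas arbitrarily close to the center.\<close>

locale hyperbolic_transport =
  fixes H :: "real \<times> real \<times> real \<Rightarrow> real" and Ha Hb Ht A' B' :: "real \<Rightarrow> real \<Rightarrow> real"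
    and t \<rho>\<^sub>0 :: real and R :: "real \<Rightarrow> real \<Rightarrow> bool"
  assumes R_def: "R a b \<longleftrightarrow> 0 < a \<and> 0 < b \<and> a + b < \<rho>\<^sub>0"
    and deriv: "R a b \<Longrightarrow> (H has_derivative (\<lambda>v. fst v * Ha a b + fst (snd v) * Hb a b + snd (snd v) * Ht a b)) (at (a, b, t))"
    and invariant: "R a b \<Longrightarrow> 0 < l \<Longrightarrow> R (l * a) (b / l) \<Longrightarrow>
      \<forall>\<^sub>F v in nhds (a, b, t). H (l * fst v, fst (snd v) / l, snd (snd v)) = H v"
    and transport: "R a b \<Longrightarrow> Ht a b + Ha a b * A' a b + Hb a b * B' a b = 0"
    and nondeg: "0 < k \<Longrightarrow> \<exists>a b. R a b \<and> a * b < k \<and> (Ha a b \<noteq> 0 \<or> Hb a b \<noteq> 0)"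
    and contA: "continuous_on {p. 0 \<le> fst p \<and> 0 \<le> snd p \<and> fst p + snd p < \<rho>\<^sub>0} (\<lambda>p. A' (fst p) (snd p))"
    and contB: "continuous_on {p. 0 \<le> fst p \<and> 0 \<le> snd p \<and> fst p + snd p < \<rho>\<^sub>0} (\<lambda>p. B' (fst p) (snd p))"
begin

text \<open>Chain rule for the scaling of a and b. Because \<open>invariant\<close> holds on a
  neighbourhood in time as well, the time derivative is also preserved.\<close>

lemma scaled_derivatives:
  assumes R: "R a b" and l: "0 < l" and R': "R (l * a) (b / l)"
  shows "l * Ha (l * a) (b / l) = Ha a b" "Hb (l * a) (b / l) / l = Hb a b" "Ht (l * a) (b / l) = Ht a b"
proof -
  define S :: "real \<times> real \<times> real \<Rightarrow> real \<times> real \<times> real" where "S v = (l * fst v, fst (snd v) / l, snd (snd v))" for v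
  have "(S has_derivative S) (at (a, b, t))"
    unfolding S_def by (auto intro!: derivative_eq_intros simp: divide_inverse)
  moreover have "(H has_derivative (\<lambda>v. fst v * Ha (l * a) (b / l) + fst (snd v) * Hb (l * a) (b / l) + snd (snd v) * Ht (l * a) (b / l))) (at (S (a, b, t)))"
    using deriv[OF R'] by (simp add: S_def)
  ultimately have d: "((\<lambda>v. H (S v)) has_derivative (\<lambda>v. fst (S v) * Ha (l * a) (b / l) + fst (snd (S v)) * Hb (l * a) (b / l) + snd (snd (S v)) * Ht (l * a) (b / l))) (at (a, b, t))"
    by (rule has_derivative_compose)
  have ev: "\<forall>\<^sub>F v in nhds (a, b, t). H (S v) = H v"
    using invariant[OF R l R'] by (simp add: S_def)
  have ev': "\<forall>\<^sub>F v in at (a, b, t). H (S v) = H v"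
    using ev unfolding at_within_def by (rule filter_leD[rotated]) simp
  have "(H has_derivative (\<lambda>v. fst (S v) * Ha (l * a) (b / l) + fst (snd (S v)) * Hb (l * a) (b / l) + snd (snd (S v)) * Ht (l * a) (b / l))) (at (a, b, t))"
    by (rule has_derivative_transform_eventually[OF d ev' eventually_nhds_x_imp_x[OF ev]]) simp
  from has_derivative_unique[OF this deriv[OF R]]
  have eq: "fst (S v) * Ha (l * a) (b / l) + fst (snd (S v)) * Hb (l * a) (b / l) + snd (snd (S v)) * Ht (l * a) (b / l)
     = fst v * Ha a b + fst (snd v) * Hb a b + snd (snd v) * Ht a b" for v
    by metis
  show "l * Ha (l * a) (b / l) = Ha a b" "Hb (l * a) (b / l) / l = Hb a b" "Ht (l * a) (b / l) = Ht a b"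
    using eq[of "(1, 0, 0)"] eq[of "(0, 1, 0)"] eq[of "(0, 0, 1)"] by (simp_all add: S_def)
qed

text \<open>
  Along \<open>l \<mapsto> (l a, b / l)\<close> the invariance says that \<open>H\<close> is a function of \<open>a b\<close> at each fixed time.
\<close>

lemma radial_derivative:
  assumes R: "R a b"
  shows "a * Ha a b = b * Hb a b"
proof -
  define c where "c l = (l * a, b / l, t)" for l :: real
  have "(c has_derivative (\<lambda>s. (s * a, - (b * s), 0))) (at 1)"
    unfolding c_def by (auto intro!: derivative_eq_intros simp: fun_eq_iff)
  moreover have "(H has_derivative (\<lambda>v. fst v * Ha a b + fst (snd v) * Hb a b + snd (snd v) * Ht a b)) (at (c 1))"
    using deriv[OF R] by (simp add: c_def)
  ultimately have "((\<lambda>l. H (c l)) has_derivative (\<lambda>s. s * a * Ha a b + - (b * s) * Hb a b + 0 * Ht a b)) (at 1)"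
    by (rule has_derivative_compose[THEN has_derivative_eq_rhs]) auto
  moreover have "((\<lambda>l. H (c l)) has_derivative (\<lambda>s. 0)) (at 1)"
  proof (rule has_derivative_transform_eventually[OF has_derivative_const])
    have "((\<lambda>l. l * a + b / l) \<longlongrightarrow> 1 * a + b / 1) (at (1::real))"
      by (intro tendsto_intros) auto
    then have "\<forall>\<^sub>F l in at 1. l * a + b / l < \<rho>\<^sub>0" using R by (intro order_tendstoD) (auto simp: R_def)
    moreover have "\<forall>\<^sub>F l in at (1::real). 0 < l"
      by (rule order_tendstoD(1)[OF tendsto_ident_at]) simp
    ultimately show "\<forall>\<^sub>F l in at 1. H (a, b, t) = H (c l)"
    proof eventually_elim
      case (elim l)
      then have "R (l * a) (b / l)" using R by (auto simp: R_def)
      from eventually_nhds_x_imp_x[OF invariant[OF R elim(2) this]] show ?case by (simp add: c_def)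
    qed
  qed (auto simp: c_def)
  ultimately have "(\<lambda>s. s * a * Ha a b + - (b * s) * Hb a b + 0 * Ht a b) = (\<lambda>s. 0)"
    by (rule has_derivative_unique)
  from fun_cong[OF this, of 1] show ?thesis by simp
qed

definition E :: "real \<times> real \<Rightarrow> real" where
  "E p = snd p * A' (fst p) (snd p) + fst p * B' (fst p) (snd p)"

text \<open>
  The material derivative of \<open>a b\<close> is constant along each hyperbola on which \<open>H\<close> has a nonzero gradient.
\<close>

lemma E_hyperbola:
  assumes R: "R a b" and n: "Ha a b \<noteq> 0 \<or> Hb a b \<noteq> 0" and R': "R p q" and pq: "p * q = a * b"
  shows "E (p, q) = E (a, b)"
proof -
  have ab: "0 < a" "0 < b" "0 < p" using R R' by (auto simp: R_def)
  define l where "l = p / a"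
  have l: "0 < l" "l * a = p" "b / l = q" using ab pq by (auto simp: l_def field_simps)
  \<comment> \<open>By \<open>radial_derivative\<close> this is the derivative of \<open>H\<close>
    with respect to the product a b; it is nonzero by assumption and can be cancelled when the two
    transport equations are compared.\<close>
  define h where "h = Ha a b / b"
  have h: "Ha a b = b * h" "Hb a b = a * h" using radial_derivative[OF R] ab by (auto simp: h_def field_simps)
  have "h \<noteq> 0" using n h by auto
  have s: "Ha p q = b * h / l" "Hb p q = l * (a * h)" "Ht p q = Ht a b"
    using scaled_derivatives[OF R l(1)] R' l h by (auto simp: field_simps)
  have "Ht a b + b * h * A' a b + a * h * B' a b = 0" using transport[OF R] h by simp
  moreover have "Ht a b + b * h / l * A' p q + l * (a * h) * B' p q = 0" using transport[OF R'] s by simp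
  ultimately have "h * (b / l * A' p q + (l * a) * B' p q) = h * (b * A' a b + a * B' a b)"
    by (simp add: algebra_simps)
  with \<open>h \<noteq> 0\<close> show ?thesis by (simp add: E_def l)
qed

text \<open>
  On a hyperbola \<open>a b = k\<close> the value of \<open>E\<close> is that at the vertex, which tends to \<open>E (0, 0) = 0\<close> as
  \<open>k \<rightarrow> 0\<close>; the limit along points with a fixed coordinate gives the claim.
\<close>

lemma
  shows B'_axis: "0 < a \<Longrightarrow> a < \<rho>\<^sub>0 \<Longrightarrow> B' a 0 = 0"
    and A'_axis: "0 < b \<Longrightarrow> b < \<rho>\<^sub>0 \<Longrightarrow> A' 0 b = 0"
proof -
  define Tri where "Tri = {p :: real \<times> real. 0 \<le> fst p \<and> 0 \<le> snd p \<and> fst p + snd p < \<rho>\<^sub>0}"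
  have cE: "continuous_on Tri E"
    unfolding E_def Tri_def by (intro continuous_intros contA contB)
  have "\<forall>n. \<exists>a b. R a b \<and> a * b < inverse (real (Suc n)) \<and> (Ha a b \<noteq> 0 \<or> Hb a b \<noteq> 0)"
    using nondeg by simp
  then obtain a b where ab: "\<And>n. R (a n) (b n)" "\<And>n. a n * b n < inverse (real (Suc n))"
      "\<And>n. Ha (a n) (b n) \<noteq> 0 \<or> Hb (a n) (b n) \<noteq> 0"
    by metis
  define k where "k n = a n * b n" for n
  have k0: "0 < k n" for n using ab(1)[of n] by (simp add: k_def R_def)
  have k: "k \<longlonglongrightarrow> 0"
    by (rule tendsto_sandwich[OF _ _ tendsto_const LIMSEQ_inverse_real_of_nat])
      (use ab(2) k0 in \<open>auto simp: k_def intro: less_imp_le always_eventually\<close>)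
  have sk: "(\<lambda>n. sqrt (k n)) \<longlonglongrightarrow> 0" using tendsto_real_sqrt[OF k] by simp
  have lim: "(\<lambda>n. E (c n)) \<longlonglongrightarrow> E l" if "c \<longlonglongrightarrow> l" "l \<in> Tri" "\<forall>\<^sub>F n in sequentially. R (fst (c n)) (snd (c n))" for c l
  proof (rule continuous_on_tendsto_compose[OF cE that(1,2)])
    show "\<forall>\<^sub>F n in sequentially. c n \<in> Tri"
      using that(3) by eventually_elim (auto simp: R_def Tri_def)
  qed
  have \<rho>: "0 < \<rho>\<^sub>0" using ab(1)[of 0] by (simp add: R_def)
  have "\<forall>\<^sub>F n in sequentially. R (sqrt (k n)) (sqrt (k n))"
  proof -
    have "\<forall>\<^sub>F n in sequentially. sqrt (k n) < \<rho>\<^sub>0 / 2" using \<rho> by (intro order_tendstoD[OF sk]) auto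
    then show ?thesis by eventually_elim (use k0 in \<open>auto simp: R_def\<close>)
  qed
  note ev0 = this
  have "(\<lambda>n. E (sqrt (k n), sqrt (k n))) \<longlonglongrightarrow> E (0, 0)"
    using ev0 \<rho> by (intro lim tendsto_Pair sk) (auto simp: Tri_def)
  moreover have "\<forall>\<^sub>F n in sequentially. E (sqrt (k n), sqrt (k n)) = E (a n, b n)"
    using ev0 by eventually_elim (use ab k0 in \<open>auto intro!: E_hyperbola simp: k_def less_imp_le\<close>)
  ultimately have "(\<lambda>n. E (a n, b n)) \<longlonglongrightarrow> E (0, 0)" by (rule Lim_transform_eventually)
  then have lim0: "(\<lambda>n. E (a n, b n)) \<longlonglongrightarrow> 0" by (simp add: E_def)
  {
    fix a0 :: real assume a0: "0 < a0" "a0 < \<rho>\<^sub>0"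
    have kl: "(\<lambda>n. k n / a0) \<longlonglongrightarrow> 0" using tendsto_divide[OF k tendsto_const, of a0] a0 by simp
    have "\<forall>\<^sub>F n in sequentially. k n / a0 < \<rho>\<^sub>0 - a0" using a0 by (intro order_tendstoD[OF kl]) auto
    then have ev: "\<forall>\<^sub>F n in sequentially. R a0 (k n / a0)" "\<forall>\<^sub>F n in sequentially. R (k n / a0) a0"
      by (eventually_elim, use k0 a0 in \<open>auto simp: R_def\<close>)+
    have "(\<lambda>n. E (a0, k n / a0)) \<longlonglongrightarrow> E (a0, 0)"
      using ev a0 by (intro lim tendsto_Pair kl tendsto_const) (auto simp: Tri_def)
    moreover have "\<forall>\<^sub>F n in sequentially. E (a0, k n / a0) = E (a n, b n)"
      using ev(1) by eventually_elim (use ab a0 in \<open>auto intro!: E_hyperbola simp: k_def\<close>)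
    ultimately have "(\<lambda>n. E (a n, b n)) \<longlonglongrightarrow> E (a0, 0)" by (rule Lim_transform_eventually)
    then have "E (a0, 0) = 0" using lim0 by (rule LIMSEQ_unique)
    \<comment> \<open>On the axis where the second coordinate vanishes only the term of
      \<open>E\<close> with \<open>B'\<close> survives, with the nonzero coefficient
      \<open>a0\<close>.\<close>
    then have 1: "B' a0 0 = 0" using a0 by (simp add: E_def)
    have "(\<lambda>n. E (k n / a0, a0)) \<longlonglongrightarrow> E (0, a0)"
      using ev a0 by (intro lim tendsto_Pair kl tendsto_const) (auto simp: Tri_def)
    moreover have "\<forall>\<^sub>F n in sequentially. E (k n / a0, a0) = E (a n, b n)"
      using ev(2) by eventually_elim (use ab a0 in \<open>auto intro!: E_hyperbola simp: k_def\<close>)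
    ultimately have "(\<lambda>n. E (a n, b n)) \<longlonglongrightarrow> E (0, a0)" by (rule Lim_transform_eventually)
    then have "E (0, a0) = 0" using lim0 by (rule LIMSEQ_unique)
    then have "A' 0 a0 = 0" using a0 by (simp add: E_def)
    note 1 this
  }
  then show "0 < a \<Longrightarrow> a < \<rho>\<^sub>0 \<Longrightarrow> B' a 0 = 0" "0 < b \<Longrightarrow> b < \<rho>\<^sub>0 \<Longrightarrow> A' 0 b = 0" for a b
    by auto
qed

end

section \<open>Uniform local charts around the center\<close>

text \<open>Constants are uniform for all times up to the right endpoint b, where the saddle may
  close. A fixed disc of radius \<kappa> in the image is covered at every time although the center
  moves. \<open>F'\<close> is the derivative jointly in space and time, \<open>g\<close> the inverse
  of \<open>F\<close> at fixed time, and \<open>expand\<close> its Lipschitz bound.\<close>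

locale moving_chart =
  fixes U :: "(real^2) set" and F :: "real^2 \<Rightarrow> real \<Rightarrow> real^2" and x0 :: "real^2" and r a b K c \<kappa> :: real
    and F' :: "(real^2) \<times> real \<Rightarrow> (real^2) \<times> real \<Rightarrow> real^2" and g :: "real^2 \<Rightarrow> real \<Rightarrow> real^2"
  assumes ball_U: "ball x0 r \<subseteq> U" and r: "0 < r" and ab: "a < b" and K: "0 < K" and c: "0 < c" and \<kappa>: "0 < \<kappa>"
    and deriv: "x \<in> ball x0 r \<Longrightarrow> t \<in> {a<..<b} \<Longrightarrow> ((\<lambda>q. F (fst q) (snd q)) has_derivative F' (x, t)) (at (x, t))"
    and F'_le: "x \<in> ball x0 r \<Longrightarrow> t \<in> {a<..<b} \<Longrightarrow> norm (F' (x, t) h) \<le> K * norm h"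
    and F'_lip: "x \<in> ball x0 r \<Longrightarrow> y \<in> ball x0 r \<Longrightarrow> t \<in> {a<..<b} \<Longrightarrow>
      norm (F' (x, t) h - F' (y, t) h) \<le> K * norm (x - y) * norm h"
    and det_ge: "x \<in> ball x0 r \<Longrightarrow> t \<in> {a<..<b} \<Longrightarrow> c \<le> \<bar>det (matrix (\<lambda>h. F' (x, t) (h, 0)))\<bar>"
    and g: "norm y < \<kappa> \<Longrightarrow> t \<in> {a<..<b} \<Longrightarrow> g y t \<in> ball x0 r \<and> F (g y t) t = y"
    and expand: "x \<in> ball x0 r \<Longrightarrow> y \<in> ball x0 r \<Longrightarrow> t \<in> {a<..<b} \<Longrightarrow> norm (x - y) \<le> K * norm (F x t - F y t)"

section \<open>Control of functions of class C^2 up to the boundary\<close>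

lemma C_upto_differentiable:
  assumes "C_upto k D E f" "set bs \<subseteq> Basis" "length bs < k" "x \<in> D"
  shows "iter_partial bs f differentiable (at x)"
  using assms unfolding C_upto_def by blast

text \<open>At points of \<open>E\<close> outside \<open>D\<close>, such as the final time, only
  limits of partial derivatives from within \<open>D\<close> are at hand, hence the formulation by
  points of \<open>D\<close> close to p.\<close>

lemma C_upto_partial_limit:
  assumes f: "C_upto k D E f" "D \<subseteq> E" and bs: "set bs \<subseteq> Basis" "length bs \<le> k" and p: "p \<in> E"
  shows "\<exists>l. \<forall>e>0. \<exists>d>0. \<forall>q\<in>D. dist q p < d \<longrightarrow> \<bar>iter_partial bs f q - l\<bar> < e"
proof -
  obtain h where h: "continuous_on E h" "\<And>x. x \<in> D \<Longrightarrow> h x = iter_partial bs f x"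
    using f(1) bs unfolding C_upto_def by metis
  have "\<exists>d>0. \<forall>q\<in>D. dist q p < d \<longrightarrow> \<bar>iter_partial bs f q - h p\<bar> < e" if e: "e > 0" for e
  proof -
    obtain d where "d > 0" "\<And>q. q \<in> E \<Longrightarrow> dist q p < d \<Longrightarrow> dist (h q) (h p) < e"
      using h(1) p e unfolding continuous_on_iff by blast
    then show ?thesis using f(2) by (intro exI[of _ d]) (auto simp: dist_real_def h(2)[symmetric])
  qed
  then show ?thesis by blast
qed

lemma finite_common_radius:
  fixes P :: "'b \<Rightarrow> 'a::metric_space \<Rightarrow> bool"
  assumes "finite I" "\<And>i. i \<in> I \<Longrightarrow> \<exists>d>0. \<forall>q\<in>D. dist q p < d \<longrightarrow> P i q"
  shows "\<exists>d>0. \<forall>q\<in>D. dist q p < d \<longrightarrow> (\<forall>i\<in>I. P i q)"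
  using assms
proof (induction I rule: finite_induct)
  case empty
  then show ?case by (auto intro: exI[of _ 1])
next
  case (insert i I)
  obtain d1 where "d1 > 0" "\<forall>q\<in>D. dist q p < d1 \<longrightarrow> P i q" using insert.prems[of i] by auto
  moreover obtain d2 where "d2 > 0" "\<forall>q\<in>D. dist q p < d2 \<longrightarrow> (\<forall>i\<in>I. P i q)" using insert by auto
  ultimately show ?case by (intro exI[of _ "min d1 d2"]) auto
qed

lemma linear_le_Basis:
  fixes L :: "'a::euclidean_space \<Rightarrow> real"
  assumes "linear L" "\<And>b. b \<in> Basis \<Longrightarrow> \<bar>L b\<bar> \<le> e"
  shows "\<bar>L h\<bar> \<le> real DIM('a) * e * norm h"
proof -
  have "L h = L (\<Sum>b\<in>Basis. (h \<bullet> b) *\<^sub>R b)" by (simp only: euclidean_representation)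
  also have "\<dots> = (\<Sum>b\<in>Basis. (h \<bullet> b) * L b)"
    by (simp only: linear_sum[OF assms(1)] linear_scale[OF assms(1)] real_scaleR_def)
  finally have "\<bar>L h\<bar> = \<bar>\<Sum>b\<in>Basis. (h \<bullet> b) * L b\<bar>" by simp
  then have "\<bar>L h\<bar> \<le> (\<Sum>b\<in>Basis. \<bar>(h \<bullet> b) * L b\<bar>)" by (simp only: sum_abs)
  also have "\<dots> \<le> (\<Sum>b\<in>(Basis::'a set). norm h * e)"
    using assms(2) by (intro sum_mono) (auto simp: abs_mult intro!: mult_mono Basis_le_norm)
  finally show ?thesis by (simp add: mult_ac)
qed

text \<open>The limits of the first partials at p assemble into the linear map \<open>L\<close>. The
  second partials have limits too, so they are bounded near p, and the mean value theorem on a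
  convex piece of \<open>D\<close> makes the derivative Lipschitz there.\<close>

lemma C_upto_2_local:
  fixes f :: "'a::euclidean_space \<Rightarrow> real"
  assumes f: "C_upto 2 D E f" "D \<subseteq> E" and p: "p \<in> E"
  shows "\<exists>L. linear L \<and> (\<forall>e>0. \<exists>d>0. \<forall>q\<in>D. dist q p < d \<longrightarrow> (\<forall>h. \<bar>frechet_derivative f (at q) h - L h\<bar> \<le> e * norm h))"
    and "\<exists>K d. 0 < d \<and> (\<forall>S q q'. convex S \<longrightarrow> S \<subseteq> D \<longrightarrow> S \<subseteq> ball p d \<longrightarrow> q \<in> S \<longrightarrow> q' \<in> S \<longrightarrow>
      (\<forall>h. \<bar>frechet_derivative f (at q) h - frechet_derivative f (at q') h\<bar> \<le> K * norm (q - q') * norm h))"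
proof -
  have diff: "f differentiable (at q)" if "q \<in> D" for q
    using C_upto_differentiable[OF f(1), of "[]" q] that by simp
  have lin: "linear (frechet_derivative f (at q))" if "q \<in> D" for q
    by (rule linear_frechet_derivative[OF diff[OF that]])
  have diff2: "(\<lambda>q. frechet_derivative f (at q) b) differentiable (at q)" if "q \<in> D" "b \<in> Basis" for q b
    using C_upto_differentiable[OF f(1), of "[b]" q] that by simp
  have "\<forall>b\<in>Basis. \<exists>l. \<forall>e>0. \<exists>d>0. \<forall>q\<in>D. dist q p < d \<longrightarrow> \<bar>frechet_derivative f (at q) b - l\<bar> < e"
  proof
    fix b :: 'a assume "b \<in> Basis"
    then show "\<exists>l. \<forall>e>0. \<exists>d>0. \<forall>q\<in>D. dist q p < d \<longrightarrow> \<bar>frechet_derivative f (at q) b - l\<bar> < e"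
      using C_upto_partial_limit[OF f, of "[b]" p] p by simp
  qed
  then obtain G where G: "\<And>b e. b \<in> Basis \<Longrightarrow> 0 < e \<Longrightarrow> \<exists>d>0. \<forall>q\<in>D. dist q p < d \<longrightarrow> \<bar>frechet_derivative f (at q) b - G b\<bar> < e"
    by metis
  define L where "L h = (\<Sum>b\<in>Basis. (h \<bullet> b) * G b)" for h :: 'a
  have L: "linear L"
    unfolding L_def by (intro linear_compose_sum linearI ballI) (auto simp: inner_add_left algebra_simps)
  have Lb: "L b = G b" if "b \<in> Basis" for b
  proof -
    have "L b = (\<Sum>b'\<in>Basis. if b' = b then G b else 0)"
      unfolding L_def using that by (intro sum.cong) (auto simp: inner_Basis)
    then show ?thesis using that by simp
  qed
  have N: "real DIM('a) > 0" by simp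
  have "\<exists>d>0. \<forall>q\<in>D. dist q p < d \<longrightarrow> (\<forall>h. \<bar>frechet_derivative f (at q) h - L h\<bar> \<le> e * norm h)" if "e > 0" for e
  proof -
    have "\<exists>d>0. \<forall>q\<in>D. dist q p < d \<longrightarrow> (\<forall>b\<in>Basis. \<bar>frechet_derivative f (at q) b - G b\<bar> < e / real DIM('a))"
      using that N by (intro finite_common_radius G) auto
    then obtain d where d: "d > 0" "\<And>q b. q \<in> D \<Longrightarrow> dist q p < d \<Longrightarrow> b \<in> Basis \<Longrightarrow> \<bar>frechet_derivative f (at q) b - G b\<bar> < e / real DIM('a)"
      by blast
    have "\<bar>frechet_derivative f (at q) h - L h\<bar> \<le> e * norm h" if "q \<in> D" "dist q p < d" for q h
    proof -
      have "\<bar>frechet_derivative f (at q) h - L h\<bar> \<le> real DIM('a) * (e / real DIM('a)) * norm h"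
        using d(2)[OF that] Lb by (intro linear_le_Basis linear_compose_sub lin L that) (auto intro: less_imp_le)
      then show ?thesis by simp
    qed
    with d(1) show ?thesis by blast
  qed
  with L show "\<exists>L. linear L \<and> (\<forall>e>0. \<exists>d>0. \<forall>q\<in>D. dist q p < d \<longrightarrow> (\<forall>h. \<bar>frechet_derivative f (at q) h - L h\<bar> \<le> e * norm h))"
    by blast
  define P where "P b q = frechet_derivative f (at q) b" for b q
  have "\<forall>x\<in>(Basis \<times> Basis :: ('a \<times> 'a) set). \<exists>l. \<forall>e>0. \<exists>d>0. \<forall>q\<in>D. dist q p < d \<longrightarrow> \<bar>frechet_derivative (P (snd x)) (at q) (fst x) - l\<bar> < e"
  proof
    fix x :: "'a \<times> 'a" assume "x \<in> Basis \<times> Basis"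
    then show "\<exists>l. \<forall>e>0. \<exists>d>0. \<forall>q\<in>D. dist q p < d \<longrightarrow> \<bar>frechet_derivative (P (snd x)) (at q) (fst x) - l\<bar> < e"
      using C_upto_partial_limit[OF f, of "[fst x, snd x]" p] p by (auto simp: P_def[abs_def])
  qed
  then obtain G2 where G2: "\<And>x e. x \<in> (Basis \<times> Basis :: ('a \<times> 'a) set) \<Longrightarrow> 0 < e \<Longrightarrow> \<exists>d>0. \<forall>q\<in>D. dist q p < d \<longrightarrow> \<bar>frechet_derivative (P (snd x)) (at q) (fst x) - G2 x\<bar> < e"
    by metis
  have "\<exists>d>0. \<forall>q\<in>D. dist q p < d \<longrightarrow> (\<forall>x\<in>(Basis \<times> Basis :: ('a \<times> 'a) set). \<bar>frechet_derivative (P (snd x)) (at q) (fst x) - G2 x\<bar> < 1)"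
    by (intro finite_common_radius G2) auto
  then obtain d where d: "d > 0" "\<And>q x. q \<in> D \<Longrightarrow> dist q p < d \<Longrightarrow> x \<in> Basis \<times> Basis \<Longrightarrow> \<bar>frechet_derivative (P (snd x)) (at q) (fst x) - G2 x\<bar> < 1"
    by blast
  define M where "M = (\<Sum>x\<in>(Basis \<times> Basis :: ('a \<times> 'a) set). \<bar>G2 x\<bar>) + 1"
  have M: "\<bar>frechet_derivative (P b) (at q) b'\<bar> \<le> M" if "q \<in> D" "dist q p < d" "b \<in> Basis" "b' \<in> Basis" for q b b'
  proof -
    have "\<bar>G2 (b', b)\<bar> \<le> (\<Sum>x\<in>(Basis \<times> Basis :: ('a \<times> 'a) set). \<bar>G2 x\<bar>)"
      using that by (intro member_le_sum) auto
    with d(2)[OF that(1,2), of "(b', b)"] that show ?thesis by (auto simp: M_def)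
  qed
  have "\<bar>frechet_derivative f (at q) h - frechet_derivative f (at q') h\<bar> \<le> real DIM('a) * (real DIM('a) * M) * norm (q - q') * norm h"
    if S: "convex S" "S \<subseteq> D" "S \<subseteq> ball p d" "q \<in> S" "q' \<in> S" for S q q' h
  proof -
    have "\<bar>P b q - P b q'\<bar> \<le> real DIM('a) * M * norm (q - q')" if b: "b \<in> Basis" for b
    proof -
      have "norm (P b q - P b q') \<le> real DIM('a) * M * norm (q - q')"
      proof (rule differentiable_bound[OF S(1) _ _ S(4,5)])
        fix x assume "x \<in> S"
        then have x: "x \<in> D" "dist x p < d" using S(2,3) by (auto simp: dist_commute)
        have D: "P b differentiable (at x)" using diff2[OF x(1) b] by (simp add: P_def[abs_def])
        show "(P b has_derivative frechet_derivative (P b) (at x)) (at x within S)"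
          by (rule has_derivative_at_withinI[OF iffD1[OF frechet_derivative_works D]])
        have "\<bar>frechet_derivative (P b) (at x) h\<bar> \<le> real DIM('a) * M * norm h" for h
          using M[OF x b] by (intro linear_le_Basis linear_frechet_derivative D)
        then show "onorm (frechet_derivative (P b) (at x)) \<le> real DIM('a) * M"
          by (intro onorm_le) simp
      qed
      then show ?thesis by simp
    qed
    moreover have "q \<in> D" "q' \<in> D" using S by auto
    ultimately have "\<bar>frechet_derivative f (at q) h - frechet_derivative f (at q') h\<bar> \<le> real DIM('a) * (real DIM('a) * M * norm (q - q')) * norm h"
      by (intro linear_le_Basis[OF linear_compose_sub[OF lin lin]]) (auto simp: P_def)
    then show ?thesis by (simp add: mult_ac)
  qed
  then show "\<exists>K d. 0 < d \<and> (\<forall>S q q'. convex S \<longrightarrow> S \<subseteq> D \<longrightarrow> S \<subseteq> ball p d \<longrightarrow> q \<in> S \<longrightarrow> q' \<in> S \<longrightarrow>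
      (\<forall>h. \<bar>frechet_derivative f (at q) h - frechet_derivative f (at q') h\<bar> \<le> K * norm (q - q') * norm h))"
    using d(1) by blast
qed

lemma norm_vec2_le:
  fixes v :: "real^2"
  assumes "\<And>i. \<bar>v $ i\<bar> \<le> e"
  shows "norm v \<le> 2 * e"
proof -
  have "norm v \<le> (\<Sum>i\<in>UNIV. \<bar>v $ i\<bar>)" by (rule norm_le_l1_cart)
  also have "\<dots> \<le> (\<Sum>i\<in>(UNIV :: 2 set). e)" using assms by (intro sum_mono) auto
  finally show ?thesis by simp
qed

lemma has_derivative_vec2:
  fixes f :: "'a::euclidean_space \<Rightarrow> real^'n"
  assumes "\<And>i. ((\<lambda>x. f x $ i) has_derivative (\<lambda>h. f' h $ i)) (at x)"
  shows "(f has_derivative f') (at x)"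
proof -
  have "((\<lambda>x. f x \<bullet> b) has_derivative (\<lambda>h. f' h \<bullet> b)) (at x)" if b: "b \<in> Basis" for b
  proof -
    obtain i where "b = axis i 1" using b by (auto simp: Basis_vec_def)
    then show ?thesis using assms[of i] by (simp add: inner_axis)
  qed
  then show ?thesis by (subst has_derivative_componentwise_within) auto
qed

lemma has_derivative_slice:
  assumes "((\<lambda>q. F (fst q) (snd q)) has_derivative F') (at (x, t))"
  shows "((\<lambda>z. F z t) has_derivative (\<lambda>h. F' (h, 0))) (at x)"
proof -
  have "((\<lambda>z. (z, t)) has_derivative (\<lambda>h. (h, 0))) (at x)"
    by (auto intro!: derivative_eq_intros)
  from has_derivative_compose[OF this, of "\<lambda>q. F (fst q) (snd q)" F'] assms show ?thesis by simp
qed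

lemma linear_det_inverse:
  fixes A :: "real^'n \<Rightarrow> real^'n"
  assumes A: "linear A" and det: "det (matrix A) \<noteq> 0"
  shows "\<exists>B. linear B \<and> (\<forall>h. B (A h) = h) \<and> (\<forall>y. A (B y) = y)"
proof -
  define M where "M = matrix A"
  have inv: "invertible M" using det by (simp add: M_def invertible_det_nz)
  have AM: "A h = M *v h" for h
    unfolding M_def by (rule fun_cong[OF matrix_vector_mul(2)[OF A], symmetric])
  obtain N where "M ** N = mat 1" "N ** M = mat 1" using inv by (auto simp: invertible_def)
  then show ?thesis
    by (intro exI[of _ "\<lambda>y. N *v y"]) (simp add: AM matrix_vector_mul_assoc matrix_vector_mul_linear)
qed

text \<open>A quantitative inverse function theorem at the space-time point p formed by the center
  at time \<open>t1\<close>, which may lie on the boundary of the domain of differentiability. The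
  spatial part of the limiting derivative is inverted once, and this frozen inverse serves at all
  slightly earlier times.\<close>

lemma ex_moving_chart:
  assumes S: "simple_saddle T U \<beta> \<delta> F" and t1: "0 < t1" "t1 \<le> T"
  shows "\<exists>x0 r a K c \<kappa> F' g. 0 \<le> a \<and> moving_chart U F x0 r a t1 K c \<kappa> F' g"
proof -
  define D where "D = U \<times> {0<..<T}"
  define E where "E = closure U \<times> {0..T}"
  have DE: "D \<subseteq> E" using closure_subset[of U] by (auto simp: D_def E_def)
  have openU: "open U"
    and FC: "\<forall>i. C_upto 2 (U \<times> {0<..<T}) (closure U \<times> {0..T}) (\<lambda>(x, t). F x t $ i)"
    and det_F: "\<exists>c>0. \<forall>x\<in>U. \<forall>t\<in>{0..T}. c \<le> \<bar>det (matrix (frechet_derivative (\<lambda>z. F z t) (at x)))\<bar>"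
    and center: "\<forall>t\<in>{0..T}. \<exists>x\<in>U. F x t = 0"
    using S unfolding simple_saddle_def by - (elim conjE, assumption)+
  have "t1 \<in> {0..T}" using t1 by simp
  with center obtain x0 where x0: "x0 \<in> U" "F x0 t1 = 0" by blast
  define p where "p = (x0, t1)"
  have p: "p \<in> E" using x0 t1 closure_subset[of U] by (auto simp: p_def E_def)
  define f where "f i q = F (fst q) (snd q) $ i" for i q
  have fC: "C_upto 2 D E (f i)" for i
    using FC unfolding D_def E_def f_def case_prod_unfold by blast
  define F' where "F' q h = (\<chi> i. frechet_derivative (f i) (at q) h)" for q h
  obtain c where c: "c > 0" and c_le: "\<And>x t. x \<in> U \<Longrightarrow> t \<in> {0..T} \<Longrightarrow> c \<le> \<bar>det (matrix (frechet_derivative (\<lambda>z. F z t) (at x)))\<bar>"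
    using det_F by blast
  have der: "((\<lambda>q. F (fst q) (snd q)) has_derivative F' q) (at q)" if q: "q \<in> D" for q
  proof (rule has_derivative_vec2)
    fix i
    have "f i differentiable (at q)" using C_upto_differentiable[OF fC[of i], of "[]" q] q by simp
    then have "(f i has_derivative frechet_derivative (f i) (at q)) (at q)" by (simp only: frechet_derivative_works)
    then show "((\<lambda>q. F (fst q) (snd q) $ i) has_derivative (\<lambda>h. F' q h $ i)) (at q)"
      by (simp add: F'_def f_def[abs_def])
  qed
  have slice: "((\<lambda>z. F z t) has_derivative (\<lambda>h. F' (x, t) (h, 0))) (at x)" if "x \<in> U" "t \<in> {0<..<T}" for x t
    using that by (intro has_derivative_slice der) (auto simp: D_def)
  have det_c: "c \<le> \<bar>det (matrix (\<lambda>h. F' (x, t) (h, 0)))\<bar>" if "x \<in> U" "t \<in> {0<..<T}" for x t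
    using c_le[of x t] that frechet_derivative_at[OF slice[OF that]] by simp
  have "\<forall>i. \<exists>L. linear L \<and> (\<forall>e>0. \<exists>d>0. \<forall>q\<in>D. dist q p < d \<longrightarrow> (\<forall>h. \<bar>frechet_derivative (f i) (at q) h - L h\<bar> \<le> e * norm h))"
    using C_upto_2_local(1)[OF fC DE p] by blast
  then obtain Lf where Lf: "\<And>i. linear (Lf i)" "\<And>i e. 0 < e \<Longrightarrow> \<exists>d>0. \<forall>q\<in>D. dist q p < d \<longrightarrow> (\<forall>h. \<bar>frechet_derivative (f i) (at q) h - Lf i h\<bar> \<le> e * norm h)"
    by metis
  define L where "L h = (\<chi> i. Lf i h)" for h
  have L: "linear L"
    unfolding L_def by (rule linearI) (simp_all add: vec_eq_iff linear_add[OF Lf(1)] linear_scale[OF Lf(1)])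
  have L_close: "\<exists>d>0. \<forall>q\<in>D. dist q p < d \<longrightarrow> (\<forall>h. norm (F' q h - L h) \<le> e * norm h)" if e: "e > 0" for e
  proof -
    have "\<exists>d>0. \<forall>q\<in>D. dist q p < d \<longrightarrow> (\<forall>i\<in>(UNIV :: 2 set). \<forall>h. \<bar>frechet_derivative (f i) (at q) h - Lf i h\<bar> \<le> e / 2 * norm h)"
      using e by (intro finite_common_radius Lf(2)) auto
    then obtain d where d: "d > 0" "\<And>q i h. q \<in> D \<Longrightarrow> dist q p < d \<Longrightarrow> \<bar>frechet_derivative (f i) (at q) h - Lf i h\<bar> \<le> e / 2 * norm h"
      by blast
    have "norm (F' q h - L h) \<le> e * norm h" if "q \<in> D" "dist q p < d" for q h
    proof -
      have "norm (F' q h - L h) \<le> 2 * (e / 2 * norm h)"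
        using d(2)[OF that] by (intro norm_vec2_le) (simp add: F'_def L_def)
      then show ?thesis by simp
    qed
    with d(1) show ?thesis by blast
  qed
  have "\<forall>i. \<exists>K d. 0 < d \<and> (\<forall>S q q'. convex S \<longrightarrow> S \<subseteq> D \<longrightarrow> S \<subseteq> ball p d \<longrightarrow> q \<in> S \<longrightarrow> q' \<in> S \<longrightarrow>
      (\<forall>h. \<bar>frechet_derivative (f i) (at q) h - frechet_derivative (f i) (at q') h\<bar> \<le> K * norm (q - q') * norm h))"
    using C_upto_2_local(2)[OF fC DE p] by blast
  then obtain Kf df where df: "\<And>i. 0 < df i" and Kf: "\<And>i S q q' h. convex S \<Longrightarrow> S \<subseteq> D \<Longrightarrow> S \<subseteq> ball p (df i) \<Longrightarrow> q \<in> S \<Longrightarrow> q' \<in> S \<Longrightarrow>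
      \<bar>frechet_derivative (f i) (at q) h - frechet_derivative (f i) (at q') h\<bar> \<le> Kf i * norm (q - q') * norm h"
    by metis
  define K2 where "K2 = \<bar>Kf 1\<bar> + \<bar>Kf 2\<bar>"
  define d2 where "d2 = min (df 1) (df 2)"
  have d2: "d2 > 0" using df by (simp add: d2_def)
  have F'_lip0: "norm (F' q h - F' q' h) \<le> 2 * K2 * norm (q - q') * norm h"
    if S: "convex S" "S \<subseteq> D" "S \<subseteq> ball p d2" "q \<in> S" "q' \<in> S" for S q q' h
  proof -
    have "\<bar>(F' q h - F' q' h) $ i\<bar> \<le> K2 * norm (q - q') * norm h" for i
    proof -
      have "i = 1 \<or> i = 2" by (rule exhaust_2)
      then have le: "Kf i \<le> K2" "d2 \<le> df i" by (auto simp: K2_def d2_def)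
      have "\<bar>frechet_derivative (f i) (at q) h - frechet_derivative (f i) (at q') h\<bar> \<le> Kf i * norm (q - q') * norm h"
        using S le(2) by (intro Kf[of S]) auto
      also have "\<dots> \<le> K2 * norm (q - q') * norm h" using le(1) by (intro mult_right_mono) auto
      finally show ?thesis by (simp add: F'_def)
    qed
    then have "norm (F' q h - F' q' h) \<le> 2 * (K2 * norm (q - q') * norm h)" by (rule norm_vec2_le)
    then show ?thesis by simp
  qed
  define A where "A h = L (h, 0)" for h
  have A: "linear A"
    unfolding A_def by (rule linearI) (simp_all add: linear_add[OF L, symmetric] linear_scale[OF L, symmetric])
  define M where "M = matrix A"
  \<comment> \<open>The Jacobian bound is used at times before \<open>t1\<close> and passed to the
    limit from the left at the fixed point \<open>x0\<close>.\<close>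
  have "c \<le> \<bar>det M\<bar>"
  proof -
    have conv: "((\<lambda>t. F' (x0, t) h) \<longlongrightarrow> L h) (at_left t1)" for h
    proof (rule tendstoI)
      fix e :: real assume e: "e > 0"
      define e' where "e' = e / (2 * (1 + norm h))"
      have n: "0 < 1 + norm h" by (simp add: add_pos_nonneg)
      have e': "e' > 0" using e n by (simp add: e'_def)
      obtain d where d: "d > 0" "\<And>q h. q \<in> D \<Longrightarrow> dist q p < d \<Longrightarrow> norm (F' q h - L h) \<le> e' * norm h"
        using L_close[OF e'] by blast
      have "\<forall>\<^sub>F t in at_left t1. t \<in> {max 0 (t1 - d)<..<t1}" using t1 d(1) by (intro eventually_at_left_real) auto
      then show "\<forall>\<^sub>F t in at_left t1. dist (F' (x0, t) h) (L h) < e"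
      proof eventually_elim
        case (elim t)
        then have "norm (F' (x0, t) h - L h) \<le> e' * norm h"
          using t1 x0 by (intro d(2)) (auto simp: D_def p_def dist_Pair_Pair dist_real_def)
        also have "\<dots> < e"
        proof -
          have "e' * norm h \<le> e' * (1 + norm h)" using e' by (intro mult_left_mono) auto
          also have "\<dots> = e / 2" using n by (simp add: e'_def field_simps)
          finally show ?thesis using e by linarith
        qed
        finally show ?case by (simp add: dist_norm)
      qed
    qed
    have "((\<lambda>t. \<bar>det (matrix (\<lambda>h. F' (x0, t) (h, 0)))\<bar>) \<longlongrightarrow> \<bar>det M\<bar>) (at_left t1)"
      unfolding det_2 matrix_def M_def A_def
      by (auto intro!: tendsto_intros conv)
    moreover have "\<forall>\<^sub>F t in at_left t1. c \<le> \<bar>det (matrix (\<lambda>h. F' (x0, t) (h, 0)))\<bar>"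
      using eventually_at_left_real[OF t1(1)] by eventually_elim (use t1 x0 in \<open>auto intro!: det_c\<close>)
    ultimately show ?thesis by (rule tendsto_lowerbound) simp
  qed
  then have "det M \<noteq> 0" using c by auto
  then obtain B where B: "linear B" and BA: "\<And>h. B (A h) = h" and AB: "\<And>y. A (B y) = y"
    using linear_det_inverse[OF A] by (auto simp: M_def)
  obtain b where b: "b > 0" "\<And>y. norm (B y) \<le> b * norm y" using linear_bounded_pos[OF B] by blast
  obtain bL where bL: "bL > 0" "\<And>y. norm (L y) \<le> bL * norm y" using linear_bounded_pos[OF L] by blast
  \<comment> \<open>With b e = 1/2 the error of the linearisation, after applying \<open>B\<close>,
    is at most half the distance. This gives both the contraction below and the constant 2 b in
    \<open>expand\<close>.\<close>
  define e where "e = 1 / (2 * b)"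
  have e: "e > 0" "b * e = 1 / 2" using b by (auto simp: e_def)
  obtain d1 where d1: "d1 > 0" "\<And>q h. q \<in> D \<Longrightarrow> dist q p < d1 \<Longrightarrow> norm (F' q h - L h) \<le> e * norm h"
    using L_close[OF e(1)] by blast
  obtain rU where rU: "rU > 0" "ball x0 rU \<subseteq> U" using openU x0 by (meson openE)
  define r where "r = min (min d1 d2) rU / 2"
  have r: "r > 0" "2 * r \<le> d1" "2 * r \<le> d2" "r \<le> rU" using d1 d2 rU by (auto simp: r_def)
  have cont0: "((\<lambda>t. F x0 t) \<longlongrightarrow> 0) (at t1 within {0..T})"
  proof (rule vec_tendstoI)
    fix i
    have "continuous_on E (f i)" using fC[of i] unfolding C_upto_def by blast
    then have "continuous_on {0..T} (\<lambda>t. f i (x0, t))"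
    proof (rule continuous_on_compose2)
      show "continuous_on {0..T} (\<lambda>t. (x0, t))" by (intro continuous_intros)
      show "(\<lambda>t. (x0, t)) ` {0..T} \<subseteq> E" using x0 closure_subset[of U] by (auto simp: E_def)
    qed
    then have "((\<lambda>t. f i (x0, t)) \<longlongrightarrow> f i (x0, t1)) (at t1 within {0..T})"
      using \<open>t1 \<in> {0..T}\<close> unfolding continuous_on_def by blast
    then show "((\<lambda>t. F x0 t $ i) \<longlongrightarrow> 0 $ i) (at t1 within {0..T})"
      by (simp add: f_def x0(2))
  qed
  \<comment> \<open>Targets y and values at \<open>x0\<close>, both of norm below \<kappa>, displace
    \<open>x0\<close> by at most 2 b \<kappa> = r / 4; together with the contraction this stays
    within r / 2.\<close>
  define \<kappa> where "\<kappa> = r / (8 * b)"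
  have \<kappa>: "\<kappa> > 0" using r b by (simp add: \<kappa>_def)
  obtain d3 where d3: "d3 > 0" "\<And>t. t \<in> {0..T} \<Longrightarrow> t \<noteq> t1 \<Longrightarrow> dist t t1 < d3 \<Longrightarrow> norm (F x0 t) < \<kappa>"
    using tendstoD[OF cont0 \<kappa>] unfolding eventually_at by auto
  define a where "a = max 0 (t1 - min r d3)"
  have a: "0 \<le> a" "a < t1" using t1 r d3 by (auto simp: a_def)
  have tT: "t \<in> {0<..<T}" "\<bar>t - t1\<bar> < r" "norm (F x0 t) < \<kappa>" if "t \<in> {a<..<t1}" for t
    using that t1 d3(2)[of t] by (auto simp: a_def dist_real_def)
  define S where "S = ball x0 r \<times> {a<..<t1}"
  have SD: "S \<subseteq> D" using rU r(4) tT(1) by (force simp: S_def D_def)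
  have Sp: "dist q p < 2 * r" if "q \<in> S" for q
  proof -
    have "dist q p \<le> dist (fst q) x0 + dist (snd q) t1"
      unfolding dist_prod_def p_def by (simp add: sqrt_sum_squares_le_sum)
    also have "\<dots> < r + r" using that tT(2)[of "snd q"] by (intro add_strict_mono) (auto simp: S_def dist_commute dist_real_def)
    finally show ?thesis by simp
  qed
  have Sd2: "S \<subseteq> ball p d2"
  proof
    fix q assume "q \<in> S"
    from Sp[OF this] r(3) show "q \<in> ball p d2" by (simp add: dist_commute)
  qed
  have Sconv: "convex S" unfolding S_def by (intro convex_Times) auto
  define K where "K = bL + e + 2 * K2 + 2 * b"
  have K2: "0 \<le> K2" by (simp add: K2_def)
  have K: "0 < K" "bL + e \<le> K" "2 * K2 \<le> K" "2 * b \<le> K" using bL(1) e(1) K2 b(1) by (auto simp: K_def)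
  have near: "norm ((F x t - F x' t) - A (x - x')) \<le> e * norm (x - x')"
    if x: "x \<in> ball x0 r" "x' \<in> ball x0 r" and t: "t \<in> {a<..<t1}" for x x' t
  proof -
    have "norm ((F x t - A x) - (F x' t - A x')) \<le> e * norm (x - x')"
    proof (rule differentiable_bound[where S = "ball x0 r" and f' = "\<lambda>x h. F' (x, t) (h, 0) - A h"])
      fix z assume z: "z \<in> ball x0 r"
      then have zS: "(z, t) \<in> S" using t by (simp add: S_def)
      then have zD: "(z, t) \<in> D" using SD by blast
      show "((\<lambda>x. F x t - A x) has_derivative (\<lambda>h. F' (z, t) (h, 0) - A h)) (at z within ball x0 r)"
        using zD A by (intro has_derivative_diff has_derivative_at_withinI[OF slice] linear_imp_has_derivative) (auto simp: D_def)
      have "norm (F' (z, t) (h, 0) - L (h, 0)) \<le> e * norm (h, 0::real)" for h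
        using Sp[OF zS] r(2) by (intro d1(2) zD) auto
      then show "onorm (\<lambda>h. F' (z, t) (h, 0) - A h) \<le> e"
        by (intro onorm_le) (simp add: A_def norm_Pair)
    qed (use x in auto)
    then show ?thesis by (simp add: linear_diff[OF A] algebra_simps)
  qed
  define g where "g y t = (SOME x. x \<in> ball x0 r \<and> F x t = y)" for y t
  have "moving_chart U F x0 r a t1 K c \<kappa> F' g"
  proof
    show "ball x0 r \<subseteq> U" using rU r(4) by force
    show "0 < r" "a < t1" "0 < K" "0 < c" "0 < \<kappa>" by fact+
    fix x y :: "real^2" and t h
    {
      assume "x \<in> ball x0 r" "t \<in> {a<..<t1}"
      then have xS: "(x, t) \<in> S" by (simp add: S_def)
      then have xD: "(x, t) \<in> D" using SD by blast
      show "((\<lambda>q. F (fst q) (snd q)) has_derivative F' (x, t)) (at (x, t))" by (rule der[OF xD])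
      show "c \<le> \<bar>det (matrix (\<lambda>h. F' (x, t) (h, 0)))\<bar>" using xD by (intro det_c) (auto simp: D_def)
      have "norm (F' (x, t) h) \<le> norm (L h) + norm (F' (x, t) h - L h)" by (metis add.commute diff_add_cancel norm_triangle_ineq)
      also have "\<dots> \<le> bL * norm h + e * norm h"
        using Sp[OF xS] r(2) by (intro add_mono bL(2) d1(2) xD) auto
      also have "\<dots> \<le> K * norm h" using K(2) by (simp add: distrib_right[symmetric] mult_right_mono)
      finally show "norm (F' (x, t) h) \<le> K * norm h" .
    }
    {
      assume xy: "x \<in> ball x0 r" "y \<in> ball x0 r" "t \<in> {a<..<t1}"
      have "norm (F' (x, t) h - F' (y, t) h) \<le> 2 * K2 * norm ((x, t) - (y, t)) * norm h"
        using xy by (intro F'_lip0[OF Sconv SD Sd2]) (auto simp: S_def)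
      also have "\<dots> \<le> K * norm (x - y) * norm h"
        using K(3) by (simp add: norm_Pair mult_right_mono)
      finally show "norm (F' (x, t) h - F' (y, t) h) \<le> K * norm (x - y) * norm h" .
      have "x - y = B (F x t - F y t) - B ((F x t - F y t) - A (x - y))"
        by (simp only: linear_diff[OF B, symmetric]) (simp add: BA)
      then have "norm (x - y) \<le> norm (B (F x t - F y t)) + norm (B ((F x t - F y t) - A (x - y)))"
        by (metis norm_triangle_ineq4)
      also have "\<dots> \<le> b * norm (F x t - F y t) + b * (e * norm (x - y))"
        using b(1) by (intro add_mono b(2) order_trans[OF b(2)] mult_left_mono near xy) auto
      also have "b * (e * norm (x - y)) = norm (x - y) / 2" using e(2) by (simp add: mult.assoc[symmetric])
      finally have "norm (x - y) \<le> 2 * b * norm (F x t - F y t)" by simp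
      also have "\<dots> \<le> K * norm (F x t - F y t)" using K(4) by (intro mult_right_mono) auto
      finally show "norm (x - y) \<le> K * norm (F x t - F y t)" .
    }
    {
      assume y: "norm y < \<kappa>" and t: "t \<in> {a<..<t1}"
      define \<Psi> where "\<Psi> x = x - B (F x t - y)" for x
      have sub: "cball x0 (r / 2) \<subseteq> ball x0 r" using r by auto
      have contr: "dist (\<Psi> x) (\<Psi> x') \<le> 1 / 2 * dist x x'" if "x \<in> cball x0 (r / 2)" "x' \<in> cball x0 (r / 2)" for x x'
      proof -
        have "\<Psi> x - \<Psi> x' = B (A (x - x') - (F x t - F x' t))"
          unfolding \<Psi>_def linear_diff[OF B] BA by (simp add: algebra_simps)
        then have "norm (\<Psi> x - \<Psi> x') \<le> b * norm (A (x - x') - (F x t - F x' t))" using b(2) by simp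
        also have "\<dots> \<le> b * (e * norm (x - x'))"
        proof (intro mult_left_mono)
          have "x \<in> ball x0 r" "x' \<in> ball x0 r" using that sub by blast+
          from near[OF this t] show "norm (A (x - x') - (F x t - F x' t)) \<le> e * norm (x - x')"
            by (simp only: norm_minus_commute)
        qed (use b(1) in simp)
        also have "\<dots> = 1 / 2 * norm (x - x')" using e(2) by (simp add: mult.assoc[symmetric])
        finally show ?thesis by (simp add: dist_norm)
      qed
      have "\<exists>!x\<in>cball x0 (r / 2). \<Psi> x = x"
      proof (rule Banach_fix[where c = "1 / 2"])
        show "\<Psi> ` cball x0 (r / 2) \<subseteq> cball x0 (r / 2)"
        proof clarify
          fix x assume x: "x \<in> cball x0 (r / 2)"
          have "dist (\<Psi> x) x0 \<le> dist (\<Psi> x) (\<Psi> x0) + dist (\<Psi> x0) x0" by (rule dist_triangle)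
          also have "dist (\<Psi> x) (\<Psi> x0) \<le> 1 / 2 * (r / 2)"
            using contr[OF x, of x0] x r by (simp add: dist_commute)
          also have "dist (\<Psi> x0) x0 \<le> b * (\<kappa> + \<kappa>)"
          proof -
            have "dist (\<Psi> x0) x0 = norm (B (F x0 t - y))" by (simp add: \<Psi>_def dist_norm)
            also have "\<dots> \<le> b * norm (F x0 t - y)" by (rule b(2))
            also have "\<dots> \<le> b * (\<kappa> + \<kappa>)"
              using b(1) tT(3)[OF t] y norm_triangle_ineq4[of "F x0 t" y] by (intro mult_left_mono) auto
            finally show ?thesis .
          qed
          also have "1 / 2 * (r / 2) + b * (\<kappa> + \<kappa>) = r / 2" using b(1) by (simp add: \<kappa>_def)
          finally show "\<Psi> x \<in> cball x0 (r / 2)" by (simp add: dist_commute)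
        qed
        show "cball x0 (r / 2) \<noteq> {}" using r by auto
      qed (use contr in \<open>auto intro: compact_imp_complete\<close>)
      then obtain x where x: "x \<in> cball x0 (r / 2)" "\<Psi> x = x" by blast
      then have "B (F x t - y) = 0" by (simp add: \<Psi>_def)
      then have "F x t - y = 0" using AB[of "F x t - y"] linear_0[OF A] by simp
      with x(1) sub have "x \<in> ball x0 r \<and> F x t = y" by auto
      then show "g y t \<in> ball x0 r \<and> F (g y t) t = y" unfolding g_def by (rule someI)
    }
  qed
  with a(1) show ?thesis by blast
qed

section \<open>The inverse of the chart and the Jacobian\<close>

context moving_chart begin

lemma F'_linear: "x \<in> ball x0 r \<Longrightarrow> t \<in> {a<..<b} \<Longrightarrow> linear (F' (x, t))"
  using has_derivative_linear[OF deriv] .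

lemma slice_deriv:
  "x \<in> ball x0 r \<Longrightarrow> t \<in> {a<..<b} \<Longrightarrow> ((\<lambda>z. F z t) has_derivative (\<lambda>h. F' (x, t) (h, 0))) (at x)"
  by (rule has_derivative_slice[OF deriv])

lemma continuous_on_F: "t \<in> {a<..<b} \<Longrightarrow> continuous_on (ball x0 r) (\<lambda>z. F z t)"
  by (intro continuous_at_imp_continuous_on ballI has_derivative_continuous[OF slice_deriv])

lemma time_lipschitz:
  assumes x: "x \<in> ball x0 r" and t: "t \<in> {a<..<b}" "t' \<in> {a<..<b}"
  shows "norm (F x t - F x t') \<le> K * \<bar>t - t'\<bar>"
proof -
  have "norm (F x t - F x t') \<le> K * norm (t - t')"
  proof (rule differentiable_bound[where S = "{a<..<b}" and f' = "\<lambda>t h. F' (x, t) (0, h)"])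
    fix s assume s: "s \<in> {a<..<b}"
    have "((\<lambda>s. (x, s)) has_derivative (\<lambda>h. (0, h))) (at s)"
      by (rule has_derivative_Pair[OF has_derivative_const has_derivative_ident])
    from has_derivative_compose[OF this deriv[OF x s]]
    have "((\<lambda>s. F x s) has_derivative (\<lambda>h. F' (x, s) (0, h))) (at s)" by simp
    then show "((\<lambda>s. F x s) has_derivative (\<lambda>h. F' (x, s) (0, h))) (at s within {a<..<b})"
      by (rule has_derivative_at_withinI)
    have "norm (F' (x, s) (0, h)) \<le> K * norm h" for h
      using F'_le[OF x s, of "(0, h)"] by (simp add: norm_Pair)
    then show "onorm (\<lambda>h. F' (x, s) (0, h)) \<le> K" by (rule onorm_le)
  qed (use t in auto)
  then show ?thesis by simp
qed

lemma g_unique: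
  assumes "x \<in> ball x0 r" "norm (F x t) < \<kappa>" "t \<in> {a<..<b}"
  shows "g (F x t) t = x"
proof -
  define z where "z = g (F x t) t"
  have z: "z \<in> ball x0 r" "F z t = F x t" using g[OF assms(2,3)] by (auto simp: z_def)
  have "norm (z - x) \<le> K * norm (F z t - F x t)" by (rule expand[OF z(1) assms(1,3)])
  then show ?thesis unfolding z(2) by (simp add: z_def)
qed

text \<open>\<open>expand\<close> compares the two points through values of \<open>F\<close> at one
  time; changing the time of the second value costs \<open>time_lipschitz\<close>.\<close>

lemma g_lipschitz:
  assumes "norm y < \<kappa>" "norm y' < \<kappa>" "t \<in> {a<..<b}" "t' \<in> {a<..<b}"
  shows "norm (g y t - g y' t') \<le> K * (norm (y - y') + K * \<bar>t - t'\<bar>)"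
proof -
  have "norm (g y t - g y' t') \<le> K * norm (F (g y t) t - F (g y' t') t)"
    using g assms by (intro expand) auto
  also have "F (g y t) t - F (g y' t') t = (y - y') + (F (g y' t') t' - F (g y' t') t)"
    using g assms by simp
  also have "norm \<dots> \<le> norm (y - y') + K * \<bar>t' - t\<bar>"
    using time_lipschitz[of "g y' t'" t' t] g[OF assms(2,4)] assms
    by (intro order_trans[OF norm_triangle_ineq] add_left_mono) auto
  finally show ?thesis using K by (simp add: abs_minus_commute)
qed

lemma continuous_on_g:
  "continuous_on (ball 0 \<kappa> \<times> {a<..<b}) (\<lambda>q. g (fst q) (snd q))"
proof (rule continuous_onI)
  fix q :: "(real^2) \<times> real" and e :: real assume q: "q \<in> ball 0 \<kappa> \<times> {a<..<b}" and e: "0 < e"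
  define d where "d = e / (2 * (K * (1 + K)))"
  have KK: "0 < K * (1 + K)" using K by simp
  have "d > 0" using e KK by (simp add: d_def)
  moreover have "dist (g (fst q') (snd q')) (g (fst q) (snd q)) \<le> e"
    if q': "q' \<in> ball 0 \<kappa> \<times> {a<..<b}" "dist q' q < d" for q'
  proof -
    have "norm (g (fst q') (snd q') - g (fst q) (snd q)) \<le> K * (norm (fst q' - fst q) + K * \<bar>snd q' - snd q\<bar>)"
      using q q' by (intro g_lipschitz) auto
    also have "\<dots> \<le> K * (dist q' q + K * dist q' q)"
      using K dist_fst_le[of q' q] dist_snd_le[of q' q] by (intro mult_left_mono add_mono) (auto simp: dist_norm)
    also have "\<dots> = K * (1 + K) * dist q' q" by (simp add: algebra_simps)
    also have "\<dots> \<le> K * (1 + K) * d" using KK q'(2) by (intro mult_left_mono) auto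
    also have "\<dots> = e / 2" using KK by (simp add: d_def field_simps)
    finally show ?thesis using e by (simp add: dist_norm)
  qed
  ultimately show "\<exists>d>0. \<forall>x'\<in>ball 0 \<kappa> \<times> {a<..<b}. dist x' q < d \<longrightarrow> dist (g (fst x') (snd x')) (g (fst q) (snd q)) \<le> e"
    by blast
qed

lemma ex_inverse_slice:
  assumes x: "x \<in> ball x0 r" and t: "t \<in> {a<..<b}"
  shows "\<exists>B. linear B \<and> (\<forall>h. B (F' (x, t) (h, 0)) = h) \<and> (\<forall>y. F' (x, t) (B y, 0) = y)"
proof -
  have "linear (\<lambda>h. F' (x, t) (h, 0))" by (rule has_derivative_linear[OF slice_deriv[OF x t]])
  moreover have "det (matrix (\<lambda>h. F' (x, t) (h, 0))) \<noteq> 0" using det_ge[OF x t] c by auto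
  ultimately show ?thesis using linear_det_inverse by blast
qed

text \<open>The inverse function rule is applied to the space-time map (x, t) -> (F x t, t), which
  makes \<open>g\<close> differentiable jointly in the target and in time.\<close>

lemma g_has_derivative:
  assumes y: "norm y < \<kappa>" and t: "t \<in> {a<..<b}"
  shows "\<exists>B. linear B \<and> (\<forall>v. F' (g y t, t) (B v, 0) = v) \<and>
    ((\<lambda>q. g (fst q) (snd q)) has_derivative (\<lambda>w. B (fst w - F' (g y t, t) (0, snd w)))) (at (y, t))"
proof -
  have gx: "g y t \<in> ball x0 r" "F (g y t) t = y" using g[OF y t] by auto
  obtain B where B: "linear B" "\<And>h. B (F' (g y t, t) (h, 0)) = h" "\<And>v. F' (g y t, t) (B v, 0) = v"
    using ex_inverse_slice[OF gx(1) t] by blast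
  define A where "A = F' (g y t, t)"
  have A: "linear A" unfolding A_def by (rule F'_linear[OF gx(1) t])
  define \<Phi> where "\<Phi> q = (F (fst q) (snd q), snd q)" for q
  define G where "G q = (g (fst q) (snd q), snd q)" for q
  define G' where "G' w = (B (fst w - A (0, snd w)), snd w)" for w
  have "linear (\<lambda>w. B (fst w - A (0, snd w)))"
  proof -
    have "linear (\<lambda>w. A (0, snd w))"
      using linear_compose[OF _ A, of "\<lambda>w. (0, snd w)"] by (simp add: o_def linear_iff)
    then have "linear (\<lambda>w. fst w - A (0, snd w))" by (intro linear_compose_sub) (auto simp: linear_iff)
    from linear_compose[OF this B(1)] show ?thesis by (simp add: o_def)
  qed
  then have "linear G'" unfolding G'_def by (simp add: linear_iff)
  have "(G has_derivative G') (at (y, t))"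
  proof (rule has_derivative_inverse_basic[where f = \<Phi> and f' = "\<lambda>w. (A w, snd w)" and T = "ball 0 \<kappa> \<times> {a<..<b}"])
    show "(\<Phi> has_derivative (\<lambda>w. (A w, snd w))) (at (G (y, t)))"
      unfolding \<Phi>_def G_def A_def fst_conv snd_conv
      by (intro has_derivative_Pair deriv gx t has_derivative_snd has_derivative_ident)
    show "bounded_linear G'" using \<open>linear G'\<close> by (simp add: linear_conv_bounded_linear)
    show "G' \<circ> (\<lambda>w. (A w, snd w)) = id"
    proof
      fix w :: "(real^2) \<times> real"
      have "A w - A (0, snd w) = A (fst w, 0)"
        by (simp only: linear_diff[OF A, symmetric]) (simp add: minus_prod_def)
      then show "(G' \<circ> (\<lambda>w. (A w, snd w))) w = id w"
        using B(2)[of "fst w"] by (simp add: G'_def A_def)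
    qed
    have "continuous_on (ball 0 \<kappa> \<times> {a<..<b}) G"
      unfolding G_def by (intro continuous_intros continuous_on_g)
    then show "continuous (at (y, t)) G"
      using y t by (subst (asm) continuous_on_eq_continuous_at) (auto intro: open_Times)
    show "open (ball (0 :: real^2) \<kappa> \<times> {a<..<b})" by (intro open_Times) auto
    show "(y, t) \<in> ball 0 \<kappa> \<times> {a<..<b}" using y t by auto
    fix z :: "(real^2) \<times> real" assume "z \<in> ball 0 \<kappa> \<times> {a<..<b}"
    then show "\<Phi> (G z) = z" using g by (auto simp: \<Phi>_def G_def)
  qed
  then have "((\<lambda>q. fst (G q)) has_derivative (\<lambda>w. fst (G' w))) (at (y, t))" by (rule has_derivative_fst)
  then show ?thesis using B(1,3) by (intro exI[of _ B]) (auto simp: G_def G'_def A_def)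
qed

definition J :: "real^2 \<Rightarrow> real \<Rightarrow> real" where
  "J x t = det (matrix (\<lambda>h. F' (x, t) (h, 0)))"

lemma component_le: "x \<in> ball x0 r \<Longrightarrow> t \<in> {a<..<b} \<Longrightarrow> \<bar>F' (x, t) w $ i\<bar> \<le> K * norm w"
  by (rule order_trans[OF component_le_norm_cart F'_le])

lemma component_lipschitz:
  assumes "x \<in> ball x0 r" "y \<in> ball x0 r" "t \<in> {a<..<b}"
  shows "\<bar>F' (x, t) w $ i - F' (y, t) w $ i\<bar> \<le> K * norm (x - y) * norm w"
  using component_le_norm_cart[of "F' (x, t) w - F' (y, t) w" i] F'_lip[OF assms, of w] by simp

lemma J_eq:
  "J x t = F' (x, t) (axis 1 1, 0) $ 1 * F' (x, t) (axis 2 1, 0) $ 2 - F' (x, t) (axis 2 1, 0) $ 1 * F' (x, t) (axis 1 1, 0) $ 2"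
  by (simp add: J_def det_2 matrix_def)

lemma J_ge: "x \<in> ball x0 r \<Longrightarrow> t \<in> {a<..<b} \<Longrightarrow> c \<le> \<bar>J x t\<bar>"
  unfolding J_def by (rule det_ge)

lemma J_le:
  assumes "x \<in> ball x0 r" "t \<in> {a<..<b}"
  shows "\<bar>J x t\<bar> \<le> 2 * K\<^sup>2"
proof -
  have e: "\<bar>F' (x, t) (axis j 1, 0) $ i\<bar> \<le> K" for i j :: 2
    using component_le[OF assms, of "(axis j 1, 0)" i] by (simp add: norm_Pair)
  have m: "\<bar>F' (x, t) (axis j 1, 0) $ i * F' (x, t) (axis j' 1, 0) $ i'\<bar> \<le> K * K" for i j i' j' :: 2
    unfolding abs_mult using K by (intro mult_mono e) auto
  show ?thesis unfolding J_eq power2_eq_square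
    using m[where i = 1 and j = 1 and i' = 2 and j' = 2] m[where i = 1 and j = 2 and i' = 2 and j' = 1]
    by linarith
qed

lemma J_lipschitz:
  assumes "x \<in> ball x0 r" "y \<in> ball x0 r" "t \<in> {a<..<b}"
  shows "\<bar>J x t - J y t\<bar> \<le> 4 * K\<^sup>2 * norm (x - y)"
proof -
  define m where "m z i j = F' (z, t) (axis j 1, 0) $ i" for z and i j :: 2
  have e: "\<bar>m z i j\<bar> \<le> K" if "z \<in> ball x0 r" for z i j
    using component_le[OF that assms(3), of "(axis j 1, 0)" i] by (simp add: norm_Pair m_def)
  have d: "\<bar>m x i j - m y i j\<bar> \<le> K * norm (x - y)" for i j
    using component_lipschitz[OF assms, of "(axis j 1, 0)" i] by (simp add: norm_Pair m_def)
  have p: "\<bar>m x i j * m x i' j' - m y i j * m y i' j'\<bar> \<le> 2 * (K\<^sup>2 * norm (x - y))" for i j i' j'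
  proof -
    have "m x i j * m x i' j' - m y i j * m y i' j' = m x i j * (m x i' j' - m y i' j') + (m x i j - m y i j) * m y i' j'"
      by (simp add: algebra_simps)
    also have "\<bar>\<dots>\<bar> \<le> \<bar>m x i j\<bar> * \<bar>m x i' j' - m y i' j'\<bar> + \<bar>m x i j - m y i j\<bar> * \<bar>m y i' j'\<bar>"
      by (metis abs_mult abs_triangle_ineq)
    also have "\<dots> \<le> K * (K * norm (x - y)) + (K * norm (x - y)) * K"
      using K assms by (intro add_mono mult_mono e d) auto
    finally show ?thesis by (simp add: power2_eq_square algebra_simps)
  qed
  have "J x t - J y t = (m x 1 1 * m x 2 2 - m y 1 1 * m y 2 2) - (m x 1 2 * m x 2 1 - m y 1 2 * m y 2 1)"
    by (simp add: J_eq m_def)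
  then show ?thesis using p[of 1 1 2 2] p[of 1 2 2 1] by linarith
qed

end

section \<open>The saddle in the chart\<close>

text \<open>The solution y of \<beta> y_1 + y_2 = p, \<delta> y_1 - y_2 = q for the argument (p, q,
  t). The determinant of this system is - (\<beta> + \<delta>), hence the division by the opening
  angle.\<close>

definition saddle_point :: "(real \<Rightarrow> real) \<Rightarrow> (real \<Rightarrow> real) \<Rightarrow> real \<times> real \<times> real \<Rightarrow> real^2" where
  "saddle_point \<beta> \<delta> v = (\<chi> i. if i = 1 then (fst v + fst (snd v)) / (\<beta> (snd (snd v)) + \<delta> (snd (snd v)))
     else (\<delta> (snd (snd v)) * fst v - \<beta> (snd (snd v)) * fst (snd v)) / (\<beta> (snd (snd v)) + \<delta> (snd (snd v))))"

text \<open>\<open>\<theta>'\<close> is the derivative of \<theta> jointly in space and time, so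
  \<open>pde\<close> states that the material derivative vanishes. Constancy is phrased for
  connected subsets of level sets, the form needed for arcs of hyperbolas.\<close>

locale qg_saddle = moving_chart U F x0 r a b K c \<kappa> F' g
  for U F x0 r a b K c \<kappa> F' g +
  fixes \<beta> \<delta> \<beta>' \<delta>' :: "real \<Rightarrow> real" and \<theta> :: "real^2 \<Rightarrow> real \<Rightarrow> real"
    and \<theta>' :: "(real^2) \<times> real \<Rightarrow> (real^2) \<times> real \<Rightarrow> real" and u :: "real^2 \<Rightarrow> real \<Rightarrow> real^2" and C :: real
  assumes \<beta>_deriv: "t \<in> {a<..<b} \<Longrightarrow> (\<beta> has_real_derivative \<beta>' t) (at t)"
    and \<delta>_deriv: "t \<in> {a<..<b} \<Longrightarrow> (\<delta> has_real_derivative \<delta>' t) (at t)"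
    and \<beta>_le: "t \<in> {a<..<b} \<Longrightarrow> \<bar>\<beta> t\<bar> \<le> C"
    and \<delta>_le: "t \<in> {a<..<b} \<Longrightarrow> \<bar>\<delta> t\<bar> \<le> C"
    and \<gamma>_pos: "t \<in> {a<..<b} \<Longrightarrow> 0 < \<beta> t + \<delta> t"
    and \<theta>_deriv: "t \<in> {a<..<b} \<Longrightarrow> ((\<lambda>q. \<theta> (fst q) (snd q)) has_derivative \<theta>' (x, t)) (at (x, t))"
    and pde: "t \<in> {a<..<b} \<Longrightarrow> \<theta>' (x, t) (u x t, 1) = 0"
    and u_cont: "t \<in> {a<..<b} \<Longrightarrow> continuous_on (ball x0 r) (\<lambda>x. u x t)"
    and \<theta>_const: "t \<in> {a<..<b} \<Longrightarrow> connected \<Gamma> \<Longrightarrow> \<Gamma> \<subseteq> {x \<in> U. saddle_rho \<beta> \<delta> F x t = k} \<Longrightarrow>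
      x \<in> \<Gamma> \<Longrightarrow> y \<in> \<Gamma> \<Longrightarrow> \<theta> x t = \<theta> y t"
    and \<theta>_nonconst: "t \<in> {a<..<b} \<Longrightarrow> 0 < s \<Longrightarrow> ball z s \<subseteq> U \<Longrightarrow> \<exists>x\<in>ball z s. \<exists>y\<in>ball z s. \<theta> x t \<noteq> \<theta> y t"
begin

abbreviation "Y \<equiv> saddle_point \<beta> \<delta>"

text \<open>In the sector with nonnegative factors p, q the first chart coordinate is (p + q) /
  \<gamma> and the second is at most C times it. Bounding the first by \<kappa>1 keeps the point in
  the disc of radius \<kappa>; this size does not shrink with \<gamma>.\<close>

definition "\<kappa>1 = \<kappa> / (1 + C)"

lemma C_nonneg: "0 \<le> C"
  using \<beta>_le[of "(a + b) / 2"] ab by (auto intro: order_trans[OF abs_ge_zero])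

lemma \<kappa>1_pos: "0 < \<kappa>1"
  using \<kappa> C_nonneg by (simp add: \<kappa>1_def)

lemma Y_factors:
  assumes "t \<in> {a<..<b}"
  shows "\<beta> t * Y (p, q, t) $ 1 + Y (p, q, t) $ 2 = p" "\<delta> t * Y (p, q, t) $ 1 - Y (p, q, t) $ 2 = q"
  using \<gamma>_pos[OF assms] by (simp_all add: saddle_point_def divide_simps) (simp_all add: algebra_simps)

lemma Y_of_factors:
  assumes "t \<in> {a<..<b}"
  shows "Y (\<beta> t * y $ 1 + y $ 2, \<delta> t * y $ 1 - y $ 2, t) = y"
proof -
  have "Y (\<beta> t * y $ 1 + y $ 2, \<delta> t * y $ 1 - y $ 2, t) $ i = y $ i" for i
    using \<gamma>_pos[OF assms] exhaust_2[of i] by (auto simp: saddle_point_def divide_simps) (simp_all add: algebra_simps)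
  then show ?thesis by (simp add: vec_eq_iff)
qed

lemma Y_norm:
  assumes t: "t \<in> {a<..<b}" and pq: "0 \<le> p" "0 \<le> q" "p + q < \<kappa>1 * (\<beta> t + \<delta> t)"
  shows "norm (Y (p, q, t)) < \<kappa>"
proof -
  define \<gamma> where "\<gamma> = \<beta> t + \<delta> t"
  have \<gamma>: "\<gamma> > 0" using \<gamma>_pos[OF t] by (simp add: \<gamma>_def)
  define s where "s = (p + q) / \<gamma>"
  have s: "0 \<le> s" "s < \<kappa>1" using pq \<gamma> by (auto simp: s_def \<gamma>_def[symmetric] divide_less_eq)
  have "Y (p, q, t) $ 1 = s" by (simp add: saddle_point_def s_def \<gamma>_def)
  then have 1: "\<bar>Y (p, q, t) $ 1\<bar> = s" using s(1) by simp
  have "\<bar>\<delta> t * p - \<beta> t * q\<bar> \<le> \<bar>\<delta> t\<bar> * p + \<bar>\<beta> t\<bar> * q"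
    using abs_triangle_ineq4[of "\<delta> t * p" "\<beta> t * q"] pq by (simp add: abs_mult)
  also have "\<dots> \<le> C * p + C * q" using \<beta>_le[OF t] \<delta>_le[OF t] pq by (intro add_mono mult_right_mono) auto
  finally have "\<bar>\<delta> t * p - \<beta> t * q\<bar> / \<gamma> \<le> C * (p + q) / \<gamma>" using \<gamma> by (intro divide_right_mono) (auto simp: distrib_left)
  then have 2: "\<bar>Y (p, q, t) $ 2\<bar> \<le> C * s" using \<gamma> by (simp add: saddle_point_def s_def \<gamma>_def[symmetric] abs_divide)
  have "norm (Y (p, q, t)) \<le> \<bar>Y (p, q, t) $ 1\<bar> + \<bar>Y (p, q, t) $ 2\<bar>"
    using norm_le_l1_cart[of "Y (p, q, t)"] by (simp add: sum_2)
  also have "\<dots> \<le> (1 + C) * s" using 1 2 by (simp add: algebra_simps)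
  also have "\<dots> < (1 + C) * \<kappa>1" using s C_nonneg by (intro mult_strict_left_mono) auto
  also have "\<dots> = \<kappa>" using C_nonneg by (simp add: \<kappa>1_def)
  finally show ?thesis .
qed

lemma Y_differentiable:
  assumes t: "t \<in> {a<..<b}"
  shows "Y differentiable (at (p, q, t))"
proof -
  have f: "(\<lambda>v::real\<times>real\<times>real. fst v) differentiable (at (p, q, t))"
    "(\<lambda>v::real\<times>real\<times>real. fst (snd v)) differentiable (at (p, q, t))"
    "(\<lambda>v::real\<times>real\<times>real. snd (snd v)) differentiable (at (p, q, t))"
    by (rule differentiableI[OF has_derivative_fst[OF has_derivative_ident]]
        differentiableI[OF has_derivative_fst[OF has_derivative_snd[OF has_derivative_ident]]]
        differentiableI[OF has_derivative_snd[OF has_derivative_snd[OF has_derivative_ident]]])+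
  have b: "\<beta> differentiable (at (snd (snd (p, q, t))))" "\<delta> differentiable (at (snd (snd (p, q, t))))"
    using \<beta>_deriv[OF t] \<delta>_deriv[OF t] unfolding differentiable_def has_field_derivative_def by auto
  have bc: "(\<lambda>v::real\<times>real\<times>real. \<beta> (snd (snd v))) differentiable (at (p, q, t))"
    "(\<lambda>v::real\<times>real\<times>real. \<delta> (snd (snd v))) differentiable (at (p, q, t))"
    by (rule differentiable_compose[OF b(1) f(3)], rule differentiable_compose[OF b(2) f(3)])
  have n: "\<beta> (snd (snd (p, q, t))) + \<delta> (snd (snd (p, q, t))) \<noteq> 0" using \<gamma>_pos[OF t] by simp
  have "(\<lambda>v. Y v $ 1) differentiable (at (p, q, t))" "(\<lambda>v. Y v $ 2) differentiable (at (p, q, t))"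
    unfolding saddle_point_def using n
    by (auto intro!: differentiable_divide differentiable_add differentiable_diff differentiable_mult f bc)
  then obtain D1 D2 where D: "((\<lambda>v. Y v $ 1) has_derivative D1) (at (p, q, t))" "((\<lambda>v. Y v $ 2) has_derivative D2) (at (p, q, t))"
    unfolding differentiable_def by blast
  have "(Y has_derivative (\<lambda>h. \<chi> i. if i = 1 then D1 h else D2 h)) (at (p, q, t))"
  proof (rule has_derivative_vec2)
    fix i :: 2
    show "((\<lambda>x. Y x $ i) has_derivative (\<lambda>h. (\<chi> i. if i = 1 then D1 h else D2 h) $ i)) (at (p, q, t))"
      using exhaust_2[of i] D by auto
  qed
  then show ?thesis unfolding differentiable_def by blast
qed

definition H :: "real \<times> real \<times> real \<Rightarrow> real" where
  "H v = \<theta> (g (Y v) (snd (snd v))) (snd (snd v))"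

lemma H_differentiable:
  assumes t: "t \<in> {a<..<b}" and Y: "norm (Y (p, q, t)) < \<kappa>"
  shows "H differentiable (at (p, q, t))"
proof -
  define S where "S v = (Y v, snd (snd v))" for v
  define G where "G w = (g (fst w) (snd w), snd w)" for w
  obtain DY where "(Y has_derivative DY) (at (p, q, t))"
    using Y_differentiable[OF t] unfolding differentiable_def by blast
  then have dS: "S differentiable (at (p, q, t))"
    unfolding S_def
    by (rule differentiableI[OF has_derivative_Pair[OF _ has_derivative_snd[OF has_derivative_snd[OF has_derivative_ident]]]])
  obtain Dg where "((\<lambda>w. g (fst w) (snd w)) has_derivative Dg) (at (S (p, q, t)))"
    using g_has_derivative[OF Y t] by (auto simp: S_def)
  then have dG: "G differentiable (at (S (p, q, t)))"
    unfolding G_def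
    by (rule differentiableI[OF has_derivative_Pair[OF _ has_derivative_snd[OF has_derivative_ident]]])
  have GS: "(\<lambda>v. G (S v)) differentiable (at (p, q, t))"
    by (rule differentiable_compose[OF dG dS])
  have "(\<lambda>q. \<theta> (fst q) (snd q)) differentiable (at (G (S (p, q, t))))"
    using \<theta>_deriv[OF t] unfolding differentiable_def by (auto simp: G_def S_def)
  from differentiable_compose[OF this GS] show ?thesis
    by (simp add: H_def[abs_def] G_def S_def)
qed

text \<open>
  The first two components of \<open>W\<close> are the factors of \<open>\<rho>\<close>; \<open>saddle_point\<close> recovers \<open>F\<close> from them.
\<close>

definition W :: "(real^2) \<times> real \<Rightarrow> real \<times> real \<times> real" where
  "W q = (\<beta> (snd q) * F (fst q) (snd q) $ 1 + F (fst q) (snd q) $ 2,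
          \<delta> (snd q) * F (fst q) (snd q) $ 1 - F (fst q) (snd q) $ 2, snd q)"

text \<open>\<open>A'\<close> and \<open>B'\<close> are the derivatives of the first two components
  of \<open>W\<close>; in the direction (u, 1) they are the material derivatives of the factors of
  \<rho>.\<close>

definition A' :: "real^2 \<Rightarrow> real \<Rightarrow> (real^2) \<times> real \<Rightarrow> real" where
  "A' x t w = \<beta>' t * snd w * F x t $ 1 + \<beta> t * F' (x, t) w $ 1 + F' (x, t) w $ 2"

definition B' :: "real^2 \<Rightarrow> real \<Rightarrow> (real^2) \<times> real \<Rightarrow> real" where
  "B' x t w = \<delta>' t * snd w * F x t $ 1 + \<delta> t * F' (x, t) w $ 1 - F' (x, t) w $ 2"

lemma W_has_derivative:
  assumes x: "x \<in> ball x0 r" and t: "t \<in> {a<..<b}"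
  shows "(W has_derivative (\<lambda>w. (A' x t w, B' x t w, snd w))) (at (x, t))"
proof -
  have Fi: "((\<lambda>q. F (fst q) (snd q) $ i) has_derivative (\<lambda>w. F' (x, t) w $ i)) (at (x, t))" for i
    by (rule bounded_linear.has_derivative[OF bounded_linear_vec_nth deriv[OF x t]])
  have s: "((\<lambda>q. snd q) has_derivative snd) (at (x, t))" by (rule has_derivative_snd[OF has_derivative_ident])
  have "(\<beta> has_derivative (\<lambda>h. \<beta>' t * h)) (at (snd (x, t)))" "(\<delta> has_derivative (\<lambda>h. \<delta>' t * h)) (at (snd (x, t)))"
    using \<beta>_deriv[OF t] \<delta>_deriv[OF t] by (simp_all add: has_field_derivative_def)
  note bd = has_derivative_compose[OF s this(1)] has_derivative_compose[OF s this(2)]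
  have "((\<lambda>q. \<beta> (snd q) * F (fst q) (snd q) $ 1 + F (fst q) (snd q) $ 2) has_derivative A' x t) (at (x, t))"
    by (rule has_derivative_eq_rhs[OF has_derivative_add[OF has_derivative_mult[OF bd(1) Fi] Fi]])
      (simp add: fun_eq_iff A'_def)
  moreover have "((\<lambda>q. \<delta> (snd q) * F (fst q) (snd q) $ 1 - F (fst q) (snd q) $ 2) has_derivative B' x t) (at (x, t))"
    by (rule has_derivative_eq_rhs[OF has_derivative_diff[OF has_derivative_mult[OF bd(2) Fi] Fi]])
      (simp add: fun_eq_iff B'_def)
  ultimately show ?thesis
    unfolding W_def by (rule has_derivative_Pair[OF _ has_derivative_Pair[OF _ s]])
qed

lemma \<theta>_eq_H_W:
  assumes "x \<in> ball x0 r" "t \<in> {a<..<b}" "norm (F x t) < \<kappa>"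
  shows "Y (W (x, t)) = F x t" "H (W (x, t)) = \<theta> x t"
proof -
  show Y: "Y (W (x, t)) = F x t" by (simp only: W_def fst_conv snd_conv Y_of_factors[OF assms(2)])
  have "snd (snd (W (x, t))) = t" by (simp add: W_def)
  then show "H (W (x, t)) = \<theta> x t" by (simp only: H_def Y g_unique[OF assms(1,3,2)])
qed

text \<open>Near (x, t) the function \<theta> is \<open>H\<close> composed with \<open>W\<close>,
  because \<open>g\<close> inverts \<open>F\<close> wherever the norm of \<open>F\<close> is below
  \<kappa>; the derivative is unique.\<close>

lemma \<theta>_chain:
  assumes x: "x \<in> ball x0 r" and t: "t \<in> {a<..<b}" and \<kappa>: "norm (F x t) < \<kappa>"
  shows "\<theta>' (x, t) w = frechet_derivative H (at (W (x, t))) (A' x t w, B' x t w, snd w)"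
proof -
  have v: "W (x, t) = (fst (W (x, t)), fst (snd (W (x, t))), t)" by (simp add: W_def)
  have "H differentiable (at (W (x, t)))"
  proof (rule H_differentiable[OF t, of "fst (W (x, t))" "fst (snd (W (x, t)))", folded v])
    show "norm (Y (W (x, t))) < \<kappa>" unfolding \<theta>_eq_H_W(1)[OF x t \<kappa>] by (rule \<kappa>)
  qed
  then have "(H has_derivative frechet_derivative H (at (W (x, t)))) (at (W (x, t)))"
    by (simp only: frechet_derivative_works)
  from has_derivative_compose[OF W_has_derivative[OF x t] this]
  have d: "((\<lambda>q. H (W q)) has_derivative (\<lambda>w. frechet_derivative H (at (W (x, t))) (A' x t w, B' x t w, snd w))) (at (x, t))" .
  define N where "N = {q \<in> ball x0 r \<times> {a<..<b}. norm (F (fst q) (snd q)) < \<kappa>}"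
  have "open N"
  proof -
    have "continuous_on (ball x0 r \<times> {a<..<b}) (\<lambda>q. F (fst q) (snd q))"
    proof (intro continuous_at_imp_continuous_on ballI)
      fix q assume "q \<in> ball x0 r \<times> {a<..<b}"
      then obtain z s where q: "q = (z, s)" "z \<in> ball x0 r" "s \<in> {a<..<b}" by blast
      from has_derivative_continuous[OF deriv[OF q(2,3)]]
      show "continuous (at q) (\<lambda>q. F (fst q) (snd q))" by (simp only: q(1))
    qed
    then have "continuous_on (ball x0 r \<times> {a<..<b}) (\<lambda>q. norm (F (fst q) (snd q)))" by (rule continuous_on_norm)
    moreover have "open (ball x0 r \<times> {a<..<b})" by (intro open_Times) auto
    moreover have "N = (ball x0 r \<times> {a<..<b}) \<inter> (\<lambda>q. norm (F (fst q) (snd q))) -` {..<\<kappa>}" by (auto simp: N_def)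
    ultimately show ?thesis by (simp only: continuous_open_preimage open_lessThan)
  qed
  moreover have "(x, t) \<in> N" using x t \<kappa> by (auto simp: N_def)
  ultimately have "((\<lambda>q. \<theta> (fst q) (snd q)) has_derivative (\<lambda>w. frechet_derivative H (at (W (x, t))) (A' x t w, B' x t w, snd w))) (at (x, t))"
    using \<theta>_eq_H_W(2) by (intro has_derivative_transform_within_open[OF d]) (auto simp: N_def)
  from fun_cong[OF has_derivative_unique[OF this \<theta>_deriv[OF t]], of w] show ?thesis by (rule sym)
qed

text \<open>The point of the plane with prescribed factors at a given time, the inverse of
  \<open>W\<close> on the closed sector including its two separatrices.\<close>

definition X :: "real \<times> real \<times> real \<Rightarrow> real^2" where
  "X v = g (Y v) (snd (snd v))"

lemma X_props:
  assumes t: "t \<in> {a<..<b}" and pq: "0 \<le> p" "0 \<le> q" "p + q < \<kappa>1 * (\<beta> t + \<delta> t)"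
  shows "X (p, q, t) \<in> ball x0 r" "F (X (p, q, t)) t = Y (p, q, t)" "W (X (p, q, t), t) = (p, q, t)"
    "norm (F (X (p, q, t)) t) < \<kappa>"
proof -
  have n: "norm (Y (p, q, t)) < \<kappa>" by (rule Y_norm[OF assms])
  show 1: "X (p, q, t) \<in> ball x0 r" "F (X (p, q, t)) t = Y (p, q, t)" using g[OF n t] by (auto simp: X_def)
  show "W (X (p, q, t), t) = (p, q, t)" using Y_factors[OF t, of p q] by (simp add: W_def 1)
  show "norm (F (X (p, q, t)) t) < \<kappa>" using n 1 by simp
qed

lemma continuous_on_X:
  assumes t: "t \<in> {a<..<b}"
  shows "continuous_on {p. 0 \<le> fst p \<and> 0 \<le> snd p \<and> fst p + snd p < \<kappa>1 * (\<beta> t + \<delta> t)} (\<lambda>p. X (fst p, snd p, t))"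
proof -
  have cY: "continuous_on S (\<lambda>p::real\<times>real. Y (fst p, snd p, t))" for S
    unfolding saddle_point_def
  proof (intro continuous_on_vec_lambda)
    fix i :: 2
    show "continuous_on S (\<lambda>p::real\<times>real. if i = 1 then (fst (fst p, snd p, t) + fst (snd (fst p, snd p, t))) / (\<beta> (snd (snd (fst p, snd p, t))) + \<delta> (snd (snd (fst p, snd p, t))))
     else (\<delta> (snd (snd (fst p, snd p, t))) * fst (fst p, snd p, t) - \<beta> (snd (snd (fst p, snd p, t))) * fst (snd (fst p, snd p, t))) / (\<beta> (snd (snd (fst p, snd p, t))) + \<delta> (snd (snd (fst p, snd p, t)))))"
      using \<gamma>_pos[OF t] by (cases "i = 1") (auto intro!: continuous_intros)
  qed
  show ?thesis
    unfolding X_def fst_conv snd_conv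
  proof (rule continuous_on_compose2[OF continuous_on_g, where f = "\<lambda>p. (Y (fst p, snd p, t), t)", unfolded fst_conv snd_conv])
    show "continuous_on {p. 0 \<le> fst p \<and> 0 \<le> snd p \<and> fst p + snd p < \<kappa>1 * (\<beta> t + \<delta> t)} (\<lambda>p. (Y (fst p, snd p, t), t))"
      by (intro continuous_intros cY)
    show "(\<lambda>p. (Y (fst p, snd p, t), t)) ` {p. 0 \<le> fst p \<and> 0 \<le> snd p \<and> fst p + snd p < \<kappa>1 * (\<beta> t + \<delta> t)} \<subseteq> ball 0 \<kappa> \<times> {a<..<b}"
      using Y_norm[OF t] t by auto
  qed
qed

text \<open>The arc \<mu> -> (\<mu> p, q / \<mu>) joins the two points within one hyperbola, and its
  image under \<open>X\<close> is connected. \<open>\<theta>_const\<close> applies as soon as the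
  arc is known to stay in the sector.\<close>

lemma H_invariant_ge_1:
  assumes t: "t \<in> {a<..<b}" and pq: "0 < p" "0 < q" "p + q < \<kappa>1 * (\<beta> t + \<delta> t)"
    and l: "1 \<le> l" "l * p + q / l < \<kappa>1 * (\<beta> t + \<delta> t)"
  shows "H (l * p, q / l, t) = H (p, q, t)"
proof -
  define T where "T = {p. 0 \<le> fst p \<and> 0 \<le> snd p \<and> fst p + snd p < \<kappa>1 * (\<beta> t + \<delta> t)}"
  have in_T: "(\<mu> * p, q / \<mu>) \<in> T" if \<mu>: "\<mu> \<in> {1..l}" for \<mu>
  proof -
    have \<mu>0: "0 < \<mu>" "\<mu> \<le> l" "1 \<le> \<mu>" using \<mu> by auto
    have "\<mu> * p + q / \<mu> < \<kappa>1 * (\<beta> t + \<delta> t)"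
    \<comment> \<open>The function \<mu> p + q / \<mu> is convex, so it is below its value at one
      endpoint: at 1 in the first case, at l in the second.\<close>
    proof (cases "p \<le> q / \<mu>")
      case True
      have "p + q - (\<mu> * p + q / \<mu>) = (\<mu> - 1) * (q / \<mu> - p)" using \<mu>0 by (simp add: field_simps)
      also have "\<dots> \<ge> 0" using True \<mu>0 by (intro mult_nonneg_nonneg) auto
      finally show ?thesis using pq by linarith
    next
      case False
      have "q / (l * \<mu>) \<le> q / \<mu>" using \<mu>0 l pq by (intro divide_left_mono) (auto intro: mult_pos_pos)
      then have "0 \<le> (l - \<mu>) * (p - q / (l * \<mu>))" using False \<mu>0 by (intro mult_nonneg_nonneg) auto
      also have "(l - \<mu>) * (p - q / (l * \<mu>)) = l * p + q / l - (\<mu> * p + q / \<mu>)" using \<mu>0 l by (simp add: field_simps)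
      finally show ?thesis using l by linarith
    qed
    then show ?thesis using \<mu>0 pq by (simp add: T_def)
  qed
  define \<Gamma> where "\<Gamma> = (\<lambda>\<mu>. X (\<mu> * p, q / \<mu>, t)) ` {1..l}"
  have "connected \<Gamma>"
    unfolding \<Gamma>_def
  proof (rule connected_continuous_image)
    show "continuous_on {1..l} (\<lambda>\<mu>. X (\<mu> * p, q / \<mu>, t))"
      by (rule continuous_on_compose2[OF continuous_on_X[OF t], where f = "\<lambda>\<mu>. (\<mu> * p, q / \<mu>)", unfolded fst_conv snd_conv])
        (use in_T in \<open>auto intro!: continuous_intros simp: T_def\<close>)
  qed simp
  moreover have "\<Gamma> \<subseteq> {x \<in> U. saddle_rho \<beta> \<delta> F x t = p * q}"
  proof
    fix x assume "x \<in> \<Gamma>"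
    then obtain \<mu> where \<mu>: "\<mu> \<in> {1..l}" "x = X (\<mu> * p, q / \<mu>, t)" by (auto simp: \<Gamma>_def)
    have T: "0 \<le> \<mu> * p" "0 \<le> q / \<mu>" "\<mu> * p + q / \<mu> < \<kappa>1 * (\<beta> t + \<delta> t)" using in_T[OF \<mu>(1)] by (auto simp: T_def)
    have "saddle_rho \<beta> \<delta> F x t = (\<mu> * p) * (q / \<mu>)"
      using X_props(3)[OF t T] by (simp add: \<mu>(2) saddle_rho_def W_def mult.commute)
    also have "\<dots> = p * q" using \<mu>(1) by simp
    finally show "x \<in> {x \<in> U. saddle_rho \<beta> \<delta> F x t = p * q}" using X_props(1)[OF t T] ball_U \<mu>(2) by auto
  qed
  moreover have "X (l * p, q / l, t) \<in> \<Gamma>" using l by (auto simp: \<Gamma>_def)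
  moreover have "X (p, q, t) \<in> \<Gamma>" unfolding \<Gamma>_def using l by (intro image_eqI[of _ _ 1]) auto
  ultimately have "\<theta> (X (l * p, q / l, t)) t = \<theta> (X (p, q, t)) t" by (rule \<theta>_const[OF t])
  then show ?thesis by (simp add: H_def X_def)
qed

lemma H_invariant:
  assumes t: "t \<in> {a<..<b}" and pq: "0 < p" "0 < q" "p + q < \<kappa>1 * (\<beta> t + \<delta> t)"
    and l: "0 < l" "l * p + q / l < \<kappa>1 * (\<beta> t + \<delta> t)"
  shows "H (l * p, q / l, t) = H (p, q, t)"
proof (cases "1 \<le> l")
  case True
  then show ?thesis using assms by (intro H_invariant_ge_1)
next
  case False
  have "H ((1 / l) * (l * p), (q / l) / (1 / l), t) = H (l * p, q / l, t)"
    using assms False by (intro H_invariant_ge_1) auto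
  then show ?thesis using l by simp
qed

end

section \<open>Motion of the separatrices with the flow\<close>

context qg_saddle begin

text \<open>Both the base point and the argument of \<open>F'\<close> vary: \<open>F'_lip\<close>
  controls the former, linearity with \<open>F'_le\<close> the latter.\<close>

lemma continuous_on_F'_u:
  assumes t: "t \<in> {a<..<b}"
  shows "continuous_on (ball x0 r) (\<lambda>x. F' (x, t) (u x t, 1))"
  unfolding continuous_on_def
proof
  fix x assume x: "x \<in> ball x0 r"
  define w where "w y = (u y t, 1::real)" for y
  have "continuous_on (ball x0 r) w" unfolding w_def by (intro continuous_intros u_cont t)
  then have w: "(w \<longlongrightarrow> w x) (at x within ball x0 r)" using x by (simp add: continuous_on_def)
  have "((\<lambda>y. F' (y, t) (w y) - F' (x, t) (w x)) \<longlongrightarrow> 0) (at x within ball x0 r)"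
  proof (rule Lim_null_comparison)
    show "\<forall>\<^sub>F y in at x within ball x0 r. norm (F' (y, t) (w y) - F' (x, t) (w x)) \<le> K * norm (y - x) * norm (w y) + K * norm (w y - w x)"
    proof (rule eventually_at_ball'[THEN eventually_mono])
      show "0 < r" by (rule r)
    next
      fix y assume "y \<in> ball x r \<and> y \<noteq> x \<and> y \<in> ball x0 r"
      then have y: "y \<in> ball x0 r" by blast
      have "F' (y, t) (w y) - F' (x, t) (w x) = (F' (y, t) (w y) - F' (x, t) (w y)) + F' (x, t) (w y - w x)"
        by (simp add: linear_diff[OF F'_linear[OF x t]])
      then have "norm (F' (y, t) (w y) - F' (x, t) (w x)) \<le> norm (F' (y, t) (w y) - F' (x, t) (w y)) + norm (F' (x, t) (w y - w x))"
        by (simp only: norm_triangle_ineq)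
      also have "\<dots> \<le> K * norm (y - x) * norm (w y) + K * norm (w y - w x)"
        by (intro add_mono F'_lip F'_le x y t)
      finally show "norm (F' (y, t) (w y) - F' (x, t) (w x)) \<le> K * norm (y - x) * norm (w y) + K * norm (w y - w x)" .
    qed
    have "((\<lambda>y. K * norm (y - x) * norm (w y) + K * norm (w y - w x)) \<longlongrightarrow> K * norm (x - x) * norm (w x) + K * norm (w x - w x)) (at x within ball x0 r)"
      by (intro tendsto_intros w)
    then show "((\<lambda>y. K * norm (y - x) * norm (w y) + K * norm (w y - w x)) \<longlongrightarrow> 0) (at x within ball x0 r)" by simp
  qed
  then show "((\<lambda>x. F' (x, t) (u x t, 1)) \<longlongrightarrow> F' (x, t) (u x t, 1)) (at x within ball x0 r)"
    unfolding w_def by (simp only: LIM_zero_iff)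
qed

lemma H_deriv_split:
  assumes "(H has_derivative L) (at v)"
  shows "L w = fst w * L (1, 0, 0) + fst (snd w) * L (0, 1, 0) + snd (snd w) * L (0, 0, 1)"
proof -
  have L: "linear L" by (rule has_derivative_linear[OF assms])
  have "w = fst w *\<^sub>R (1, 0, 0) + fst (snd w) *\<^sub>R (0, 1, 0) + snd (snd w) *\<^sub>R (0, 0, 1)"
    by (simp add: prod_eq_iff)
  then have "L w = L (fst w *\<^sub>R (1, 0, 0) + fst (snd w) *\<^sub>R (0, 1, 0) + snd (snd w) *\<^sub>R (0, 0, 1))" by (rule arg_cong)
  also have "\<dots> = fst w * L (1, 0, 0) + fst (snd w) * L (0, 1, 0) + snd (snd w) * L (0, 0, 1)"
    by (simp only: linear_add[OF L] linear_scale[OF L] real_scaleR_def)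
  finally show ?thesis .
qed

text \<open>An instance of \<open>hyperbolic_transport\<close> at one fixed time, with \<kappa>1
  \<gamma> as the size of the sector: \<open>B'_axis\<close> and \<open>A'_axis\<close>, read at the
  points \<open>X (p, 0, t)\<close> and \<open>X (0, p, t)\<close>.\<close>

lemma
  assumes t: "t \<in> {a<..<b}"
  shows B'_separatrix: "0 < p \<Longrightarrow> p < \<kappa>1 * (\<beta> t + \<delta> t) \<Longrightarrow> B' (X (p, 0, t)) t (u (X (p, 0, t)) t, 1) = 0"
    and A'_separatrix: "0 < p \<Longrightarrow> p < \<kappa>1 * (\<beta> t + \<delta> t) \<Longrightarrow> A' (X (0, p, t)) t (u (X (0, p, t)) t, 1) = 0"
proof -
  define \<rho> where "\<rho> = \<kappa>1 * (\<beta> t + \<delta> t)"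
  have \<rho>: "\<rho> > 0" using \<gamma>_pos[OF t] \<kappa>1_pos by (simp add: \<rho>_def)
  define R where "R p q \<longleftrightarrow> 0 < p \<and> 0 < q \<and> p + q < \<rho>" for p q
  have R: "0 \<le> p" "0 \<le> q" "p + q < \<kappa>1 * (\<beta> t + \<delta> t)" if "R p q" for p q using that by (auto simp: R_def \<rho>_def)
  define L where "L p q = frechet_derivative H (at (p, q, t))" for p q
  define Ai where "Ai p q = A' (X (p, q, t)) t (u (X (p, q, t)) t, 1)" for p q
  define Bi where "Bi p q = B' (X (p, q, t)) t (u (X (p, q, t)) t, 1)" for p q
  have HL: "(H has_derivative L p q) (at (p, q, t))" if "R p q" for p q
    using H_differentiable[OF t Y_norm[OF t R[OF that]]] unfolding L_def by (simp only: frechet_derivative_works)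
  interpret hyperbolic_transport H "\<lambda>p q. L p q (1, 0, 0)" "\<lambda>p q. L p q (0, 1, 0)" "\<lambda>p q. L p q (0, 0, 1)" Ai Bi t \<rho> R
  proof
    fix p q
    show "R p q = (0 < p \<and> 0 < q \<and> p + q < \<rho>)" by (rule R_def)
    show "(H has_derivative (\<lambda>v. fst v * L p q (1, 0, 0) + fst (snd v) * L p q (0, 1, 0) + snd (snd v) * L p q (0, 0, 1))) (at (p, q, t))" if "R p q"
      by (rule has_derivative_eq_rhs[OF HL[OF that]], rule ext, rule H_deriv_split[OF HL[OF that]])
  next
    \<comment> \<open>Invariance is required on a full neighbourhood in space and time. Both points
      lie in the open sector at time t, whose size varies continuously, so they stay inside at
      nearby times.\<close>
    fix p q l :: real assume pq: "R p q" and l: "0 < l" "R (l * p) (q / l)"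
    have ct: "(f \<longlongrightarrow> f t) (nhds t)" if "(f has_real_derivative f') (at t)" for f f'
      using DERIV_isCont[OF that] by (simp add: isCont_def tendsto_at_iff_tendsto_nhds)
    have id: "((\<lambda>v. v) \<longlongrightarrow> (p, q, t)) (nhds (p, q, t))" by (rule filterlim_ident)
    have f1: "((\<lambda>v. fst v) \<longlongrightarrow> p) (nhds (p, q, t))" and f2: "((\<lambda>v. fst (snd v)) \<longlongrightarrow> q) (nhds (p, q, t))"
      and f3: "((\<lambda>v. snd (snd v)) \<longlongrightarrow> t) (nhds (p, q, t))"
      using tendsto_fst[OF id] tendsto_fst[OF tendsto_snd[OF id]] tendsto_snd[OF tendsto_snd[OF id]] by simp_all
    have g: "((\<lambda>v. \<kappa>1 * (\<beta> (snd (snd v)) + \<delta> (snd (snd v)))) \<longlongrightarrow> \<rho>) (nhds (p, q, t))"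
      unfolding \<rho>_def by (intro tendsto_intros filterlim_compose[OF ct[OF \<beta>_deriv[OF t]] f3] filterlim_compose[OF ct[OF \<delta>_deriv[OF t]] f3])
    have "\<forall>\<^sub>F v in nhds (p, q, t). 0 < \<kappa>1 * (\<beta> (snd (snd v)) + \<delta> (snd (snd v))) - (fst v + fst (snd v))"
      using pq by (intro order_tendstoD(1)[OF tendsto_diff[OF g tendsto_add[OF f1 f2]]]) (auto simp: R_def)
    moreover have "((\<lambda>v. l * fst v + fst (snd v) / l) \<longlongrightarrow> l * p + q / l) (nhds (p, q, t))"
      using l by (intro tendsto_intros f1 f2) auto
    then have "\<forall>\<^sub>F v in nhds (p, q, t). 0 < \<kappa>1 * (\<beta> (snd (snd v)) + \<delta> (snd (snd v))) - (l * fst v + fst (snd v) / l)"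
      using l(2) by (intro order_tendstoD(1)[OF tendsto_diff[OF g]]) (auto simp: R_def)
    moreover have "\<forall>\<^sub>F v in nhds (p, q, t). 0 < fst v" using pq by (intro order_tendstoD(1)[OF f1]) (auto simp: R_def)
    moreover have "\<forall>\<^sub>F v in nhds (p, q, t). 0 < fst (snd v)" using pq by (intro order_tendstoD(1)[OF f2]) (auto simp: R_def)
    moreover have "\<forall>\<^sub>F v in nhds (p, q, t). a < snd (snd v)" using t by (intro order_tendstoD(1)[OF f3]) auto
    moreover have "\<forall>\<^sub>F v in nhds (p, q, t). snd (snd v) < b" using t by (intro order_tendstoD(2)[OF f3]) auto
    ultimately show "\<forall>\<^sub>F v in nhds (p, q, t). H (l * fst v, fst (snd v) / l, snd (snd v)) = H v"
    proof eventually_elim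
      case (elim v)
      then have "H (l * fst v, fst (snd v) / l, snd (snd v)) = H (fst v, fst (snd v), snd (snd v))"
        using l(1) by (intro H_invariant) auto
      then show ?case by simp
    qed
  next
    fix p q assume pq: "R p q"
    define x where "x = X (p, q, t)"
    note x = X_props[OF t R[OF pq], folded x_def]
    have "0 = L p q (Ai p q, Bi p q, 1)"
      using \<theta>_chain[OF x(1) t x(4), of "(u x t, 1)"] pde[OF t, of x]
      unfolding x(3) L_def Ai_def Bi_def x_def[symmetric] snd_conv by simp
    also have "\<dots> = Ai p q * L p q (1, 0, 0) + Bi p q * L p q (0, 1, 0) + L p q (0, 0, 1)"
      using H_deriv_split[OF HL[OF pq], of "(Ai p q, Bi p q, 1)"] by simp
    finally show "L p q (0, 0, 1) + L p q (1, 0, 0) * Ai p q + L p q (0, 1, 0) * Bi p q = 0" by (simp add: algebra_simps)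
  next
    fix k :: real assume k: "0 < k"
    show "\<exists>p q. R p q \<and> p * q < k \<and> (L p q (1, 0, 0) \<noteq> 0 \<or> L p q (0, 1, 0) \<noteq> 0)"
    \<comment> \<open>If both spatial derivatives of \<open>H\<close> vanished wherever p q < k, the
      spatial gradient of \<theta> would vanish on an open set around the point with factors (e, e),
      so \<theta> would be constant on a disc.\<close>
    proof (rule ccontr)
      assume "\<not> ?thesis"
      then have z: "L p q (1, 0, 0) = 0" "L p q (0, 1, 0) = 0" if "R p q" "p * q < k" for p q using that by blast+
      define fA where "fA x = \<beta> t * F x t $ 1 + F x t $ 2" for x
      define fB where "fB x = \<delta> t * F x t $ 1 - F x t $ 2" for x
      have cA: "continuous_on (ball x0 r) fA" "continuous_on (ball x0 r) fB"
        unfolding fA_def fB_def by (intro continuous_intros continuous_on_F t)+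
      define N where "N = {x \<in> ball x0 r. norm (F x t) < \<kappa>} \<inter> {x \<in> ball x0 r. 0 < fA x} \<inter> {x \<in> ball x0 r. 0 < fB x}
         \<inter> {x \<in> ball x0 r. fA x + fB x < \<rho>} \<inter> {x \<in> ball x0 r. fA x * fB x < k}"
      have op: "open {x \<in> ball x0 r. h x < m}" if "continuous_on (ball x0 r) h" for h and m :: real
      proof -
        have "{x \<in> ball x0 r. h x < m} = ball x0 r \<inter> h -` {..<m}" by auto
        then show ?thesis using continuous_open_preimage[OF that] by (simp only: open_ball open_lessThan)
      qed
      have op': "open {x \<in> ball x0 r. 0 < h x}" if "continuous_on (ball x0 r) h" for h :: "real^2 \<Rightarrow> real"
      proof -
        have "{x \<in> ball x0 r. 0 < h x} = ball x0 r \<inter> h -` {0<..}" by auto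
        then show ?thesis using continuous_open_preimage[OF that] by (simp only: open_ball open_greaterThan)
      qed
      have "open N"
        unfolding N_def by (intro open_Int op op' cA continuous_on_norm continuous_on_F t continuous_on_add continuous_on_mult)
      define e where "e = min (\<rho> / 3) (min 1 (k / 2))"
      have e: "0 < e" "e + e < \<rho>" "e * e < k"
      proof -
        show "0 < e" "e + e < \<rho>" using \<rho> k by (auto simp: e_def)
        have "e * e \<le> 1 * (k / 2)" using \<open>0 < e\<close> by (intro mult_mono) (auto simp: e_def)
        then show "e * e < k" using k by simp
      qed
      have ee: "R e e" using e by (simp add: R_def)
      define x1 where "x1 = X (e, e, t)"
      note x1 = X_props[OF t R[OF ee], folded x1_def]
      have "fA x1 = e" "fB x1 = e" using x1(3) by (simp_all add: W_def fA_def fB_def)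
      then have "x1 \<in> N" using x1 e by (simp add: N_def)
      then obtain s where s: "s > 0" "ball x1 s \<subseteq> N" using \<open>open N\<close> by (meson openE)
      have "N \<subseteq> ball x0 r" unfolding N_def by blast
      with s(2) ball_U have "ball x1 s \<subseteq> U" by (meson subset_trans)
      then obtain y y' where y: "y \<in> ball x1 s" "y' \<in> ball x1 s" "\<theta> y t \<noteq> \<theta> y' t"
        using \<theta>_nonconst[OF t s(1)] by blast
      have zero: "((\<lambda>x. \<theta> x t) has_derivative (\<lambda>h. 0)) (at x within ball x1 s)" if x: "x \<in> ball x1 s" for x
      proof -
        have xN: "x \<in> ball x0 r" "norm (F x t) < \<kappa>" "R (fA x) (fB x)" "fA x * fB x < k" using x s(2) by (auto simp: N_def R_def)
        have Wx: "W (x, t) = (fA x, fB x, t)" by (simp add: W_def fA_def fB_def)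
        have "\<theta>' (x, t) (h, 0) = 0" for h
          using \<theta>_chain[OF xN(1) t xN(2), of "(h, 0)"] H_deriv_split[OF HL[OF xN(3)], of "(A' x t (h, 0), B' x t (h, 0), 0)"] z[OF xN(3,4)]
          by (simp add: Wx L_def)
        then have "(\<lambda>h. \<theta>' (x, t) (h, 0)) = (\<lambda>h. 0)" by (intro ext)
        with has_derivative_slice[OF \<theta>_deriv[OF t, of x]]
        have "((\<lambda>x. \<theta> x t) has_derivative (\<lambda>h. 0)) (at x)" by (simp only:)
        then show ?thesis by (rule has_derivative_at_withinI)
      qed
      have "\<exists>c. \<forall>x\<in>ball x1 s. \<theta> x t = c"
        by (rule has_derivative_zero_constant[OF convex_ball zero])
      with y show False by metis
    qed
  next
    define Tri where "Tri = {p. 0 \<le> fst p \<and> 0 \<le> snd p \<and> fst p + snd p < \<rho>}"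
    have cX: "continuous_on Tri (\<lambda>p. X (fst p, snd p, t))"
      using continuous_on_X[OF t] by (simp add: Tri_def \<rho>_def)
    have im: "(\<lambda>p. X (fst p, snd p, t)) ` Tri \<subseteq> ball x0 r"
      using X_props(1)[OF t] by (auto simp: Tri_def \<rho>_def)
    have "continuous_on (ball x0 r) (\<lambda>x. A' x t (u x t, 1))" "continuous_on (ball x0 r) (\<lambda>x. B' x t (u x t, 1))"
      unfolding A'_def B'_def snd_conv by (intro continuous_intros continuous_on_F continuous_on_F'_u t)+
    from this[THEN continuous_on_compose2, OF cX im]
    show "continuous_on {p. 0 \<le> fst p \<and> 0 \<le> snd p \<and> fst p + snd p < \<rho>} (\<lambda>p. Ai (fst p) (snd p))"
      "continuous_on {p. 0 \<le> fst p \<and> 0 \<le> snd p \<and> fst p + snd p < \<rho>} (\<lambda>p. Bi (fst p) (snd p))"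
      by (simp_all add: Ai_def Bi_def Tri_def)
  qed
  show "0 < p \<Longrightarrow> p < \<kappa>1 * (\<beta> t + \<delta> t) \<Longrightarrow> B' (X (p, 0, t)) t (u (X (p, 0, t)) t, 1) = 0"
    using B'_axis[of p] by (simp add: Bi_def \<rho>_def)
  show "0 < p \<Longrightarrow> p < \<kappa>1 * (\<beta> t + \<delta> t) \<Longrightarrow> A' (X (0, p, t)) t (u (X (0, p, t)) t, 1) = 0"
    using A'_axis[of p] by (simp add: Ai_def \<rho>_def)
qed

end

section \<open>The stream function along the separatrices\<close>

locale qg_saddle_stream = qg_saddle U F x0 r a b K c \<kappa> F' g \<beta> \<delta> \<beta>' \<delta>' \<theta> \<theta>' u C
  for U F x0 r a b K c \<kappa> F' g \<beta> \<delta> \<beta>' \<delta>' \<theta> \<theta>' u C +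
  fixes \<psi> :: "real^2 \<Rightarrow> real \<Rightarrow> real" and C1 :: real
  assumes u_eq: "t \<in> {a<..<b} \<Longrightarrow> u x t = perp_grad (\<lambda>z. \<psi> z t) x"
    and \<psi>_diff: "t \<in> {a<..<b} \<Longrightarrow> (\<lambda>z. \<psi> z t) differentiable (at x)"
    and \<psi>_modulus: "t \<in> {a<..<b} \<Longrightarrow> norm (z1 - z2) \<le> D \<Longrightarrow> 0 < D \<Longrightarrow> \<bar>\<psi> z1 t - \<psi> z2 t\<bar> \<le> C1 * (D * (1 + \<bar>ln D\<bar>))"
begin

lemma F'_split:
  assumes "x \<in> ball x0 r" "t \<in> {a<..<b}"
  shows "F' (x, t) (h, s) $ i = h $ 1 * F' (x, t) (axis 1 1, 0) $ i + h $ 2 * F' (x, t) (axis 2 1, 0) $ i + s * F' (x, t) (0, 1) $ i"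
proof -
  have L: "linear (F' (x, t))" by (rule F'_linear[OF assms])
  have "(h, s) = (h $ 1) *\<^sub>R (axis 1 1, 0) + (h $ 2) *\<^sub>R (axis 2 1, 0) + s *\<^sub>R (0, 1)"
    using exhaust_2 by (auto simp: prod_eq_iff vec_eq_iff axis_def forall_2)
  then have "F' (x, t) (h, s) = F' (x, t) ((h $ 1) *\<^sub>R (axis 1 1, 0) + (h $ 2) *\<^sub>R (axis 2 1, 0) + s *\<^sub>R (0, 1))" by (rule arg_cong)
  also have "\<dots> = (h $ 1) *\<^sub>R F' (x, t) (axis 1 1, 0) + (h $ 2) *\<^sub>R F' (x, t) (axis 2 1, 0) + s *\<^sub>R F' (x, t) (0, 1)"
    by (simp only: linear_add[OF L] linear_scale[OF L])
  finally show ?thesis by simp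
qed

text \<open>With u = perp_grad \<psi>, the derivative of \<psi> in a direction h is the cross
  product of h and u. Mapping both vectors by the spatial derivative of \<open>F\<close> multiplies
  their cross product by \<open>J\<close> and sends h to \<eta>.\<close>

lemma stream_along_ray:
  assumes t: "t \<in> {a<..<b}" and n: "norm (s *\<^sub>R \<eta>) < \<kappa>"
  defines "x \<equiv> g (s *\<^sub>R \<eta>) t"
  shows "\<exists>d. ((\<lambda>s. \<psi> (g (s *\<^sub>R \<eta>) t) t) has_real_derivative d) (at s) \<and>
    J x t * d = \<eta> $ 1 * F' (x, t) (u x t, 0) $ 2 - \<eta> $ 2 * F' (x, t) (u x t, 0) $ 1"
proof -
  have x: "x \<in> ball x0 r" using g[OF n t] by (simp add: x_def)
  obtain B where B: "linear B" "\<And>v. F' (x, t) (B v, 0) = v"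
    "((\<lambda>q. g (fst q) (snd q)) has_derivative (\<lambda>w. B (fst w - F' (x, t) (0, snd w)))) (at (s *\<^sub>R \<eta>, t))"
    using g_has_derivative[OF n t] unfolding x_def by blast
  have z: "F' (x, t) (0, 0) = 0" using linear_0[OF F'_linear[OF x t]] by (simp add: zero_prod_def)
  have "((\<lambda>s. (s *\<^sub>R \<eta>, t)) has_derivative (\<lambda>h. (h *\<^sub>R \<eta>, 0))) (at s)"
    by (intro has_derivative_Pair has_derivative_const has_derivative_scaleR_left has_derivative_ident)
  from has_derivative_compose[OF this B(3)]
  have dg: "((\<lambda>s. g (s *\<^sub>R \<eta>) t) has_derivative (\<lambda>h. h *\<^sub>R B \<eta>)) (at s)"
    by (simp add: z linear_scale[OF B(1)])
  define D where "D = frechet_derivative (\<lambda>z. \<psi> z t) (at x)"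
  have D: "((\<lambda>z. \<psi> z t) has_derivative D) (at (g (s *\<^sub>R \<eta>) t))"
    using \<psi>_diff[OF t] unfolding D_def x_def by (simp only: frechet_derivative_works)
  have Dl: "linear D" by (rule has_derivative_linear[OF D])
  have "((\<lambda>s. \<psi> (g (s *\<^sub>R \<eta>) t) t) has_derivative (\<lambda>h. D (h *\<^sub>R B \<eta>))) (at s)"
    by (rule has_derivative_compose[OF dg D])
  then have d: "((\<lambda>s. \<psi> (g (s *\<^sub>R \<eta>) t) t) has_real_derivative D (B \<eta>)) (at s)"
    unfolding has_field_derivative_def by (simp add: linear_scale[OF Dl] mult.commute[of _ "D (B \<eta>)"])
  define h where "h = B \<eta>"
  define m where "m i j = F' (x, t) (axis j 1, 0) $ i" for i j :: 2
  define \<psi>1 where "\<psi>1 = D (axis 1 1)"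
  define \<psi>2 where "\<psi>2 = D (axis 2 1)"
  have "h = (h $ 1) *\<^sub>R axis 1 1 + (h $ 2) *\<^sub>R axis 2 1"
    by (simp add: vec_eq_iff axis_def forall_2)
  then have "D h = D ((h $ 1) *\<^sub>R axis 1 1 + (h $ 2) *\<^sub>R axis 2 1)" by (rule arg_cong)
  then have Dh: "D h = h $ 1 * \<psi>1 + h $ 2 * \<psi>2"
    by (simp only: linear_add[OF Dl] linear_scale[OF Dl] real_scaleR_def \<psi>1_def \<psi>2_def)
  have uc: "u x t $ 1 = - \<psi>2" "u x t $ 2 = \<psi>1"
    unfolding u_eq[OF t] perp_grad_def grad_def \<psi>1_def \<psi>2_def D_def by simp_all
  have \<eta>: "\<eta> $ i = h $ 1 * m i 1 + h $ 2 * m i 2" for i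
    using B(2)[of \<eta>] F'_split[OF x t, of h 0 i] by (simp add: h_def m_def)
  have Fu: "F' (x, t) (u x t, 0) $ i = - \<psi>2 * m i 1 + \<psi>1 * m i 2" for i
    using F'_split[OF x t, of "u x t" 0 i] by (simp add: m_def uc)
  have "J x t * D h = \<eta> $ 1 * F' (x, t) (u x t, 0) $ 2 - \<eta> $ 2 * F' (x, t) (u x t, 0) $ 1"
    unfolding J_eq Dh \<eta> Fu m_def[symmetric] by (simp add: algebra_simps)
  with d show ?thesis unfolding h_def by blast
qed

text \<open>In the chart the separatrices are the lines y_2 = \<delta> y_1 and y_2 = - \<beta> y_1;
  normalising the first component parametrises both by s = y_1.\<close>

definition ray :: "real \<Rightarrow> real^2" where
  "ray m = (\<chi> i. if i = 1 then 1 else m)"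

lemma Y_rays:
  assumes t: "t \<in> {a<..<b}"
  shows "Y ((\<beta> t + \<delta> t) * s, 0, t) = s *\<^sub>R ray (\<delta> t)" "Y (0, (\<beta> t + \<delta> t) * s, t) = s *\<^sub>R ray (- \<beta> t)"
  using \<gamma>_pos[OF t] by (simp_all add: saddle_point_def ray_def vec_eq_iff)

text \<open>\<open>B'_separatrix\<close> eliminates the velocity from the cross product of
  \<open>stream_along_ray\<close>: what remains are the time derivatives of \<delta> and of the
  chart.\<close>

lemma plus_branch:
  assumes t: "t \<in> {a<..<b}" and s: "0 < s" "s < \<kappa>1"
  defines "x \<equiv> g (s *\<^sub>R ray (\<delta> t)) t"
  shows "norm (s *\<^sub>R ray (\<delta> t)) < \<kappa>" "x \<in> ball x0 r" "F x t = s *\<^sub>R ray (\<delta> t)"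
    "\<exists>d. ((\<lambda>s. \<psi> (g (s *\<^sub>R ray (\<delta> t)) t) t) has_real_derivative d) (at s) \<and>
      J x t * d = \<delta>' t * s + \<delta> t * F' (x, t) (0, 1) $ 1 - F' (x, t) (0, 1) $ 2"
proof -
  define p where "p = (\<beta> t + \<delta> t) * s"
  have p: "0 < p" "p < \<kappa>1 * (\<beta> t + \<delta> t)" using s \<gamma>_pos[OF t] by (auto simp: p_def mult.commute)
  have Xx: "X (p, 0, t) = x" by (simp add: X_def p_def Y_rays[OF t] x_def)
  have pp: "0 \<le> p" "(0::real) \<le> 0" "p + 0 < \<kappa>1 * (\<beta> t + \<delta> t)" using p by auto
  note X = X_props[OF t pp, unfolded Xx]
  show n: "norm (s *\<^sub>R ray (\<delta> t)) < \<kappa>" using Y_norm[OF t pp] by (simp add: p_def Y_rays[OF t])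
  show x: "x \<in> ball x0 r" by (rule X(1))
  show Fx: "F x t = s *\<^sub>R ray (\<delta> t)" using X(2) by (simp add: p_def Y_rays[OF t])
  have b: "\<delta>' t * s + \<delta> t * F' (x, t) (u x t, 1) $ 1 - F' (x, t) (u x t, 1) $ 2 = 0"
    using B'_separatrix[OF t p] unfolding Xx B'_def Fx by (simp add: ray_def)
  have sp: "F' (x, t) (u x t, 1) $ i = F' (x, t) (u x t, 0) $ i + F' (x, t) (0, 1) $ i" for i
    using F'_split[OF x t, of "u x t" 1 i] F'_split[OF x t, of "u x t" 0 i] by simp
  obtain d where d: "((\<lambda>s. \<psi> (g (s *\<^sub>R ray (\<delta> t)) t) t) has_real_derivative d) (at s)"
      "J x t * d = ray (\<delta> t) $ 1 * F' (x, t) (u x t, 0) $ 2 - ray (\<delta> t) $ 2 * F' (x, t) (u x t, 0) $ 1"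
    using stream_along_ray[OF t n] unfolding x_def by blast
  have "J x t * d = \<delta>' t * s + \<delta> t * F' (x, t) (0, 1) $ 1 - F' (x, t) (0, 1) $ 2"
    using b unfolding sp d(2) by (simp add: ray_def algebra_simps)
  with d(1) show "\<exists>d. ((\<lambda>s. \<psi> (g (s *\<^sub>R ray (\<delta> t)) t) t) has_real_derivative d) (at s) \<and>
      J x t * d = \<delta>' t * s + \<delta> t * F' (x, t) (0, 1) $ 1 - F' (x, t) (0, 1) $ 2" by blast
qed

lemma minus_branch:
  assumes t: "t \<in> {a<..<b}" and s: "0 < s" "s < \<kappa>1"
  defines "x \<equiv> g (s *\<^sub>R ray (- \<beta> t)) t"
  shows "norm (s *\<^sub>R ray (- \<beta> t)) < \<kappa>" "x \<in> ball x0 r" "F x t = s *\<^sub>R ray (- \<beta> t)"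
    "\<exists>d. ((\<lambda>s. \<psi> (g (s *\<^sub>R ray (- \<beta> t)) t) t) has_real_derivative d) (at s) \<and>
      J x t * d = - (\<beta>' t * s + \<beta> t * F' (x, t) (0, 1) $ 1 + F' (x, t) (0, 1) $ 2)"
proof -
  define p where "p = (\<beta> t + \<delta> t) * s"
  have p: "0 < p" "p < \<kappa>1 * (\<beta> t + \<delta> t)" using s \<gamma>_pos[OF t] by (auto simp: p_def mult.commute)
  have Xx: "X (0, p, t) = x" by (simp add: X_def p_def Y_rays[OF t] x_def)
  have pp: "(0::real) \<le> 0" "0 \<le> p" "0 + p < \<kappa>1 * (\<beta> t + \<delta> t)" using p by auto
  note X = X_props[OF t pp, unfolded Xx]
  show n: "norm (s *\<^sub>R ray (- \<beta> t)) < \<kappa>" using Y_norm[OF t pp] by (simp add: p_def Y_rays[OF t])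
  show x: "x \<in> ball x0 r" by (rule X(1))
  show Fx: "F x t = s *\<^sub>R ray (- \<beta> t)" using X(2) by (simp add: p_def Y_rays[OF t])
  have b: "\<beta>' t * s + \<beta> t * F' (x, t) (u x t, 1) $ 1 + F' (x, t) (u x t, 1) $ 2 = 0"
    using A'_separatrix[OF t p] unfolding Xx A'_def Fx by (simp add: ray_def)
  have sp: "F' (x, t) (u x t, 1) $ i = F' (x, t) (u x t, 0) $ i + F' (x, t) (0, 1) $ i" for i
    using F'_split[OF x t, of "u x t" 1 i] F'_split[OF x t, of "u x t" 0 i] by simp
  obtain d where d: "((\<lambda>s. \<psi> (g (s *\<^sub>R ray (- \<beta> t)) t) t) has_real_derivative d) (at s)"
      "J x t * d = ray (- \<beta> t) $ 1 * F' (x, t) (u x t, 0) $ 2 - ray (- \<beta> t) $ 2 * F' (x, t) (u x t, 0) $ 1"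
    using stream_along_ray[OF t n] unfolding x_def by blast
  have "J x t * d = - (\<beta>' t * s + \<beta> t * F' (x, t) (0, 1) $ 1 + F' (x, t) (0, 1) $ 2)"
    using b unfolding sp d(2) by (simp add: ray_def algebra_simps)
  with d(1) show "\<exists>d. ((\<lambda>s. \<psi> (g (s *\<^sub>R ray (- \<beta> t)) t) t) has_real_derivative d) (at s) \<and>
      J x t * d = - (\<beta>' t * s + \<beta> t * F' (x, t) (0, 1) $ 1 + F' (x, t) (0, 1) $ 2)" by blast
qed

end

section \<open>The differential inequality for the opening angle\<close>

context qg_saddle_stream begin

lemma C1_nonneg: "0 \<le> C1"
proof -
  have "(a + b) / 2 \<in> {a<..<b}" using ab by auto
  from \<psi>_modulus[OF this, of 0 0 1] show ?thesis by simp
qed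

text \<open>The formulas of \<open>plus_branch\<close> and \<open>minus_branch\<close> at equal
  parameters are subtracted. The corresponding points are at distance O(\<gamma>) by
  \<open>expand\<close>, so all chart terms differ by O(\<gamma>), and only the difference of the
  derivatives of \<psi> brings in the logarithm.\<close>

lemma opening_angle_derivative_le:
  "\<exists>C2. \<forall>t\<in>{a<..<b}. \<bar>\<beta>' t + \<delta>' t\<bar> \<le> C2 * ((\<beta> t + \<delta> t) * (1 + \<bar>ln (\<beta> t + \<delta> t)\<bar>))"
proof -
  \<comment> \<open>The parameter multiplies the derivatives of \<beta> and \<delta> in the branch
    formulas, so it must stay away from 0; on [s1, s2] it can be divided out at the cost of 3 /
    \<kappa>1.\<close>
  define s1 where "s1 = \<kappa>1 / 3"
  define s2 where "s2 = 2 * \<kappa>1 / 3"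
  have s12: "0 < s1" "s1 < s2" "s2 < \<kappa>1" "s2 - s1 = \<kappa>1 / 3" using \<kappa>1_pos by (auto simp: s1_def s2_def)
  \<comment> \<open>The oscillation of \<psi> over the chart ball, of diameter 2 r.\<close>
  define B where "B = C1 * (2 * r * (1 + \<bar>ln (2 * r)\<bar>))"
  define C\<delta> where "C\<delta> = (3 / \<kappa>1) * (2 * K\<^sup>2 * (3 / \<kappa>1 * B) + (C + 1) * K)"
  define Cd where "Cd = (C\<delta> * \<kappa>1 + (C + 1) * K) / c"
  define P where "P = K * \<kappa>1"
  have P: "0 < P" using K \<kappa>1_pos by (simp add: P_def)
  define C2 where "C2 = (3 / \<kappa>1) * (2 * K\<^sup>2 * (6 / \<kappa>1 * (C1 * (P * (1 + \<bar>ln P\<bar>)))) + C * K * P + K + K * P + 4 * K\<^sup>2 * P * Cd)"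
  have "\<bar>\<beta>' t + \<delta>' t\<bar> \<le> C2 * ((\<beta> t + \<delta> t) * (1 + \<bar>ln (\<beta> t + \<delta> t)\<bar>))" if t: "t \<in> {a<..<b}" for t
  proof -
    define \<gamma> where "\<gamma> = \<beta> t + \<delta> t"
    have \<gamma>: "\<gamma> > 0" using \<gamma>_pos[OF t] by (simp add: \<gamma>_def)
    define xp where "xp s = g (s *\<^sub>R ray (\<delta> t)) t" for s
    define xm where "xm s = g (s *\<^sub>R ray (- \<beta> t)) t" for s
    define fA where "fA x = F' (x, t) (0, 1) $ 1" for x
    define fB where "fB x = F' (x, t) (0, 1) $ 2" for x
    have xp: "xp s \<in> ball x0 r" "F (xp s) t = s *\<^sub>R ray (\<delta> t)" if "s \<in> {0<..<\<kappa>1}" for s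
      using plus_branch(2,3)[OF t, of s] that by (auto simp: xp_def)
    have xm: "xm s \<in> ball x0 r" "F (xm s) t = s *\<^sub>R ray (- \<beta> t)" if "s \<in> {0<..<\<kappa>1}" for s
      using minus_branch(2,3)[OF t, of s] that by (auto simp: xm_def)
    have "\<forall>s\<in>{0<..<\<kappa>1}. \<exists>d. ((\<lambda>s. \<psi> (xp s) t) has_real_derivative d) (at s) \<and> J (xp s) t * d = \<delta>' t * s + \<delta> t * fA (xp s) - fB (xp s)"
      using plus_branch(4)[OF t] by (auto simp: xp_def fA_def fB_def)
    then obtain dp where dp: "\<And>s. s \<in> {0<..<\<kappa>1} \<Longrightarrow> ((\<lambda>s. \<psi> (xp s) t) has_real_derivative dp s) (at s)"
      "\<And>s. s \<in> {0<..<\<kappa>1} \<Longrightarrow> J (xp s) t * dp s = \<delta>' t * s + \<delta> t * fA (xp s) - fB (xp s)"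
      by metis
    have "\<forall>s\<in>{0<..<\<kappa>1}. \<exists>d. ((\<lambda>s. \<psi> (xm s) t) has_real_derivative d) (at s) \<and> J (xm s) t * d = - (\<beta>' t * s + \<beta> t * fA (xm s) + fB (xm s))"
      using minus_branch(4)[OF t] by (auto simp: xm_def fA_def fB_def)
    then obtain dm where dm: "\<And>s. s \<in> {0<..<\<kappa>1} \<Longrightarrow> ((\<lambda>s. \<psi> (xm s) t) has_real_derivative dm s) (at s)"
      "\<And>s. s \<in> {0<..<\<kappa>1} \<Longrightarrow> J (xm s) t * dm s = - (\<beta>' t * s + \<beta> t * fA (xm s) + fB (xm s))"
      by metis
    have F_le: "\<bar>fA x\<bar> \<le> K" "\<bar>fB x\<bar> \<le> K" if "x \<in> ball x0 r" for x
      using component_le[OF that t, of "(0, 1)"] by (simp_all add: fA_def fB_def norm_Pair)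
    have C\<delta>A: "\<bar>\<delta> t * fA x - fB x\<bar> \<le> (C + 1) * K" if "x \<in> ball x0 r" for x
    proof -
      have "\<bar>\<delta> t * fA x\<bar> \<le> C * K" unfolding abs_mult using \<delta>_le[OF t] F_le[OF that] C_nonneg by (intro mult_mono) auto
      then show ?thesis using F_le(2)[OF that] by (simp add: distrib_right)
    qed
    \<comment> \<open>The functions \<beta> and \<delta> are continuously differentiable only on the
      half-open time interval, so a bound for their derivatives up to its end has to come from the
      equation: one branch alone and the oscillation of \<psi> give it.\<close>
    have \<delta>'_le: "\<bar>\<delta>' t\<bar> \<le> C\<delta>"
    proof -
      obtain \<xi> where \<xi>: "s1 < \<xi>" "\<xi> < s2" "\<psi> (xp s2) t - \<psi> (xp s1) t = (s2 - s1) * dp \<xi>"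
        using MVT2[OF s12(2), of "\<lambda>s. \<psi> (xp s) t" dp] dp(1) s12 by auto
      have \<xi>': "\<xi> \<in> {0<..<\<kappa>1}" using \<xi> s12 by auto
      have "norm (xp s2 - xp s1) \<le> 2 * r"
        using xp(1)[of s1] xp(1)[of s2] s12 dist_triangle_less_add[of "xp s2" x0 r "xp s1" r]
        by (auto simp: dist_norm norm_minus_commute)
      then have "\<bar>(s2 - s1) * dp \<xi>\<bar> \<le> B" unfolding \<xi>(3)[symmetric] B_def using r by (intro \<psi>_modulus t) auto
      then have d: "\<bar>dp \<xi>\<bar> \<le> 3 / \<kappa>1 * B" unfolding s12(4) abs_mult using \<kappa>1_pos by (simp add: field_simps)
      have x: "xp \<xi> \<in> ball x0 r" by (rule xp(1)[OF \<xi>'])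
      have "\<delta>' t * \<xi> = J (xp \<xi>) t * dp \<xi> - (\<delta> t * fA (xp \<xi>) - fB (xp \<xi>))" using dp(2)[OF \<xi>'] by simp
      then have "\<bar>\<delta>' t\<bar> * \<xi> \<le> \<bar>J (xp \<xi>) t * dp \<xi>\<bar> + \<bar>\<delta> t * fA (xp \<xi>) - fB (xp \<xi>)\<bar>"
        using \<xi>' abs_triangle_ineq4[of "J (xp \<xi>) t * dp \<xi>" "\<delta> t * fA (xp \<xi>) - fB (xp \<xi>)"] abs_mult[of "\<delta>' t" \<xi>] by simp
      also have "\<dots> \<le> 2 * K\<^sup>2 * (3 / \<kappa>1 * B) + (C + 1) * K"
        unfolding abs_mult[of "J (xp \<xi>) t"] using x by (intro add_mono mult_mono J_le d C\<delta>A t) auto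
      finally have "\<bar>\<delta>' t\<bar> * \<xi> \<le> 2 * K\<^sup>2 * (3 / \<kappa>1 * B) + (C + 1) * K" .
      moreover have "\<bar>\<delta>' t\<bar> * (\<kappa>1 / 3) \<le> \<bar>\<delta>' t\<bar> * \<xi>" using \<xi>(1) by (intro mult_left_mono) (auto simp: s1_def)
      ultimately have "\<bar>\<delta>' t\<bar> * (\<kappa>1 / 3) \<le> 2 * K\<^sup>2 * (3 / \<kappa>1 * B) + (C + 1) * K" by linarith
      then have "(3 / \<kappa>1) * (\<bar>\<delta>' t\<bar> * (\<kappa>1 / 3)) \<le> C\<delta>"
        unfolding C\<delta>_def using \<kappa>1_pos by (intro mult_left_mono) auto
      then show ?thesis using \<kappa>1_pos by simp
    qed
    have dp_le: "\<bar>dp s\<bar> \<le> Cd" if s: "s \<in> {0<..<\<kappa>1}" for s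
    proof -
      have x: "xp s \<in> ball x0 r" by (rule xp(1)[OF s])
      have "c * \<bar>dp s\<bar> \<le> \<bar>J (xp s) t * dp s\<bar>" unfolding abs_mult by (intro mult_right_mono J_ge x t) auto
      also have "J (xp s) t * dp s = \<delta>' t * s + (\<delta> t * fA (xp s) - fB (xp s))" using dp(2)[OF s] by simp
      also have "\<bar>\<dots>\<bar> \<le> \<bar>\<delta>' t * s\<bar> + \<bar>\<delta> t * fA (xp s) - fB (xp s)\<bar>" by (rule abs_triangle_ineq)
      also have "\<dots> \<le> C\<delta> * \<kappa>1 + (C + 1) * K"
      proof (intro add_mono C\<delta>A x)
        have "0 \<le> C\<delta>" using \<delta>'_le by linarith
        then show "\<bar>\<delta>' t * s\<bar> \<le> C\<delta> * \<kappa>1" unfolding abs_mult using s \<delta>'_le by (intro mult_mono) auto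
      qed
      finally show ?thesis unfolding Cd_def using c by (simp add: pos_le_divide_eq mult.commute)
    qed
    define D where "D = P * \<gamma>"
    have D: "D > 0" using P \<gamma> by (simp add: D_def)
    have dist_pm: "norm (xp s - xm s) \<le> D" if s: "s \<in> {0<..<\<kappa>1}" for s
    proof -
      have e: "s *\<^sub>R ray (\<delta> t) - s *\<^sub>R ray (- \<beta> t) = (s * \<gamma>) *\<^sub>R axis 2 1"
        using exhaust_2 by (auto simp: vec_eq_iff ray_def axis_def forall_2 \<gamma>_def algebra_simps)
      have "norm (xp s - xm s) \<le> K * norm (F (xp s) t - F (xm s) t)"
        by (intro expand xp xm s t)
      also have "\<dots> = K * (s * \<gamma>)" using s \<gamma> by (simp add: xp(2)[OF s] xm(2)[OF s] e abs_mult)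
      also have "\<dots> \<le> K * (\<kappa>1 * \<gamma>)" using s \<gamma> K by (intro mult_left_mono mult_right_mono) auto
      finally show ?thesis by (simp add: D_def P_def mult.assoc)
    qed
    define h where "h s = \<psi> (xp s) t - \<psi> (xm s) t" for s
    define E0 where "E0 = C1 * (D * (1 + \<bar>ln D\<bar>))"
    have h_le: "\<bar>h s\<bar> \<le> E0" if s: "s \<in> {0<..<\<kappa>1}" for s
      unfolding h_def E0_def by (rule \<psi>_modulus[OF t dist_pm[OF s] D])
    have "(h has_real_derivative dp s - dm s) (at s)" if "s \<in> {0<..<\<kappa>1}" for s
      unfolding h_def by (rule DERIV_diff[OF dp(1)[OF that] dm(1)[OF that]])
    \<comment> \<open>The modulus controls values of \<psi> only. The mean value theorem turns this
      into a bound for the difference of the derivatives at some \<xi>, and the branch formulas hold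
      at every parameter.\<close>
    then obtain \<xi> where \<xi>: "s1 < \<xi>" "\<xi> < s2" "h s2 - h s1 = (s2 - s1) * (dp \<xi> - dm \<xi>)"
      using MVT2[OF s12(2), of h "\<lambda>s. dp s - dm s"] s12 by auto
    have \<xi>': "\<xi> \<in> {0<..<\<kappa>1}" using \<xi> s12 by auto
    define x where "x = xp \<xi>"
    define y where "y = xm \<xi>"
    have x: "x \<in> ball x0 r" and y: "y \<in> ball x0 r" unfolding x_def y_def by (rule xp(1)[OF \<xi>'], rule xm(1)[OF \<xi>'])
    have xy: "norm (x - y) \<le> D" unfolding x_def y_def by (rule dist_pm[OF \<xi>'])
    have "\<bar>(s2 - s1) * (dp \<xi> - dm \<xi>)\<bar> \<le> 2 * E0"
      using h_le[of s1] h_le[of s2] s12 abs_triangle_ineq4[of "h s2" "h s1"] unfolding \<xi>(3)[symmetric] by auto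
    then have dd: "\<bar>dp \<xi> - dm \<xi>\<bar> \<le> 6 / \<kappa>1 * E0" unfolding s12(4) abs_mult using \<kappa>1_pos by (simp add: field_simps)
    have Jp: "J x t * dp \<xi> = \<delta>' t * \<xi> + \<delta> t * fA x - fB x" unfolding x_def by (rule dp(2)[OF \<xi>'])
    have Jm: "J y t * dm \<xi> = - (\<beta>' t * \<xi> + \<beta> t * fA y + fB y)" unfolding y_def by (rule dm(2)[OF \<xi>'])
    \<comment> \<open>Every term on the right is small with the distance of the two separatrices, apart from the first,
      which is a difference of stream function values across the thin sector.\<close>
    have key: "(\<beta>' t + \<delta>' t) * \<xi> = J y t * (dp \<xi> - dm \<xi>) + - (\<delta> t * (fA x - fA y)) + - (\<gamma> * fA y) + (fB x - fB y) + (J x t - J y t) * dp \<xi>"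
      using Jp Jm unfolding \<gamma>_def by (simp add: algebra_simps)
    have "\<bar>(\<beta>' t + \<delta>' t) * \<xi>\<bar> \<le> \<bar>J y t * (dp \<xi> - dm \<xi>)\<bar> + \<bar>\<delta> t * (fA x - fA y)\<bar> + \<bar>\<gamma> * fA y\<bar> + \<bar>fB x - fB y\<bar> + \<bar>(J x t - J y t) * dp \<xi>\<bar>"
      unfolding key by linarith
    also have "\<dots> \<le> 2 * K\<^sup>2 * (6 / \<kappa>1 * E0) + C * (K * D) + \<gamma> * K + K * D + (4 * K\<^sup>2 * D) * Cd"
    proof (intro add_mono)
      show "\<bar>J y t * (dp \<xi> - dm \<xi>)\<bar> \<le> 2 * K\<^sup>2 * (6 / \<kappa>1 * E0)"
        unfolding abs_mult by (intro mult_mono J_le y t dd) auto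
      have comp: "\<bar>F' (x, t) (0, 1) $ i - F' (y, t) (0, 1) $ i\<bar> \<le> K * D" for i
      proof -
        have "\<bar>F' (x, t) (0, 1) $ i - F' (y, t) (0, 1) $ i\<bar> \<le> K * norm (x - y) * norm (0 :: real^2, 1::real)"
          by (rule component_lipschitz[OF x y t])
        also have "\<dots> \<le> K * D" using xy K by (simp add: norm_Pair)
        finally show ?thesis .
      qed
      show "\<bar>fB x - fB y\<bar> \<le> K * D" unfolding fB_def by (rule comp)
      show "\<bar>\<delta> t * (fA x - fA y)\<bar> \<le> C * (K * D)"
        unfolding abs_mult fA_def using C_nonneg by (intro mult_mono \<delta>_le t comp) auto
      show "\<bar>\<gamma> * fA y\<bar> \<le> \<gamma> * K" unfolding abs_mult using \<gamma> F_le(1)[OF y] by simp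
      have "\<bar>J x t - J y t\<bar> \<le> 4 * K\<^sup>2 * D"
        using J_lipschitz[OF x y t] mult_left_mono[OF xy, of "4 * K\<^sup>2"] by simp
      then show "\<bar>(J x t - J y t) * dp \<xi>\<bar> \<le> (4 * K\<^sup>2 * D) * Cd"
        unfolding abs_mult using D by (intro mult_mono dp_le \<xi>') auto
    qed
    finally have main: "\<bar>\<beta>' t + \<delta>' t\<bar> * \<xi> \<le> 2 * K\<^sup>2 * (6 / \<kappa>1 * E0) + C * (K * D) + \<gamma> * K + K * D + (4 * K\<^sup>2 * D) * Cd"
      using \<xi>' by (simp add: abs_mult)
    define \<Lambda> where "\<Lambda> = \<gamma> * (1 + \<bar>ln \<gamma>\<bar>)"
    have \<Lambda>: "\<gamma> \<le> \<Lambda>" using \<gamma> by (simp add: \<Lambda>_def)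
    have E0: "E0 \<le> C1 * (P * (1 + \<bar>ln P\<bar>)) * \<Lambda>"
    proof -
      \<comment> \<open>This absorbs the fixed factor P: 1 + |ln D| is at most the product of 1 +
        |ln P| and 1 + |ln \<gamma>|.\<close>
      have "ln D = ln P + ln \<gamma>" using P \<gamma> by (simp add: D_def ln_mult)
      then have "1 + \<bar>ln D\<bar> \<le> 1 + \<bar>ln P\<bar> + \<bar>ln \<gamma>\<bar> + \<bar>ln P\<bar> * \<bar>ln \<gamma>\<bar>"
        using mult_nonneg_nonneg[OF abs_ge_zero abs_ge_zero, of "ln P" "ln \<gamma>"] by linarith
      also have "\<dots> = (1 + \<bar>ln P\<bar>) * (1 + \<bar>ln \<gamma>\<bar>)" by (simp add: algebra_simps)
      finally have "C1 * (D * (1 + \<bar>ln D\<bar>)) \<le> C1 * (D * ((1 + \<bar>ln P\<bar>) * (1 + \<bar>ln \<gamma>\<bar>)))"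
        using C1_nonneg D by (intro mult_left_mono) auto
      then show ?thesis unfolding E0_def by (simp add: D_def \<Lambda>_def mult_ac)
    qed
    have Cd0: "0 \<le> Cd" using dp_le[OF \<xi>'] by linarith
    have D\<Lambda>: "D \<le> P * \<Lambda>" unfolding D_def using \<Lambda> P by simp
    have "2 * K\<^sup>2 * (6 / \<kappa>1 * E0) \<le> 2 * K\<^sup>2 * (6 / \<kappa>1 * (C1 * (P * (1 + \<bar>ln P\<bar>)) * \<Lambda>))"
      using \<kappa>1_pos by (intro mult_left_mono E0) auto
    moreover have "C * (K * D) \<le> C * (K * (P * \<Lambda>))" using C_nonneg K by (intro mult_left_mono D\<Lambda>) auto
    moreover have "\<gamma> * K \<le> \<Lambda> * K" using \<Lambda> K by simp
    moreover have "K * D \<le> K * (P * \<Lambda>)" using K by (intro mult_left_mono D\<Lambda>) auto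
    moreover have "(4 * K\<^sup>2 * D) * Cd \<le> (4 * K\<^sup>2 * (P * \<Lambda>)) * Cd"
      using Cd0 by (intro mult_right_mono mult_left_mono D\<Lambda>) auto
    moreover have "\<bar>\<beta>' t + \<delta>' t\<bar> * (\<kappa>1 / 3) \<le> \<bar>\<beta>' t + \<delta>' t\<bar> * \<xi>" using \<xi>(1) by (intro mult_left_mono) (auto simp: s1_def)
    ultimately have "\<bar>\<beta>' t + \<delta>' t\<bar> * (\<kappa>1 / 3) \<le> 2 * K\<^sup>2 * (6 / \<kappa>1 * (C1 * (P * (1 + \<bar>ln P\<bar>)) * \<Lambda>)) + C * (K * (P * \<Lambda>)) + \<Lambda> * K
        + K * (P * \<Lambda>) + (4 * K\<^sup>2 * (P * \<Lambda>)) * Cd"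
      using main by linarith
    then have "(3 / \<kappa>1) * (\<bar>\<beta>' t + \<delta>' t\<bar> * (\<kappa>1 / 3)) \<le> (3 / \<kappa>1) * (2 * K\<^sup>2 * (6 / \<kappa>1 * (C1 * (P * (1 + \<bar>ln P\<bar>)) * \<Lambda>)) + C * (K * (P * \<Lambda>)) + \<Lambda> * K
        + K * (P * \<Lambda>) + (4 * K\<^sup>2 * (P * \<Lambda>)) * Cd)"
      using \<kappa>1_pos by (intro mult_left_mono) auto
    also have "\<dots> = C2 * \<Lambda>" unfolding C2_def by (simp only: distrib_left distrib_right mult_ac)
    finally have "\<bar>\<beta>' t + \<delta>' t\<bar> \<le> C2 * \<Lambda>" using \<kappa>1_pos by simp
    then show ?thesis by (simp add: \<Lambda>_def \<gamma>_def)
  qed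
  then show ?thesis by blast
qed

end

lemma moving_chart_mono:
  assumes "moving_chart U F x0 r a b K c \<kappa> F' g" "a \<le> a'" "a' < b"
  shows "moving_chart U F x0 r a' b K c \<kappa> F' g"
proof -
  interpret moving_chart U F x0 r a b K c \<kappa> F' g by fact
  have t: "t \<in> {a<..<b}" if "t \<in> {a'<..<b}" for t using that assms(2) by simp
  show ?thesis
    by unfold_locales (use ball_U r K c \<kappa> assms(3) deriv[OF _ t] F'_le[OF _ t] F'_lip[OF _ _ t] det_ge[OF _ t] g[OF _ t] expand[OF _ _ t] in blast)+
qed

section \<open>The theorem\<close>

lemma C_upto_real_derivative:
  fixes f :: "real \<Rightarrow> real"
  assumes "C_upto 1 D E f" "t \<in> D"
  shows "(f has_real_derivative deriv f t) (at t)"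
proof -
  have "f differentiable (at t)" using C_upto_differentiable[OF assms(1), of "[]" t] assms(2) by simp
  then show ?thesis
    by (simp add: DERIV_deriv_iff_real_differentiable)
qed

lemma continuous_on_perp_grad:
  fixes f :: "real^2 \<Rightarrow> real"
  assumes "C_upto 2 UNIV UNIV f"
  shows "continuous_on S (perp_grad f)"
proof -
  have p: "continuous_on S (\<lambda>x. frechet_derivative f (at x) b)" if "b \<in> Basis" for b
  proof -
    have "iter_partial [b] f differentiable (at x)" for x
      using that by (intro C_upto_differentiable[OF assms]) auto
    then show ?thesis
      by (intro continuous_at_imp_continuous_on ballI differentiable_imp_continuous_within) simp
  qed
  have "continuous_on S (\<lambda>x. \<chi> i::2. if i = 1 then - frechet_derivative f (at x) (axis 2 1) else frechet_derivative f (at x) (axis 1 1))"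
  proof (intro continuous_on_vec_lambda)
    fix i :: 2
    show "continuous_on S (\<lambda>x. if i = 1 then - frechet_derivative f (at x) (axis 2 1) else frechet_derivative f (at x) (axis 1 1))"
      by (cases "i = 1") (auto intro!: continuous_intros p)
  qed
  moreover have "perp_grad f = (\<lambda>x. \<chi> i::2. if i = 1 then - frechet_derivative f (at x) (axis 2 1) else frechet_derivative f (at x) (axis 1 1))"
    by (simp add: fun_eq_iff vec_eq_iff perp_grad_def grad_def forall_2)
  ultimately show ?thesis by (simp only:)
qed

text \<open>At an interior time the derivative within the half-open interval is two-sided, so it
  agrees with the time part of \<open>L\<close>; the spatial part of \<open>L\<close> is the
  gradient, and the two cancel.\<close>

lemma transport_joint_derivative:
  fixes \<theta> :: "real^2 \<Rightarrow> real \<Rightarrow> real"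
  assumes L: "((\<lambda>q. \<theta> (fst q) (snd q)) has_derivative L) (at (x, t))"
    and t: "0 < t" "t < T"
    and pde: "((\<lambda>s. \<theta> x s) has_real_derivative - (w \<bullet> grad (\<lambda>z. \<theta> z t) x)) (at t within {0..<T})"
  shows "L (w, 1) = 0"
proof -
  have lin: "linear L" by (rule has_derivative_linear[OF L])
  have gr: "grad (\<lambda>z. \<theta> z t) x $ i = L (axis i 1, 0)" for i
    using fun_cong[OF frechet_derivative_at[OF has_derivative_slice[OF L]], of "axis i 1"] by (simp add: grad_def)
  have "((\<lambda>s. (x, s)) has_derivative (\<lambda>h. (0, h))) (at t)"
    by (rule has_derivative_Pair[OF has_derivative_const has_derivative_ident])
  from has_derivative_compose[OF this L]
  have "((\<lambda>s. \<theta> x s) has_derivative (\<lambda>h. L (0, h))) (at t)" by simp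
  moreover have "((\<lambda>s. \<theta> x s) has_real_derivative - (w \<bullet> grad (\<lambda>z. \<theta> z t) x)) (at t)"
    using pde t by (subst (asm) at_within_interior) (auto simp: interior_atLeastLessThan)
  ultimately have "(\<lambda>h. L (0, h)) = (*) (- (w \<bullet> grad (\<lambda>z. \<theta> z t) x))"
    unfolding has_field_derivative_def by (rule has_derivative_unique)
  from fun_cong[OF this, of 1] have Lt: "L (0, 1) = - (w \<bullet> grad (\<lambda>z. \<theta> z t) x)" by simp
  have "(w, 1) = (w $ 1) *\<^sub>R (axis 1 1, 0) + (w $ 2) *\<^sub>R (axis 2 1, 0) + (0, 1)"
    by (auto simp: prod_eq_iff vec_eq_iff axis_def forall_2)
  then have "L (w, 1) = L ((w $ 1) *\<^sub>R (axis 1 1, 0) + (w $ 2) *\<^sub>R (axis 2 1, 0) + (0, 1))" by (rule arg_cong)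
  also have "\<dots> = w $ 1 * L (axis 1 1, 0) + w $ 2 * L (axis 2 1, 0) + L (0, 1)"
    by (simp only: linear_add[OF lin] linear_scale[OF lin] real_scaleR_def)
  also have "\<dots> = w \<bullet> grad (\<lambda>z. \<theta> z t) x + L (0, 1)" by (simp add: inner_vec_def sum_2 gr)
  finally show ?thesis by (simp add: Lt)
qed

lemma constant_along_connected:
  assumes "constant_along_saddle T U \<beta> \<delta> F \<theta>" and t: "t \<in> {0..<T}"
    and \<Gamma>: "connected \<Gamma>" "\<Gamma> \<subseteq> {x \<in> U. saddle_rho \<beta> \<delta> F x t = k}" and xy: "x \<in> \<Gamma>" "y \<in> \<Gamma>"
  shows "\<theta> x t = \<theta> y t"
proof -
  define S where "S = {x \<in> U. saddle_rho \<beta> \<delta> F x t = k}"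
  have "S \<noteq> {}" using \<Gamma>(2) xy(1) by (auto simp: S_def)
  then obtain c where c: "c \<in> components S" "\<Gamma> \<subseteq> c"
    using exists_component_superset[of \<Gamma> S] \<Gamma> by (auto simp: S_def)
  then have "(\<lambda>x. \<theta> x t) constant_on c"
    using assms(1) t unfolding constant_along_saddle_def S_def by blast
  then show ?thesis using c(2) xy unfolding constant_on_def by (metis subsetD)
qed

theorem theorem1:
  fixes T :: real
    and U :: "(real^2) set"
    and \<theta>0 :: "real^2 \<Rightarrow> real"
    and \<theta> \<psi> :: "real^2 \<Rightarrow> real \<Rightarrow> real"
    and \<beta> \<delta> :: "real \<Rightarrow> real"
    and F :: "real^2 \<Rightarrow> real \<Rightarrow> real^2"
  assumes "0 < T"
    and "smooth_qg_solution T \<theta>0 \<theta> \<psi>"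
    and "simple_saddle T U \<beta> \<delta> F"
    and nondegenerate: "\<exists>t\<in>{0..<T}. opening_angle \<beta> \<delta> t \<noteq> 0"
    and "constant_along_saddle T U \<beta> \<delta> F \<theta>"
    and "\<forall>t\<in>{0..<T}. \<forall>a r. 0 < r \<and> ball a r \<subseteq> U \<longrightarrow> \<not> (\<lambda>x. \<theta> x t) constant_on ball a r"
  shows "\<exists>L. L \<noteq> 0 \<and> (opening_angle \<beta> \<delta> \<longlongrightarrow> L) (at_left T)"
proof -
  have \<theta>_smooth: "smooth_upto (UNIV \<times> {0<..<T}) (UNIV \<times> {0..<T}) (\<lambda>(x, t). \<theta> x t)"
    and \<psi>_smooth: "\<forall>t\<in>{0..<T}. smooth_upto UNIV UNIV (\<lambda>x. \<psi> x t)"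
    and hl: "\<forall>t\<in>{0..<T}. has_half_laplacian (\<lambda>x. \<psi> x t) (\<lambda>x. - \<theta> x t)"
    and pde: "\<forall>x. \<forall>t\<in>{0..<T}. ((\<lambda>s. \<theta> x s) has_real_derivative
           - (perp_grad (\<lambda>z. \<psi> z t) x \<bullet> grad (\<lambda>z. \<theta> z t) x)) (at t within {0..<T})"
    and bdd: "\<exists>M. \<forall>x. \<forall>t\<in>{0..<T}. \<bar>\<theta> x t\<bar> \<le> M"
    and L2: "\<forall>t\<in>{0..<T}. integrable lborel (\<lambda>x. (\<theta> x t)\<^sup>2) \<and>
        (LINT x|lborel. (\<theta> x t)\<^sup>2) = (LINT x|lborel. (\<theta>0 x)\<^sup>2)"
    using assms(2) unfolding smooth_qg_solution_def by - (elim conjE, assumption)+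
  have \<beta>C: "C_upto 1 {0<..<T} {0..<T} \<beta>" and \<delta>C: "C_upto 1 {0<..<T} {0..<T} \<delta>"
    and \<beta>\<delta>_bdd: "\<exists>C. \<forall>t\<in>{0..<T}. \<bar>\<beta> t\<bar> \<le> C \<and> \<bar>\<delta> t\<bar> \<le> C"
    and \<gamma>_nonneg: "\<forall>t\<in>{0..<T}. 0 \<le> \<beta> t + \<delta> t"
    using assms(3) unfolding simple_saddle_def by - (elim conjE, assumption)+
  obtain M where M: "\<And>x t. t \<in> {0..<T} \<Longrightarrow> \<bar>\<theta> x t\<bar> \<le> M" using bdd by blast
  obtain C where C: "\<And>t. t \<in> {0..<T} \<Longrightarrow> \<bar>\<beta> t\<bar> \<le> C" "\<And>t. t \<in> {0..<T} \<Longrightarrow> \<bar>\<delta> t\<bar> \<le> C" using \<beta>\<delta>_bdd by blast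
  define L where "L = (LINT x|lborel. (\<theta>0 x)\<^sup>2)"
  define C1 where "C1 = 2 * (2 * M + 24 * pi\<^sup>2 * M + L + 36 * pi\<^sup>2)"
  define \<theta>' where "\<theta>' q = frechet_derivative (\<lambda>q. \<theta> (fst q) (snd q)) (at q)" for q
  have \<theta>'_deriv: "((\<lambda>q. \<theta> (fst q) (snd q)) has_derivative \<theta>' (x, t)) (at (x, t))" if "t \<in> {0<..<T}" for x t
  proof -
    have "C_upto 1 (UNIV \<times> {0<..<T}) (UNIV \<times> {0..<T}) (\<lambda>q. \<theta> (fst q) (snd q))"
      using \<theta>_smooth unfolding smooth_upto_def case_prod_unfold by blast
    from C_upto_differentiable[OF this, of "[]" "(x, t)"] that
    have "(\<lambda>q. \<theta> (fst q) (snd q)) differentiable (at (x, t))" by simp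
    then show ?thesis unfolding \<theta>'_def by (simp only: frechet_derivative_works)
  qed
  have \<psi>C: "C_upto k UNIV UNIV (\<lambda>z. \<psi> z t)" if "t \<in> {0..<T}" for k t
    using \<psi>_smooth that unfolding smooth_upto_def by blast
  have \<psi>_diff: "(\<lambda>z. \<psi> z t) differentiable (at x)" if "t \<in> {0..<T}" for x t
    using C_upto_differentiable[OF \<psi>C[OF that, of 1], of "[]" x] by simp
  have modulus: "\<bar>\<psi> z1 t - \<psi> z2 t\<bar> \<le> C1 * (D * (1 + \<bar>ln D\<bar>))"
    if t: "t \<in> {0<..<T}" and D: "norm (z1 - z2) \<le> D" "0 < D" for t z1 z2 D
  proof -
    have t0: "t \<in> {0..<T}" using t by auto
    interpret half_laplacian_pair "\<lambda>x. \<psi> x t" "\<lambda>x. \<theta> x t" M L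
    proof
      show "continuous_on UNIV (\<lambda>x. \<psi> x t)" using \<psi>C[OF t0, of 0] unfolding C_upto_def by blast
      show "continuous_on UNIV (\<lambda>x. \<theta> x t)"
        by (intro continuous_at_imp_continuous_on ballI has_derivative_continuous[OF has_derivative_slice[OF \<theta>'_deriv[OF t]]])
    qed (use hl M L2 t0 in \<open>auto simp: L_def\<close>)
    show ?thesis unfolding C1_def by (rule log_lipschitz[OF D])
  qed
  obtain t0 where t0: "t0 \<in> {0..<T}" "\<beta> t0 + \<delta> t0 \<noteq> 0"
    using nondegenerate unfolding opening_angle_def by blast
  have t0_pos: "0 < \<beta> t0 + \<delta> t0"
    using bspec[OF \<gamma>_nonneg t0(1)] t0(2) by linarith
  \<comment> \<open>The local step is carried out for an arbitrary end time \<open>t1\<close>, since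
    \<gamma> might a priori vanish before \<open>T\<close>.\<close>
  have "\<exists>l>0. ((\<lambda>t. \<beta> t + \<delta> t) \<longlongrightarrow> l) (at_left T)"
  proof (rule positive_limit_continuation[where \<gamma> = "\<lambda>t. \<beta> t + \<delta> t"])
    show "t0 \<in> {0..<T}" "0 < \<beta> t0 + \<delta> t0" by (rule t0(1), rule t0_pos)
    show "continuous_on {0..<T} (\<lambda>t. \<beta> t + \<delta> t)"
      using \<beta>C \<delta>C unfolding C_upto_def by (intro continuous_on_add) blast+
  next
    fix t1 assume t1: "t0 < t1" "t1 \<le> T" and pos: "\<forall>t\<in>{t0<..<t1}. 0 < \<beta> t + \<delta> t"
    have "0 < t1" using t0 t1 by auto
    then obtain x0 r a0 K c \<kappa> F' g where a0: "0 \<le> a0" and chart: "moving_chart U F x0 r a0 t1 K c \<kappa> F' g"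
      using ex_moving_chart[OF assms(3) _ t1(2)] by blast
    \<comment> \<open>The chart is available after \<open>a0\<close> and positivity of the angle
      after \<open>t0\<close>.\<close>
    define a where "a = max a0 t0"
    have "a0 < t1" using moving_chart.ab[OF chart] .
    then have at1: "a < t1" using t1 by (simp add: a_def)
    have sub: "t \<in> {0<..<T}" "t \<in> {0..<T}" "t \<in> {t0<..<t1}" if "t \<in> {a<..<t1}" for t
      using that t1 a0 by (auto simp: a_def)
    define u where "u x t = perp_grad (\<lambda>z. \<psi> z t) x" for x t
    interpret moving_chart U F x0 r a t1 K c \<kappa> F' g
      by (rule moving_chart_mono[OF chart _ at1]) (simp add: a_def)
    interpret qg_saddle_stream U F x0 r a t1 K c \<kappa> F' g \<beta> \<delta> "deriv \<beta>" "deriv \<delta>" \<theta> \<theta>' u C \<psi> C1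
    proof
      fix t assume t: "t \<in> {a<..<t1}"
      note t' = sub[OF t]
      show "(\<beta> has_real_derivative deriv \<beta> t) (at t)" "(\<delta> has_real_derivative deriv \<delta> t) (at t)"
        by (rule C_upto_real_derivative[OF \<beta>C t'(1)], rule C_upto_real_derivative[OF \<delta>C t'(1)])
      show "\<bar>\<beta> t\<bar> \<le> C" "\<bar>\<delta> t\<bar> \<le> C" by (rule C(1)[OF t'(2)], rule C(2)[OF t'(2)])
      show "0 < \<beta> t + \<delta> t" using pos t'(3) by blast
      show "((\<lambda>q. \<theta> (fst q) (snd q)) has_derivative \<theta>' (x, t)) (at (x, t))" for x by (rule \<theta>'_deriv[OF t'(1)])
      show "\<theta>' (x, t) (u x t, 1) = 0" for x
        using t'(1,2) pde by (intro transport_joint_derivative[OF \<theta>'_deriv[OF t'(1)]]) (auto simp: u_def)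
      show "continuous_on (ball x0 r) (\<lambda>x. u x t)"
        unfolding u_def by (rule continuous_on_perp_grad[OF \<psi>C[OF t'(2)]])
      show "\<theta> x t = \<theta> y t" if "connected \<Gamma>" "\<Gamma> \<subseteq> {x \<in> U. saddle_rho \<beta> \<delta> F x t = k}" "x \<in> \<Gamma>" "y \<in> \<Gamma>" for \<Gamma> k x y
        by (rule constant_along_connected[OF assms(5) t'(2) that])
      show "\<exists>x\<in>ball z s. \<exists>y\<in>ball z s. \<theta> x t \<noteq> \<theta> y t" if s: "0 < s" "ball z s \<subseteq> U" for z s
      proof -
        have "\<not> (\<lambda>x. \<theta> x t) constant_on ball z s" using assms(6) t'(2) s by blast
        then show ?thesis unfolding constant_on_def by blast
      qed
      show "u x t = perp_grad (\<lambda>z. \<psi> z t) x" for x by (simp add: u_def)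
      show "(\<lambda>z. \<psi> z t) differentiable (at x)" for x by (rule \<psi>_diff[OF t'(2)])
      show "\<bar>\<psi> z1 t - \<psi> z2 t\<bar> \<le> C1 * (D * (1 + \<bar>ln D\<bar>))" if "norm (z1 - z2) \<le> D" "0 < D" for z1 z2 D
        by (rule modulus[OF t'(1) that])
    qed
    obtain C2 where C2: "\<And>t. t \<in> {a<..<t1} \<Longrightarrow> \<bar>deriv \<beta> t + deriv \<delta> t\<bar> \<le> C2 * ((\<beta> t + \<delta> t) * (1 + \<bar>ln (\<beta> t + \<delta> t)\<bar>))"
      using opening_angle_derivative_le by blast
    show "\<exists>l>0. ((\<lambda>t. \<beta> t + \<delta> t) \<longlongrightarrow> l) (at_left t1)"
      by (rule osgood_positive_limit[OF at1 DERIV_add[OF \<beta>_deriv \<delta>_deriv] \<gamma>_pos C2])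
  qed
  then obtain l where "l > 0" "((\<lambda>t. \<beta> t + \<delta> t) \<longlongrightarrow> l) (at_left T)" by blast
  then show ?thesis unfolding opening_angle_def[abs_def] by (intro exI[of _ l]) simp
qed

end
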